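(* Let $L$ be a frame and let $e\colon L\to L^\delta$ be a canonical extension of $L$. Then $e$ is injective if and only if, for all open sublocales $U,V\subseteq L$, $$U\subseteq V\quad\text{iff}\quad\text{for every compact fitted sublocale } K\subseteq L,\ K\subseteq U \text{ implies } K\subseteq V.$$ Moreover, the Ultrafilter Principle is equivalent (over choice-free set theory) to the statement that every frame whose canonical extension is injective is spatial.
   Context: A frame is a complete lattice in which finite meets distribute over arbitrary joins. A filter of $L$ is an upset closed under finite meets (the improper filter is allowed). A filter $\kappa\subseteq L$ is Scott-open if, whenever $D\subseteq L$ is directed and $\bigvee D\in\kappa$, then $d\in\kappa$ for some $d\in D$. $L^{\wedge}$ denotes the set of Scott-open filters of $L$. A canonical extension of a frame $L$ is a monotone map $e\colon L\to L^\delta$ into a complete lattice $L^\delta$ such that: (Dense) for all $u,v\in L^\delta$: $u\le v$ holds provided that for all $\kappa\in L^{\wedge}$ and $a\in L$, the inequalities $\bigwedge e[\kappa]\le u$ and $v\le e(a)$ together imply $\bigwedge e[\kappa]\le e(a)$; (Compact) if $\bigwedge e[\kappa]\le e(a)$ for some $\kappa\in L^{\wedge}$ and $a\in L$, then $a\in\kappa$. Every frame has a canonical extension, unique up to isomorphism. A nucleus on $L$ is a closure operator $\nu\colon L\to L$ preserving binary meets; a sublocale of $L$ is the set of fixpoints of a nucleus, and it is a frame in the induced order. Sublocales are ordered by inclusion, and meets of sublocales are intersections. The open sublocale of $a\in L$ is $U_a=\{x\in L\mid x=(a\to x)\}$, where $\to$ is Heyting implication. A sublocale is fitted if it is an intersection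 of open sublocales, and compact if it is compact as a frame. A frame is spatial if it is isomorphic to the frame of open sets of some topological space. The Ultrafilter Principle: every proper filter on a set extends to an ultrafilter. *)

theory Defs
  imports Main "HOL-Library.Lub_Glb"
begin

section \<open>Frames, canonical extensions and sublocales\<close>

text \<open>The library class \<open>complete_distrib_lattice\<close> means completely distributive, which is
  stronger than being a frame.\<close>

class frame = complete_lattice +
  assumes inf_Sup_frame: "inf a (Sup S) = (SUP s\<in>S. inf a s)"

definition is_filter :: "'a::frame set \<Rightarrow> bool" where
  "is_filter \<kappa> \<longleftrightarrow>
     (\<forall>x\<in>\<kappa>. \<forall>y. x \<le> y \<longrightarrow> y \<in> \<kappa>) \<and> top \<in> \<kappa> \<and> (\<forall>x\<in>\<kappa>. \<forall>y\<in>\<kappa>. inf x y \<in> \<kappa>)"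

definition directed :: "'a::order set \<Rightarrow> bool" where
  "directed D \<longleftrightarrow> D \<noteq> {} \<and> (\<forall>x\<in>D. \<forall>y\<in>D. \<exists>z\<in>D. x \<le> z \<and> y \<le> z)"

definition scott_open_filter :: "'a::frame set \<Rightarrow> bool" where
  "scott_open_filter \<kappa> \<longleftrightarrow>
     is_filter \<kappa> \<and> (\<forall>D. directed D \<and> Sup D \<in> \<kappa> \<longrightarrow> (\<exists>d\<in>D. d \<in> \<kappa>))"

definition canonical_extension :: "('a::frame \<Rightarrow> 'b::complete_lattice) \<Rightarrow> bool" where
  "canonical_extension e \<longleftrightarrow>
     mono e \<and>
     (\<forall>u v. (\<forall>\<kappa> a. scott_open_filter \<kappa> \<longrightarrow> Inf (e ` \<kappa>) \<le> u \<and> v \<le> e a \<longrightarrow> Inf (e ` \<kappa>) \<le> e a)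
        \<longrightarrow> u \<le> v) \<and>
     (\<forall>\<kappa> a. scott_open_filter \<kappa> \<and> Inf (e ` \<kappa>) \<le> e a \<longrightarrow> a \<in> \<kappa>)"

definition nucleus :: "('a::frame \<Rightarrow> 'a) \<Rightarrow> bool" where
  "nucleus \<nu> \<longleftrightarrow>
     mono \<nu> \<and> (\<forall>x. x \<le> \<nu> x) \<and> (\<forall>x. \<nu> (\<nu> x) = \<nu> x) \<and> (\<forall>x y. \<nu> (inf x y) = inf (\<nu> x) (\<nu> y))"

definition is_sublocale :: "'a::frame set \<Rightarrow> bool" where
  "is_sublocale K \<longleftrightarrow> (\<exists>\<nu>. nucleus \<nu> \<and> K = {x. \<nu> x = x})"

definition heyting_imp :: "'a::frame \<Rightarrow> 'a \<Rightarrow> 'a" where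
  "heyting_imp a b = Sup {c. inf a c \<le> b}"

definition open_sublocale :: "'a::frame \<Rightarrow> 'a set" where
  "open_sublocale a = {x. x = heyting_imp a x}"

definition fitted_sublocale :: "'a::frame set \<Rightarrow> bool" where
  "fitted_sublocale K \<longleftrightarrow> is_sublocale K \<and> (\<exists>A. K = (\<Inter>a\<in>A. open_sublocale a))"

text \<open>Joins in the frame \<open>K\<close> are least upper bounds within \<open>K\<close>; they differ from joins in the
  ambient frame. The top element of a sublocale is that of the ambient frame.\<close>

definition compact_sublocale :: "'a::frame set \<Rightarrow> bool" where
  "compact_sublocale K \<longleftrightarrow>
     is_sublocale K \<and>
     (\<forall>S\<subseteq>K. isLub K S top \<longrightarrow> (\<exists>F\<subseteq>S. finite F \<and> isLub K F top))"


section \<open>Models of ZF\<close>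

text \<open>HOL has a choice operator and proves the Ultrafilter Principle, so an equivalence over
  choice-free set theory is not expressed by an equivalence of HOL propositions. Instead, a structure
  for the language of set theory is a type \<open>'v\<close> with an arbitrary relation \<open>mem\<close>, and an equivalence
  holds over ZF if it holds in every model of the ZF axioms (by soundness and completeness of
  first-order logic, this is the same as provability in ZF).

  Below, every defined predicate on \<open>'v\<close> is the interpretation of a first-order formula: the bound
  variables range over \<open>'v\<close>, and HOL sets occur only as comprehensions abbreviating such formulas.
  There is no quantification over HOL sets of, or HOL functions on, elements of \<open>'v\<close>.
  The formulas in the separation and replacement schemes are coded by the type \<open>fm\<close>.\<close>

datatype fm = Mem nat nat | Eq nat nat | Neg fm | Conj fm fm | Ex nat fm

locale set_structure =
  fixes mem :: "'v \<Rightarrow> 'v \<Rightarrow> bool"  (infix \<open>\<epsilon>\<close> 50)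
begin

primrec sat :: "fm \<Rightarrow> (nat \<Rightarrow> 'v) \<Rightarrow> bool" where
  "sat (Mem i j) \<rho> \<longleftrightarrow> \<rho> i \<epsilon> \<rho> j"
| "sat (Eq i j) \<rho> \<longleftrightarrow> \<rho> i = \<rho> j"
| "sat (Neg \<phi>) \<rho> \<longleftrightarrow> \<not> sat \<phi> \<rho>"
| "sat (Conj \<phi> \<psi>) \<rho> \<longleftrightarrow> sat \<phi> \<rho> \<and> sat \<psi> \<rho>"
| "sat (Ex i \<phi>) \<rho> \<longleftrightarrow> (\<exists>x. sat \<phi> (\<rho>(i := x)))"

definition elts :: "'v \<Rightarrow> 'v set" where
  "elts x = {y. y \<epsilon> x}"

end

text \<open>In separation the element is variable 0; in replacement argument and value are
  variables 0 and 1. All other variables are parameters.\<close>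

locale ZF_model = set_structure +
  assumes extensionality: "elts x = elts y \<Longrightarrow> x = y"
    and foundation: "elts x \<noteq> {} \<Longrightarrow> \<exists>y\<in>elts x. elts y \<inter> elts x = {}"
    and pairing: "\<exists>z. elts z = {x, y}"
    and union: "\<exists>u. elts u = (\<Union>y\<in>elts x. elts y)"
    and power_set: "\<exists>p. elts p = {y. elts y \<subseteq> elts x}"
    and infinity: "\<exists>w. (\<exists>z\<in>elts w. elts z = {}) \<and>
        (\<forall>x\<in>elts w. \<exists>y\<in>elts w. elts y = insert x (elts x))"
    and separation: "\<exists>b. elts b = {x \<in> elts a. sat \<phi> (\<rho>(0 := x))}"
    and replacement: "(\<forall>x\<in>elts a. \<exists>!y. sat \<phi> (\<rho>(0 := x, 1 := y))) \<Longrightarrow>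
        \<exists>b. elts b = {y. \<exists>x\<in>elts a. sat \<phi> (\<rho>(0 := x, 1 := y))}"


section \<open>The Ultrafilter Principle and spatiality in a structure for set theory\<close>

context set_structure
begin

text \<open>Kuratowski pairs. Binary relations and functions are sets of pairs.\<close>

definition is_pair :: "'v \<Rightarrow> 'v \<Rightarrow> 'v \<Rightarrow> bool" where
  "is_pair p x y \<longleftrightarrow> (\<exists>s d. elts s = {x} \<and> elts d = {x, y} \<and> elts p = {s, d})"

definition rel :: "'v \<Rightarrow> 'v \<Rightarrow> 'v \<Rightarrow> bool" where
  "rel r x y \<longleftrightarrow> (\<exists>p. is_pair p x y \<and> p \<epsilon> r)"

definition is_fun :: "'v \<Rightarrow> 'v \<Rightarrow> 'v \<Rightarrow> bool" where
  "is_fun f A B \<longleftrightarrow>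
     (\<forall>p. p \<epsilon> f \<longrightarrow> (\<exists>x y. x \<epsilon> A \<and> y \<epsilon> B \<and> is_pair p x y)) \<and>
     (\<forall>x. x \<epsilon> A \<longrightarrow> (\<exists>!y. rel f x y))"

definition is_inj :: "'v \<Rightarrow> bool" where
  "is_inj f \<longleftrightarrow> (\<forall>x x' y. rel f x y \<and> rel f x' y \<longrightarrow> x = x')"

definition set_filter :: "'v \<Rightarrow> 'v \<Rightarrow> bool" where
  "set_filter X F \<longleftrightarrow>
     (\<forall>U. U \<epsilon> F \<longrightarrow> elts U \<subseteq> elts X) \<and> X \<epsilon> F \<and>
     (\<forall>U V. U \<epsilon> F \<and> elts U \<subseteq> elts V \<and> elts V \<subseteq> elts X \<longrightarrow> V \<epsilon> F) \<and>
     (\<forall>U V W. U \<epsilon> F \<and> V \<epsilon> F \<and> elts W = elts U \<inter> elts V \<longrightarrow> W \<epsilon> F)"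

definition proper_set_filter :: "'v \<Rightarrow> 'v \<Rightarrow> bool" where
  "proper_set_filter X F \<longleftrightarrow> set_filter X F \<and> (\<forall>U. U \<epsilon> F \<longrightarrow> elts U \<noteq> {})"

definition set_ultrafilter :: "'v \<Rightarrow> 'v \<Rightarrow> bool" where
  "set_ultrafilter X F \<longleftrightarrow>
     proper_set_filter X F \<and>
     (\<forall>G. proper_set_filter X G \<and> elts F \<subseteq> elts G \<longrightarrow> G = F)"

definition ultrafilter_principle :: bool where
  "ultrafilter_principle \<longleftrightarrow>
     (\<forall>X F. proper_set_filter X F \<longrightarrow> (\<exists>G. set_ultrafilter X G \<and> elts F \<subseteq> elts G))"

text \<open>A poset is given by its carrier \<open>A\<close> and its order relation \<open>r\<close>. In \<open>is_lub A r P j\<close> and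
  \<open>is_glb A r P m\<close>, the argument \<open>P\<close> is \<open>elts S\<close> for some \<open>S\<close> or a definable comprehension.\<close>

definition is_poset :: "'v \<Rightarrow> 'v \<Rightarrow> bool" where
  "is_poset A r \<longleftrightarrow> partial_order_on (elts A) {(x, y). rel r x y}"

definition is_lub :: "'v \<Rightarrow> 'v \<Rightarrow> 'v set \<Rightarrow> 'v \<Rightarrow> bool" where
  "is_lub A r P j \<longleftrightarrow>
     j \<epsilon> A \<and> (\<forall>x\<in>P. rel r x j) \<and> (\<forall>u. u \<epsilon> A \<and> (\<forall>x\<in>P. rel r x u) \<longrightarrow> rel r j u)"

definition is_glb :: "'v \<Rightarrow> 'v \<Rightarrow> 'v set \<Rightarrow> 'v \<Rightarrow> bool" where
  "is_glb A r P m \<longleftrightarrow>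
     m \<epsilon> A \<and> (\<forall>x\<in>P. rel r m x) \<and> (\<forall>l. l \<epsilon> A \<and> (\<forall>x\<in>P. rel r l x) \<longrightarrow> rel r l m)"

definition is_complete_lattice :: "'v \<Rightarrow> 'v \<Rightarrow> bool" where
  "is_complete_lattice A r \<longleftrightarrow>
     is_poset A r \<and>
     (\<forall>S. elts S \<subseteq> elts A \<longrightarrow> (\<exists>j. is_lub A r (elts S) j) \<and> (\<exists>m. is_glb A r (elts S) m))"

definition is_frame :: "'v \<Rightarrow> 'v \<Rightarrow> bool" where
  "is_frame A r \<longleftrightarrow>
     is_complete_lattice A r \<and>
     (\<forall>a S s m. a \<epsilon> A \<and> elts S \<subseteq> elts A \<and> is_lub A r (elts S) s \<and> is_glb A r {a, s} m \<longrightarrow>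
        is_lub A r {t. \<exists>x\<in>elts S. is_glb A r {a, x} t} m)"

definition is_directed :: "'v \<Rightarrow> 'v \<Rightarrow> bool" where
  "is_directed r D \<longleftrightarrow>
     elts D \<noteq> {} \<and> (\<forall>x\<in>elts D. \<forall>y\<in>elts D. \<exists>z\<in>elts D. rel r x z \<and> rel r y z)"

definition is_scott_open_filter :: "'v \<Rightarrow> 'v \<Rightarrow> 'v \<Rightarrow> bool" where
  "is_scott_open_filter A r \<kappa> \<longleftrightarrow>
     elts \<kappa> \<subseteq> elts A \<and>
     (\<forall>x y. x \<epsilon> \<kappa> \<and> rel r x y \<longrightarrow> y \<epsilon> \<kappa>) \<and>
     (\<forall>t. is_glb A r {} t \<longrightarrow> t \<epsilon> \<kappa>) \<and>
     (\<forall>x y m. x \<epsilon> \<kappa> \<and> y \<epsilon> \<kappa> \<and> is_glb A r {x, y} m \<longrightarrow> m \<epsilon> \<kappa>) \<and>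
     (\<forall>D s. elts D \<subseteq> elts A \<and> is_directed r D \<and> is_lub A r (elts D) s \<and> s \<epsilon> \<kappa> \<longrightarrow>
        (\<exists>d\<in>elts D. d \<epsilon> \<kappa>))"

text \<open>\<open>e\<close> is a canonical extension of the frame \<open>(A, r)\<close> into \<open>(B, q)\<close>.
  The predicate \<open>meet_of e B q \<kappa> k\<close> says that \<open>k\<close> is the meet of the direct image \<open>e[\<kappa>]\<close>.\<close>

definition meet_of :: "'v \<Rightarrow> 'v \<Rightarrow> 'v \<Rightarrow> 'v \<Rightarrow> 'v \<Rightarrow> bool" where
  "meet_of e B q \<kappa> k \<longleftrightarrow> is_glb B q {y. \<exists>x\<in>elts \<kappa>. rel e x y} k"

definition is_canonical_extension :: "'v \<Rightarrow> 'v \<Rightarrow> 'v \<Rightarrow> 'v \<Rightarrow> 'v \<Rightarrow> bool" where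
  "is_canonical_extension A r B q e \<longleftrightarrow>
     is_complete_lattice B q \<and> is_fun e A B \<and>
     (\<forall>x x' y y'. rel r x x' \<and> rel e x y \<and> rel e x' y' \<longrightarrow> rel q y y') \<and>
     (\<forall>u v. u \<epsilon> B \<and> v \<epsilon> B \<and>
        (\<forall>\<kappa> k a b. is_scott_open_filter A r \<kappa> \<and> meet_of e B q \<kappa> k \<and> rel e a b \<longrightarrow>
           rel q k u \<and> rel q v b \<longrightarrow> rel q k b)
        \<longrightarrow> rel q u v) \<and>
     (\<forall>\<kappa> k a b. is_scott_open_filter A r \<kappa> \<and> meet_of e B q \<kappa> k \<and> rel e a b \<and> rel q k b \<longrightarrow>
        a \<epsilon> \<kappa>)"

definition is_topology :: "'v \<Rightarrow> 'v \<Rightarrow> bool" where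
  "is_topology X T \<longleftrightarrow>
     (\<forall>U. U \<epsilon> T \<longrightarrow> elts U \<subseteq> elts X) \<and> X \<epsilon> T \<and>
     (\<forall>U V W. U \<epsilon> T \<and> V \<epsilon> T \<and> elts W = elts U \<inter> elts V \<longrightarrow> W \<epsilon> T) \<and>
     (\<forall>S W. elts S \<subseteq> elts T \<and> elts W = (\<Union>U\<in>elts S. elts U) \<longrightarrow> W \<epsilon> T)"

definition is_spatial :: "'v \<Rightarrow> 'v \<Rightarrow> bool" where
  "is_spatial A r \<longleftrightarrow>
     (\<exists>X T f. is_topology X T \<and> is_fun f A T \<and> is_inj f \<and>
        (\<forall>U. U \<epsilon> T \<longrightarrow> (\<exists>x. rel f x U)) \<and>
        (\<forall>x y U V. rel f x U \<and> rel f y V \<longrightarrow> (rel r x y \<longleftrightarrow> elts U \<subseteq> elts V)))"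

text \<open>Canonical extensions are unique up to isomorphism, so the one from the hypothesis may be
  any.\<close>

definition injective_frames_spatial :: bool where
  "injective_frames_spatial \<longleftrightarrow>
     (\<forall>A r B q e. is_frame A r \<and> is_canonical_extension A r B q e \<and> is_inj e \<longrightarrow>
        is_spatial A r)"

end

end

(*
In a canonical extension, e a <= e b holds iff
every Scott-open filter containing a contains b. Hence e is injective iff Scott-open filters
separate the elements of the frame, and by the Hofmann-Mislove correspondence they can be replaced
by compact fitted sublocales.

Ultrafilter Principle ==> spatiality. Given a Scott-open filter kappa and b outside kappa, let N be
the set of elements above b and outside kappa. A single ultrafilter, on the set of relations
S <= A x A each of whose sections S[x] has, together with x, an upper bound in N, containing all
sets that include a dense open set (for the order of inclusion), yields simultaneously for every
x in N a prime ideal Phi(x) containing x and disjoint from kappa. Then x |-> Sup Phi(x) is an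
inflationary map on N, which is closed under joins of chains. By the Bourbaki-Witt theorem, which
needs no choice, it has a fixpoint p, and the ideal Phi(p) is principal with generator p, so that p
is prime.

Spatiality ==> Ultrafilter Principle. The filters containing a given proper filter F form a frame.
Its elements are separated by the Scott-open filters {H. U in H}, so its canonical extension, the
lattice of intersections of Scott-open filters, is injective. A point of this frame is a prime
filter containing F.
*)

theory Submission
  imports Defs
begin

section \<open>Scott-open filters and compact fitted sublocales\<close>

text \<open>A Scott-open filter is usually not completely prime. Given \<open>b\<close> outside it,
  the Ultrafilter Principle provides a prime ideal around \<open>b\<close> that avoids the filter,
  and Scott-openness keeps the join of that ideal outside; but this join need not be prime. The step
  has to be repeated transfinitely, and picking a new prime ideal at every stage would be a choice.
  So one ultrafilter must serve all elements at once, and it lives on relations because a relation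
  approximates the whole family of ideals; the dense open sets ensure that almost every
  approximation settles whether a given element can still enter a given ideal.

  The two halves live in different settings. The criterion on sublocales is a HOL theorem, where
  Zorn's lemma is at hand for the Hofmann-Mislove argument. The equivalence concerns an arbitrary
  model of ZF, where subsets come from separation: each construction is accompanied by a proof that
  a formula with parameters describes it, and the induction behind Bourbaki-Witt is restricted to
  definable predicates.\<close>

lemma le_heyting_imp_iff: "c \<le> heyting_imp a b \<longleftrightarrow> inf a c \<le> (b :: 'a::frame)"
proof
  assume "c \<le> heyting_imp a b"
  then have "inf a c \<le> inf a (Sup {c. inf a c \<le> b})"
    unfolding heyting_imp_def by (rule inf_mono[OF order_refl])
  also have "\<dots> \<le> b" unfolding inf_Sup_frame by (rule SUP_least) simp
  finally show "inf a c \<le> b" .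
qed (simp add: heyting_imp_def Sup_upper)

lemma le_heyting_imp: "b \<le> heyting_imp a (b :: 'a::frame)"
  by (simp add: le_heyting_imp_iff le_infI2)

lemma mem_open_sublocale: "x \<in> open_sublocale a \<longleftrightarrow> heyting_imp a x \<le> (x :: 'a::frame)"
  using le_heyting_imp[of x a] by (auto simp: open_sublocale_def)

text \<open>The test element is \<open>heyting_imp a b\<close>. It always lies in the open sublocale
  of \<open>a\<close>; lying in that of \<open>b\<close> forces it to be \<open>top\<close>, because
  \<open>heyting_imp b (heyting_imp a b)\<close> is \<open>top\<close>. This turns the criterion on
  open sublocales into one on elements of the frame.\<close>

lemma open_sublocale_subset_iff: "open_sublocale a \<subseteq> open_sublocale b \<longleftrightarrow> a \<le> (b :: 'a::frame)"
proof
  assume sub: "open_sublocale a \<subseteq> open_sublocale b"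
  have "inf a (heyting_imp a (heyting_imp a b)) \<le> heyting_imp a b"
    by (simp add: le_heyting_imp_iff[symmetric])
  then have "heyting_imp a b \<in> open_sublocale a"
    unfolding mem_open_sublocale le_heyting_imp_iff by (simp add: inf_left_idem)
  then have "heyting_imp b (heyting_imp a b) \<le> heyting_imp a b"
    using sub mem_open_sublocale by blast
  moreover have "top \<le> heyting_imp b (heyting_imp a b)" by (simp add: le_heyting_imp_iff)
  ultimately have "top \<le> heyting_imp a b" by (rule order_trans[rotated])
  then show "a \<le> b" unfolding le_heyting_imp_iff by simp
next
  assume "a \<le> b"
  then have "heyting_imp b x \<le> heyting_imp a x" for x :: 'a
    unfolding le_heyting_imp_iff
    by (rule order_trans[OF inf_mono[OF _ order_refl]]) (simp add: le_heyting_imp_iff[symmetric])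
  then show "open_sublocale a \<subseteq> open_sublocale b"
    using order_trans by (fastforce simp: mem_open_sublocale)
qed

lemma Inf_mem_open_sublocale:
  assumes "Y \<subseteq> open_sublocale a" shows "Inf Y \<in> open_sublocale (a :: 'a::frame)"
  unfolding mem_open_sublocale
proof (rule Inf_greatest)
  fix y assume "y \<in> Y"
  then have "heyting_imp a y \<le> y" using assms by (auto simp: mem_open_sublocale)
  moreover have "inf a (heyting_imp a (Inf Y)) \<le> Inf Y" by (simp add: le_heyting_imp_iff[symmetric])
  then have "heyting_imp a (Inf Y) \<le> heyting_imp a y"
    unfolding le_heyting_imp_iff by (rule order_trans) (rule Inf_lower[OF \<open>y \<in> Y\<close>])
  ultimately show "heyting_imp a (Inf Y) \<le> y" by (rule order_trans[rotated])
qed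

lemma heyting_imp_mem_open_sublocale:
  assumes "x \<in> open_sublocale a" shows "heyting_imp c x \<in> open_sublocale (a :: 'a::frame)"
proof -
  have "inf c (inf a (heyting_imp a (heyting_imp c x))) \<le> x"
    by (simp add: le_heyting_imp_iff[symmetric])
  then have "inf c (heyting_imp a (heyting_imp c x)) \<le> heyting_imp a x"
    by (simp add: le_heyting_imp_iff inf_left_commute)
  also have "\<dots> \<le> x" using assms by (simp add: mem_open_sublocale)
  finally show ?thesis by (simp add: mem_open_sublocale le_heyting_imp_iff)
qed

text \<open>Closure under meets makes \<open>\<nu>\<close> a closure operator. Closure under
  implication makes it preserve binary meets: the adjunction turns
  \<open>inf x y \<le> \<nu> (inf x y)\<close> into a bound on \<open>x\<close> by an element of
  \<open>K\<close>, so \<open>x\<close> may be replaced by \<open>\<nu> x\<close>, and then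
  \<open>y\<close> by \<open>\<nu> y\<close> in the same way.\<close>

lemma is_sublocaleI:
  fixes K :: "'a::frame set"
  assumes Inf: "\<And>Y. Y \<subseteq> K \<Longrightarrow> Inf Y \<in> K" and imp: "\<And>c x. x \<in> K \<Longrightarrow> heyting_imp c x \<in> K"
  shows "is_sublocale K"
proof -
  define \<nu> where "\<nu> x = Inf {y \<in> K. x \<le> y}" for x
  have K: "\<nu> x \<in> K" for x unfolding \<nu>_def by (rule Inf) blast
  have le: "x \<le> \<nu> x" for x unfolding \<nu>_def by (rule Inf_greatest) blast
  have least: "y \<in> K \<Longrightarrow> x \<le> y \<Longrightarrow> \<nu> x \<le> y" for x y unfolding \<nu>_def by (rule Inf_lower) blast
  have mono: "x \<le> y \<Longrightarrow> \<nu> x \<le> \<nu> y" for x y by (rule least[OF K]) (rule order_trans[OF _ le])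
  have fix_iff: "\<nu> x = x \<longleftrightarrow> x \<in> K" for x
    using K[of x] least[of x x] le[of x] by (metis order_antisym order_refl)
  have "inf (\<nu> x) (\<nu> y) \<le> \<nu> (inf x y)" for x y
  proof -
    let ?z = "\<nu> (inf x y)"
    have "x \<le> heyting_imp y ?z"
      using le[of "inf x y"] by (simp add: le_heyting_imp_iff inf_commute)
    then have "\<nu> x \<le> heyting_imp y ?z" by (rule least[OF imp[OF K]])
    then have "y \<le> heyting_imp (\<nu> x) ?z" by (simp add: le_heyting_imp_iff inf_commute)
    then have "\<nu> y \<le> heyting_imp (\<nu> x) ?z" by (rule least[OF imp[OF K]])
    then show ?thesis by (simp add: le_heyting_imp_iff)
  qed
  then have "\<nu> (inf x y) = inf (\<nu> x) (\<nu> y)" for x y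
    by (intro order_antisym le_infI mono) simp_all
  then have "nucleus \<nu>"
    unfolding nucleus_def using mono le fix_iff K by (auto intro: monoI)
  moreover have "K = {x. \<nu> x = x}" using fix_iff by blast
  ultimately show ?thesis unfolding is_sublocale_def by blast
qed

lemma is_sublocale_INT_open:
  "is_sublocale (\<Inter>a\<in>A. open_sublocale (a :: 'a::frame))"
  by (rule is_sublocaleI) (auto intro!: Inf_mem_open_sublocale heyting_imp_mem_open_sublocale)

text \<open>The fixpoint \<open>\<nu> a\<close> can lie in the open sublocale of \<open>a\<close>
  only if it is \<open>top\<close>, since \<open>heyting_imp a (\<nu> a)\<close> is. Conversely,
  once \<open>\<nu> a\<close> is \<open>top\<close>, \<open>\<nu>\<close> sends
  \<open>inf a (heyting_imp a x)\<close> and \<open>heyting_imp a x\<close> to the same element, and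
  the former is sent below the fixpoint \<open>x\<close>.\<close>

lemma subset_open_sublocale_iff:
  assumes \<nu>: "nucleus \<nu>"
  shows "{x. \<nu> x = x} \<subseteq> open_sublocale a \<longleftrightarrow> \<nu> a = (top :: 'a::frame)"
proof
  assume "{x. \<nu> x = x} \<subseteq> open_sublocale a"
  then have "\<nu> a \<in> open_sublocale a" using \<nu> by (auto simp: nucleus_def)
  then have "heyting_imp a (\<nu> a) \<le> \<nu> a" by (simp add: mem_open_sublocale)
  moreover have "top \<le> heyting_imp a (\<nu> a)" using \<nu> by (simp add: le_heyting_imp_iff nucleus_def)
  ultimately show "\<nu> a = top" by (simp add: top_unique)
next
  assume top: "\<nu> a = top"
  have "heyting_imp a x \<le> x" if x: "\<nu> x = x" for x
  proof -
    have "inf a (heyting_imp a x) \<le> x" by (simp add: le_heyting_imp_iff[symmetric])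
    then have "\<nu> (inf a (heyting_imp a x)) \<le> \<nu> x" using \<nu> unfolding nucleus_def mono_def by blast
    then have "\<nu> (heyting_imp a x) \<le> x" using \<nu> x top by (simp add: nucleus_def)
    then show ?thesis using \<nu> by (auto simp: nucleus_def intro: order_trans)
  qed
  then show "{x. \<nu> x = x} \<subseteq> open_sublocale a" by (auto simp: mem_open_sublocale)
qed

section \<open>Scott-open filters versus compact fitted sublocales\<close>

lemma isLub_top_iff:
  "isLub K S (top :: 'a::complete_lattice) \<longleftrightarrow> top \<in> K \<and> (\<forall>y\<in>K. (\<forall>s\<in>S. s \<le> y) \<longrightarrow> y = top)"
  by (auto simp: isLub_def leastP_def isUb_def setle_def setge_def top_unique)

lemma directed_finite_upper_bound:
  assumes "directed D" "finite F" "F \<subseteq> D" shows "\<exists>d\<in>D. \<forall>x\<in>F. x \<le> d"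
  using assms(2,3)
proof (induction F rule: finite_induct)
  case empty
  then show ?case using assms(1) by (auto simp: directed_def)
next
  case (insert x F)
  then obtain d where d: "d \<in> D" "\<forall>x\<in>F. x \<le> d" by auto
  then obtain z where "z \<in> D" "x \<le> z" "d \<le> z"
    using assms(1) insert.prems unfolding directed_def by blast
  then show ?case using d by (auto intro: order_trans)
qed

text \<open>In terms of the nucleus this is the preimage of \<open>top\<close>, a filter because
  \<open>\<nu>\<close> preserves meets. A directed set whose join is sent to \<open>top\<close> has
  a cover of \<open>K\<close> as its image; a finite subcover comes from finitely many elements, and
  directedness merges them into one.\<close>

lemma scott_open_filter_of_compact:
  assumes K: "compact_sublocale K"
  shows "scott_open_filter {a :: 'a::frame. K \<subseteq> open_sublocale a}"
proof -
  obtain \<nu> where \<nu>: "nucleus \<nu>" and K_eq: "K = {x. \<nu> x = x}"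
    using K unfolding compact_sublocale_def is_sublocale_def by blast
  have mono: "x \<le> y \<Longrightarrow> \<nu> x \<le> \<nu> y" and le: "x \<le> \<nu> x" and idem: "\<nu> (\<nu> x) = \<nu> x"
    and inf: "\<nu> (inf x y) = inf (\<nu> x) (\<nu> y)" for x y
    using \<nu> by (auto simp: nucleus_def mono_def)
  have sub: "K \<subseteq> open_sublocale a \<longleftrightarrow> \<nu> a = top" for a
    unfolding K_eq by (rule subset_open_sublocale_iff[OF \<nu>])
  have top: "\<nu> top = top" using le[of top] by (simp add: top_unique)
  have "is_filter {a. \<nu> a = top}"
    unfolding is_filter_def using mono top by (auto simp: inf) (metis top_unique)
  moreover have "\<exists>d\<in>D. \<nu> d = top" if D: "directed D" "\<nu> (Sup D) = top" for D
  proof -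
    have "isLub K (\<nu> ` D) top"
      unfolding isLub_top_iff
    proof (intro conjI ballI impI)
      show "top \<in> K" by (simp add: K_eq top)
      fix y assume y: "y \<in> K" "\<forall>s\<in>\<nu> ` D. s \<le> y"
      then have "Sup D \<le> y" by (auto intro!: Sup_least intro: order_trans[OF le])
      then have "\<nu> (Sup D) \<le> y" using mono[of "Sup D" y] y by (simp add: K_eq)
      then show "y = top" using D by (simp add: top_unique)
    qed
    moreover have "\<nu> ` D \<subseteq> K" by (auto simp: K_eq idem)
    ultimately obtain F where F: "F \<subseteq> \<nu> ` D" "finite F" "isLub K F top"
      using K unfolding compact_sublocale_def by blast
    obtain E where E: "E \<subseteq> D" "finite E" "F = \<nu> ` E" using F finite_subset_image by meson
    obtain d where d: "d \<in> D" "\<forall>x\<in>E. x \<le> d"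
      using directed_finite_upper_bound[OF D(1) E(2,1)] by blast
    then have "\<forall>s\<in>F. s \<le> \<nu> d" using E mono by auto
    then have "\<nu> d = top" using F(3) by (auto simp: isLub_top_iff K_eq idem)
    then show ?thesis using d by blast
  qed
  ultimately show ?thesis unfolding scott_open_filter_def sub by blast
qed

lemma scott_open_filterD:
  assumes "scott_open_filter \<kappa>"
  shows "x \<in> \<kappa> \<Longrightarrow> x \<le> y \<Longrightarrow> y \<in> \<kappa>" "top \<in> \<kappa>" "x \<in> \<kappa> \<Longrightarrow> y \<in> \<kappa> \<Longrightarrow> inf x y \<in> \<kappa>"
    "directed D \<Longrightarrow> Sup D \<in> \<kappa> \<Longrightarrow> \<exists>d\<in>D. d \<in> \<kappa>"
proof -
  have up: "\<forall>x\<in>\<kappa>. \<forall>y. x \<le> y \<longrightarrow> y \<in> \<kappa>" and "top \<in> \<kappa>" and meet: "\<forall>x\<in>\<kappa>. \<forall>y\<in>\<kappa>. inf x y \<in> \<kappa>"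
    and scott: "\<forall>D. directed D \<and> Sup D \<in> \<kappa> \<longrightarrow> (\<exists>d\<in>D. d \<in> \<kappa>)"
    by (insert assms[unfolded scott_open_filter_def is_filter_def], elim conjE, assumption)+
  show "x \<in> \<kappa> \<Longrightarrow> x \<le> y \<Longrightarrow> y \<in> \<kappa>" using up by blast
  show "top \<in> \<kappa>" by fact
  show "x \<in> \<kappa> \<Longrightarrow> y \<in> \<kappa> \<Longrightarrow> inf x y \<in> \<kappa>" using meet by blast
  show "directed D \<Longrightarrow> Sup D \<in> \<kappa> \<Longrightarrow> \<exists>d\<in>D. d \<in> \<kappa>" using scott by blast
qed

text \<open>Zorn's lemma applies because the complement of a Scott-open set is closed under joins of
  chains. The maximal element \<open>m\<close> then lies in every open sublocale \<open>open_sublocale a\<close> with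
  \<open>a \<in> \<kappa>\<close>: otherwise both \<open>a\<close> and \<open>heyting_imp a m\<close> would be in \<open>\<kappa>\<close>, hence also \<open>m\<close>.\<close>

lemma scott_open_filter_avoid:
  fixes \<kappa> :: "'a::frame set"
  assumes \<kappa>: "scott_open_filter \<kappa>" and b: "b \<notin> \<kappa>"
  shows "\<exists>m\<in>\<Inter>a\<in>\<kappa>. open_sublocale a. b \<le> m \<and> m \<notin> \<kappa>"
proof -
  note up = scott_open_filterD(1)[OF \<kappa>] and meet = scott_open_filterD(3)[OF \<kappa>]
    and scott = scott_open_filterD(4)[OF \<kappa>]
  define A where "A = {x. b \<le> x \<and> x \<notin> \<kappa>}"
  have "\<exists>m\<in>A. \<forall>a\<in>A. m \<le> a \<longrightarrow> a = m"
  proof (rule predicate_Zorn)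
    show "partial_order_on A (relation_of (\<le>) A)"
      by (rule partial_order_on_relation_ofI) auto
    fix C assume C: "C \<in> Chains (relation_of (\<le>) A)"
    then have CA: "C \<subseteq> A" and chain: "\<And>x y. x \<in> C \<Longrightarrow> y \<in> C \<Longrightarrow> x \<le> y \<or> y \<le> x"
      unfolding Chains_def relation_of_def by auto
    show "\<exists>u\<in>A. \<forall>a\<in>C. a \<le> u"
    proof (cases "C = {}")
      case True
      then show ?thesis using b by (auto simp: A_def)
    next
      case False
      then have "directed C" using chain unfolding directed_def by (metis order_refl)
      then have "Sup C \<notin> \<kappa>" using scott CA by (auto simp: A_def)
      moreover obtain c where c: "c \<in> C" using False by blast
      then have "b \<le> c" using CA by (auto simp: A_def)
      then have "b \<le> Sup C" using c by (rule Sup_upper2[rotated])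
      ultimately show ?thesis by (auto simp: A_def intro: Sup_upper)
    qed
  qed
  then obtain m where m: "b \<le> m" "m \<notin> \<kappa>" "\<And>x. m \<le> x \<Longrightarrow> x \<notin> \<kappa> \<Longrightarrow> x = m"
    unfolding A_def by (auto intro: order_trans)
  have "m \<in> open_sublocale a" if a: "a \<in> \<kappa>" for a
  proof -
    have "inf a (heyting_imp a m) \<le> m" by (simp add: le_heyting_imp_iff[symmetric])
    then have "heyting_imp a m \<notin> \<kappa>" using meet[OF a] up m(2) by blast
    then have "heyting_imp a m = m" using m(3) le_heyting_imp by blast
    then show ?thesis by (simp add: open_sublocale_def)
  qed
  then show ?thesis using m by blast
qed

text \<open>If \<open>b\<close> is outside the filter, the element \<open>m\<close> above it found
  by \<open>scott_open_filter_avoid\<close> lies in the intersection; in the open sublocale of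
  \<open>b\<close> it would have to be \<open>top\<close>, which belongs to the filter. So a
  Scott-open filter is recovered from its fitted sublocale.\<close>

lemma subset_open_sublocale_iff_mem:
  fixes \<kappa> :: "'a::frame set"
  assumes \<kappa>: "scott_open_filter \<kappa>"
  shows "(\<Inter>a\<in>\<kappa>. open_sublocale a) \<subseteq> open_sublocale b \<longleftrightarrow> b \<in> \<kappa>"
proof
  assume sub: "(\<Inter>a\<in>\<kappa>. open_sublocale a) \<subseteq> open_sublocale b"
  show "b \<in> \<kappa>"
  proof (rule ccontr)
    assume "b \<notin> \<kappa>"
    then obtain m where m: "m \<in> open_sublocale b" "b \<le> m" "m \<notin> \<kappa>"
      using scott_open_filter_avoid[OF \<kappa>] sub by blast
    have "top \<le> heyting_imp b m" using m(2) by (simp add: le_heyting_imp_iff)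
    also have "\<dots> \<le> m" using m(1) by (simp add: mem_open_sublocale)
    finally have "m = top" by (simp add: top_unique)
    then show False using m(3) scott_open_filterD(2)[OF \<kappa>] by simp
  qed
qed blast

text \<open>Covers are joins within the sublocale, so \<open>Sup S\<close> need not be
  \<open>top\<close>. It does belong to the filter, for otherwise some element of the sublocale
  other than \<open>top\<close> would bound \<open>S\<close>. Conversely, an element of the
  sublocale above a member of the filter is \<open>top\<close>, and this makes the finite set found
  by Scott-openness a cover.\<close>

lemma compact_sublocale_of_scott_open_filter:
  fixes \<kappa> :: "'a::frame set"
  assumes \<kappa>: "scott_open_filter \<kappa>"
  shows "compact_sublocale (\<Inter>a\<in>\<kappa>. open_sublocale a)"
  unfolding compact_sublocale_def
proof (intro conjI allI impI is_sublocale_INT_open)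
  let ?K = "\<Inter>a\<in>\<kappa>. open_sublocale a"
  fix S assume S: "S \<subseteq> ?K" "isLub ?K S top"
  have topK: "top \<in> ?K" by (simp add: mem_open_sublocale)
  note top\<kappa> = scott_open_filterD(2)[OF \<kappa>]
  have "Sup S \<in> \<kappa>"
  proof (rule ccontr)
    assume "Sup S \<notin> \<kappa>"
    then obtain m where m: "m \<in> ?K" "Sup S \<le> m" "m \<notin> \<kappa>"
      using scott_open_filter_avoid[OF \<kappa>] by blast
    then have "\<forall>s\<in>S. s \<le> m" by (auto intro: order_trans[OF Sup_upper])
    then have "m = top" using S(2) m(1) unfolding isLub_top_iff by blast
    then show False using m(3) top\<kappa> by simp
  qed
  \<comment> \<open>Scott-openness speaks of directed joins, so the cover is replaced by the joins
    of its finite subsets.\<close>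
  moreover define D where "D = Sup ` {F. F \<subseteq> S \<and> finite F}"
  have "directed D"
    unfolding directed_def
  proof (intro conjI ballI)
    show "D \<noteq> {}" by (auto simp: D_def)
    fix x y assume "x \<in> D" "y \<in> D"
    then obtain F G where FG: "F \<subseteq> S" "finite F" "x = Sup F" "G \<subseteq> S" "finite G" "y = Sup G"
      by (auto simp: D_def)
    then have "Sup (F \<union> G) \<in> D" by (auto simp: D_def)
    moreover have "x \<le> Sup (F \<union> G)" "y \<le> Sup (F \<union> G)" using FG by (auto intro!: Sup_subset_mono)
    ultimately show "\<exists>z\<in>D. x \<le> z \<and> y \<le> z" by blast
  qed
  moreover have "Sup S \<le> Sup D"
  proof (rule Sup_least)
    fix s assume "s \<in> S"
    then have "Sup {s} \<in> D" unfolding D_def by blast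
    then show "s \<le> Sup D" by (simp add: Sup_upper)
  qed
  ultimately obtain d where "d \<in> D" "d \<in> \<kappa>"
    using scott_open_filterD(1,4)[OF \<kappa>] by blast
  then obtain F where F: "F \<subseteq> S" "finite F" "Sup F \<in> \<kappa>" by (auto simp: D_def)
  have "isLub ?K F top"
    unfolding isLub_top_iff
  proof (intro conjI ballI impI topK)
    fix y assume y: "y \<in> ?K" "\<forall>s\<in>F. s \<le> y"
    then have "heyting_imp (Sup F) y \<le> y" using F(3) by (auto simp: mem_open_sublocale)
    moreover have "top \<le> heyting_imp (Sup F) y"
      using y(2) by (simp add: le_heyting_imp_iff Sup_least)
    ultimately show "y = top" by (simp add: top_unique)
  qed
  then show "\<exists>F\<subseteq>S. finite F \<and> isLub ?K F top" using F by blast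
qed

text \<open>Each kind of test is translated into the other: a filter into the intersection of its
  open sublocales, a compact sublocale into the filter of the \<open>a\<close> whose open sublocale
  contains it. Both translations preserve which elements pass the test.\<close>

lemma compact_fitted_separation_iff:
  "(\<forall>K. compact_sublocale K \<and> fitted_sublocale K \<longrightarrow> K \<subseteq> open_sublocale a \<longrightarrow> K \<subseteq> open_sublocale b) \<longleftrightarrow>
    (\<forall>\<kappa>. scott_open_filter \<kappa> \<longrightarrow> a \<in> \<kappa> \<longrightarrow> (b :: 'a::frame) \<in> \<kappa>)"
proof (intro iffI allI impI)
  fix \<kappa> :: "'a set"
  let ?K = "\<Inter>a\<in>\<kappa>. open_sublocale a"
  assume sep: "\<forall>K. compact_sublocale K \<and> fitted_sublocale K \<longrightarrow> K \<subseteq> open_sublocale a \<longrightarrow> K \<subseteq> open_sublocale b"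
    and \<kappa>: "scott_open_filter \<kappa>" and a: "a \<in> \<kappa>"
  have "fitted_sublocale ?K"
    unfolding fitted_sublocale_def using is_sublocale_INT_open by blast
  moreover have "?K \<subseteq> open_sublocale a" using a by blast
  ultimately have "?K \<subseteq> open_sublocale b"
    using sep[THEN spec, of ?K] compact_sublocale_of_scott_open_filter[OF \<kappa>] by simp
  then show "b \<in> \<kappa>" by (simp add: subset_open_sublocale_iff_mem[OF \<kappa>])
next
  fix K :: "'a set"
  assume sep: "\<forall>\<kappa>. scott_open_filter \<kappa> \<longrightarrow> a \<in> \<kappa> \<longrightarrow> b \<in> \<kappa>"
    and K: "compact_sublocale K \<and> fitted_sublocale K" "K \<subseteq> open_sublocale a"
  have "scott_open_filter {a. K \<subseteq> open_sublocale a}" using K by (simp add: scott_open_filter_of_compact)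
  then have "b \<in> {a. K \<subseteq> open_sublocale a}"
    using sep[THEN spec, of "{a. K \<subseteq> open_sublocale a}"] K(2) by simp
  then show "K \<subseteq> open_sublocale b" by simp
qed

section \<open>Injectivity of a canonical extension as separation by Scott-open filters\<close>

lemma canonical_extensionD:
  assumes "canonical_extension e"
  shows "a \<le> b \<Longrightarrow> e a \<le> e b"
    "(\<And>\<kappa> a. scott_open_filter \<kappa> \<Longrightarrow> Inf (e ` \<kappa>) \<le> u \<Longrightarrow> v \<le> e a \<Longrightarrow> Inf (e ` \<kappa>) \<le> e a) \<Longrightarrow> u \<le> v"
    "scott_open_filter \<kappa> \<Longrightarrow> Inf (e ` \<kappa>) \<le> e a \<Longrightarrow> a \<in> \<kappa>"
proof -
  have mono: "mono e"
    and dense: "\<forall>u v. (\<forall>\<kappa> a. scott_open_filter \<kappa> \<longrightarrow> Inf (e ` \<kappa>) \<le> u \<and> v \<le> e a \<longrightarrow> Inf (e ` \<kappa>) \<le> e a) \<longrightarrow> u \<le> v"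
    and compact: "\<forall>\<kappa> a. scott_open_filter \<kappa> \<and> Inf (e ` \<kappa>) \<le> e a \<longrightarrow> a \<in> \<kappa>"
    by (insert assms[unfolded canonical_extension_def], elim conjE, assumption)+
  show "a \<le> b \<Longrightarrow> e a \<le> e b" using mono by (rule monoD)
  show "(\<And>\<kappa> a. scott_open_filter \<kappa> \<Longrightarrow> Inf (e ` \<kappa>) \<le> u \<Longrightarrow> v \<le> e a \<Longrightarrow> Inf (e ` \<kappa>) \<le> e a) \<Longrightarrow> u \<le> v"
    by (rule dense[THEN spec, THEN spec, THEN mp]) blast
  show "scott_open_filter \<kappa> \<Longrightarrow> Inf (e ` \<kappa>) \<le> e a \<Longrightarrow> a \<in> \<kappa>" using compact by blast
qed

text \<open>Left to right is compactness, since the meet over a filter lies below the image of each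
  member. Right to left is density: compactness reads off \<open>a \<in> \<kappa>\<close> from the
  first inequality of a test pair, and the separation assumption moves this to
  \<open>b\<close>.\<close>

lemma canonical_extension_le_iff:
  fixes e :: "'a::frame \<Rightarrow> 'b::complete_lattice"
  assumes e: "canonical_extension e"
  shows "e a \<le> e b \<longleftrightarrow> (\<forall>\<kappa>. scott_open_filter \<kappa> \<longrightarrow> a \<in> \<kappa> \<longrightarrow> b \<in> \<kappa>)"
proof (intro iffI allI impI)
  note compact = canonical_extensionD(3)[OF e]
  have lower: "Inf (e ` \<kappa>) \<le> e a" if "a \<in> \<kappa>" for \<kappa> a using that by (intro Inf_lower) blast
  show "b \<in> \<kappa>" if "e a \<le> e b" "scott_open_filter \<kappa>" "a \<in> \<kappa>" for \<kappa>
    using compact[OF that(2)] order_trans[OF lower[OF that(3)] that(1)] by blast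
  show "e a \<le> e b" if sep: "\<forall>\<kappa>. scott_open_filter \<kappa> \<longrightarrow> a \<in> \<kappa> \<longrightarrow> b \<in> \<kappa>"
  proof (rule canonical_extensionD(2)[OF e])
    fix \<kappa> c assume \<kappa>: "scott_open_filter \<kappa>" "Inf (e ` \<kappa>) \<le> e a" "e b \<le> e c"
    then have "b \<in> \<kappa>" using sep compact by blast
    then show "Inf (e ` \<kappa>) \<le> e c" using lower \<kappa>(3) order_trans by blast
  qed
qed

text \<open>Injectivity concerns equal values, while separation concerns the order. The bridge is
  \<open>inf a b\<close>: filters are closed under meets, so if every Scott-open filter containing
  \<open>a\<close> contains \<open>b\<close>, it also contains \<open>inf a b\<close>, and then
  \<open>e\<close> takes equal values at \<open>a\<close> and \<open>inf a b\<close>.\<close>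

lemma inj_canonical_extension_iff:
  fixes e :: "'a::frame \<Rightarrow> 'b::complete_lattice"
  assumes e: "canonical_extension e"
  shows "inj e \<longleftrightarrow> (\<forall>a b :: 'a. a \<le> b \<longleftrightarrow> (\<forall>\<kappa>. scott_open_filter \<kappa> \<longrightarrow> a \<in> \<kappa> \<longrightarrow> b \<in> \<kappa>))"
proof -
  have "inj e \<longleftrightarrow> (\<forall>a b. a \<le> b \<longleftrightarrow> e a \<le> e b)"
  proof
    note mono = canonical_extensionD(1)[OF e]
    assume inj: "inj e"
    have "a \<le> b" if ab: "e a \<le> e b" for a b
    proof -
      have "inf a b \<in> \<kappa>" if \<kappa>: "scott_open_filter \<kappa>" "a \<in> \<kappa>" for \<kappa>
      proof -
        have "b \<in> \<kappa>" using ab \<kappa> unfolding canonical_extension_le_iff[OF e] by blast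
        then show ?thesis using \<kappa> scott_open_filterD(3) by blast
      qed
      then have "e a \<le> e (inf a b)" unfolding canonical_extension_le_iff[OF e] by blast
      then have "e (inf a b) = e a" using mono[of "inf a b" a] by simp
      then have "inf a b = a" using inj by (simp add: inj_eq)
      then show ?thesis by (simp add: inf.absorb_iff1)
    qed
    then show "\<forall>a b. a \<le> b \<longleftrightarrow> e a \<le> e b" using mono by blast
  next
    assume "\<forall>a b. a \<le> b \<longleftrightarrow> e a \<le> e b"
    then show "inj e" by (intro injI order_antisym) simp_all
  qed
  then show ?thesis by (simp only: canonical_extension_le_iff[OF e])
qed

section \<open>Definable predicates and sets in a model of ZF\<close>

text \<open>Bound variables are renamed along with the free ones; for injective \<open>f\<close> no
  capture can arise.\<close>

primrec rename :: "(nat \<Rightarrow> nat) \<Rightarrow> fm \<Rightarrow> fm" where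
  "rename f (Mem i j) = Mem (f i) (f j)"
| "rename f (Eq i j) = Eq (f i) (f j)"
| "rename f (Neg \<phi>) = Neg (rename f \<phi>)"
| "rename f (Conj \<phi> \<psi>) = Conj (rename f \<phi>) (rename f \<psi>)"
| "rename f (Ex i \<phi>) = Ex (f i) (rename f \<phi>)"

definition interleave :: "(nat \<Rightarrow> 'a) \<Rightarrow> (nat \<Rightarrow> 'a) \<Rightarrow> nat \<Rightarrow> 'a" where
  "interleave \<rho> \<sigma> n = (if even n then \<rho> (n div 2) else \<sigma> (n div 2))"

lemma interleave_simps [simp]:
  "interleave \<rho> \<sigma> (2 * i) = \<rho> i" "interleave \<rho> \<sigma> (Suc (2 * i)) = \<sigma> i"
  by (simp_all add: interleave_def)

lemma ext_even_odd:
  assumes "\<And>i. f (2 * i) = g (2 * i)" "\<And>i. f (Suc (2 * i)) = g (Suc (2 * i))"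
  shows "f = (g :: nat \<Rightarrow> 'a)"
proof
  fix n show "f n = g n"
    using assms[of "n div 2"] by (cases "even n") auto
qed

text \<open>The language of set theory has no function symbols, so its terms are variables and, as
  constants of the model, parameters.\<close>

definition variable :: "((nat \<Rightarrow> 'v) \<Rightarrow> 'v) \<Rightarrow> bool" where
  "variable t \<longleftrightarrow> (\<exists>i. t = (\<lambda>\<rho>. \<rho> i)) \<or> (\<exists>c. t = (\<lambda>\<rho>. c))"

named_theorems definable

context set_structure
begin

lemma sat_rename: "inj f \<Longrightarrow> sat (rename f \<phi>) \<rho> = sat \<phi> (\<rho> \<circ> f)"
proof (induction \<phi> arbitrary: \<rho>)
  case (Ex i \<phi>)
  then have "(\<rho>(f i := x)) \<circ> f = (\<rho> \<circ> f)(i := x)" for x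
    by (auto simp: fun_eq_iff inj_eq)
  with Ex show ?case by (simp del: fun_upd_apply comp_apply add: o_def[symmetric])
qed auto

text \<open>The variables of a formula are split: the even-numbered ones are read from the environment
  \<open>\<rho>\<close>, the odd-numbered ones hold parameters, so that there is always room for more of them.
  In the rules for quantifiers below, the bound variable is number 0 of the environment and the
  others are shifted.\<close>

definition definable :: "((nat \<Rightarrow> 'v) \<Rightarrow> bool) \<Rightarrow> bool" where
  "definable Q \<longleftrightarrow> (\<exists>\<phi> \<sigma>. \<forall>\<rho>. Q \<rho> \<longleftrightarrow> sat \<phi> (interleave \<rho> \<sigma>))"

lemma definableI: "(\<And>\<rho>. Q \<rho> \<longleftrightarrow> sat \<phi> (interleave \<rho> \<sigma>)) \<Longrightarrow> definable Q"
  by (auto simp: definable_def)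

lemma variable_var [definable]: "variable (\<lambda>\<rho>. \<rho> i)"
  and variable_const [definable]: "variable (\<lambda>\<rho>. c)"
  by (auto simp: variable_def)

lemma variable_comp: "variable t \<Longrightarrow> variable (\<lambda>\<rho>. t (\<lambda>n. \<rho> (f n)))"
  by (auto simp: variable_def)

lemma variable_code:
  fixes s t :: "(nat \<Rightarrow> 'v) \<Rightarrow> 'v"
  assumes "variable s" "variable t"
  obtains i j \<sigma> where "\<And>\<rho>. s \<rho> = interleave \<rho> \<sigma> i" "\<And>\<rho>. t \<rho> = interleave \<rho> \<sigma> j"
proof -
  \<comment> \<open>The slot \<open>k\<close> that holds the parameter is left open, so that
    \<open>s\<close> can use slot 0 and \<open>t\<close> slot 1 of the same parameter
    sequence.\<close>
  have *: "\<exists>c. \<forall>k. \<exists>i. \<forall>\<rho> \<sigma>. \<sigma> k = c \<longrightarrow> t \<rho> = interleave \<rho> \<sigma> i"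
    if t: "variable t" for t :: "(nat \<Rightarrow> 'v) \<Rightarrow> 'v"
    using t unfolding variable_def
  proof (elim disjE exE)
    fix i assume "t = (\<lambda>\<rho>. \<rho> i)"
    then show ?thesis by (intro exI[of _ undefined] allI exI[of _ "2 * i"]) simp
  next
    fix c assume "t = (\<lambda>\<rho>. c)"
    then show ?thesis by (intro exI[of _ c] allI, rule_tac x = "Suc (2 * k)" in exI) simp
  qed
  obtain c d i j
    where st: "\<And>\<rho> \<sigma>. \<sigma> 0 = c \<Longrightarrow> s \<rho> = interleave \<rho> \<sigma> i" "\<And>\<rho> \<sigma>. \<sigma> (Suc 0) = d \<Longrightarrow> t \<rho> = interleave \<rho> \<sigma> j"
    using *[OF assms(1)] *[OF assms(2)] by meson
  show thesis
    by (rule that[of "case_nat c (\<lambda>_. d)" i j]) (rule st, simp)+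
qed

section \<open>Atomic formulas, connectives and quantifiers\<close>

lemma definable_mem [definable]:
  assumes "variable s" "variable t" shows "definable (\<lambda>\<rho>. s \<rho> \<epsilon> t \<rho>)"
proof -
  obtain i j \<sigma> where "\<And>\<rho>. s \<rho> = interleave \<rho> \<sigma> i" "\<And>\<rho>. t \<rho> = interleave \<rho> \<sigma> j"
    using variable_code[OF assms] by metis
  then show ?thesis by (intro definableI[of _ "Mem i j" \<sigma>]) simp
qed

lemma definable_eq [definable]:
  assumes "variable s" "variable t" shows "definable (\<lambda>\<rho>. s \<rho> = t \<rho>)"
proof -
  obtain i j \<sigma> where "\<And>\<rho>. s \<rho> = interleave \<rho> \<sigma> i" "\<And>\<rho>. t \<rho> = interleave \<rho> \<sigma> j"
    using variable_code[OF assms] by metis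
  then show ?thesis by (intro definableI[of _ "Eq i j" \<sigma>]) simp
qed

lemma definable_not [definable]: "definable Q \<Longrightarrow> definable (\<lambda>\<rho>. \<not> Q \<rho>)"
  by (auto simp: definable_def) (metis sat.simps(3))

lemma definable_conj [definable]:
  assumes "definable Q" "definable R" shows "definable (\<lambda>\<rho>. Q \<rho> \<and> R \<rho>)"
proof -
  obtain \<phi> \<sigma> where Q: "\<And>\<rho>. Q \<rho> \<longleftrightarrow> sat \<phi> (interleave \<rho> \<sigma>)"
    using assms(1) by (auto simp: definable_def)
  obtain \<psi> \<tau> where R: "\<And>\<rho>. R \<rho> \<longleftrightarrow> sat \<psi> (interleave \<rho> \<tau>)"
    using assms(2) by (auto simp: definable_def)
  \<comment> \<open>The two parameter sequences are merged into
    \<open>interleave \<sigma> \<tau>\<close>. Accordingly \<open>f 0\<close> sends parameter slot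
    \<open>m\<close> to slot \<open>2 * m\<close> and \<open>f 1\<close> sends it to slot
    \<open>2 * m + 1\<close>; both fix the even codes, which stand for the shared
    environment.\<close>
  define f :: "nat \<Rightarrow> nat \<Rightarrow> nat" where
    "f k n = (if even n then n else Suc (2 * (2 * (n div 2) + k)))" for k n
  have inj: "inj (f k)" for k
    by (rule injI) (auto simp: f_def split: if_splits elim!: oddE)
  have 0: "interleave \<rho> (interleave \<sigma> \<tau>) \<circ> f 0 = interleave \<rho> \<sigma>" for \<rho>
  proof (rule ext_even_odd)
    show "(interleave \<rho> (interleave \<sigma> \<tau>) \<circ> f 0) (Suc (2 * i)) = interleave \<rho> \<sigma> (Suc (2 * i))" for i
      using interleave_simps(2)[of \<rho> "interleave \<sigma> \<tau>" "2 * i"] by (simp add: f_def)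
  qed (simp add: f_def)
  have 1: "interleave \<rho> (interleave \<sigma> \<tau>) \<circ> f 1 = interleave \<rho> \<tau>" for \<rho>
  proof (rule ext_even_odd)
    show "(interleave \<rho> (interleave \<sigma> \<tau>) \<circ> f 1) (Suc (2 * i)) = interleave \<rho> \<tau> (Suc (2 * i))" for i
      using interleave_simps(2)[of \<rho> "interleave \<sigma> \<tau>" "Suc (2 * i)"] by (simp add: f_def)
  qed (simp add: f_def)
  show ?thesis
    by (rule definableI[of _ "Conj (rename (f 0) \<phi>) (rename (f 1) \<psi>)" "interleave \<sigma> \<tau>"])
      (simp add: sat_rename[OF inj] 0 1[unfolded One_nat_def] Q R)
qed

lemma definable_Ex [definable]:
  assumes "definable (\<lambda>\<rho>. Q (\<rho> 0) (\<lambda>n. \<rho> (Suc n)))"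
  shows "definable (\<lambda>\<rho>. \<exists>x. Q x \<rho>)"
proof -
  obtain \<phi> \<sigma> where \<phi>: "\<And>\<rho>. Q (\<rho> 0) (\<lambda>n. \<rho> (Suc n)) \<longleftrightarrow> sat \<phi> (interleave \<rho> \<sigma>)"
    using assms by (auto simp: definable_def)
  \<comment> \<open>The bound variable has code 0 and must leave the environment, so it moves to
    code 1, that is, parameter slot 0. The other even codes move down by 2, undoing the shift of the
    environment, and the odd codes move up by 2 to make room. Slot 0 is overwritten by the
    quantifier, hence the \<open>undefined\<close> in \<open>\<sigma>'\<close>.\<close>
  define f :: "nat \<Rightarrow> nat" where "f n = (if n = 0 then 1 else if even n then n - 2 else n + 2)" for n
  have inj: "inj f"
    by (rule inj_on_inverseI[where g = "\<lambda>m. if m = 1 then 0 else if even m then m + 2 else m - 2"])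
      (auto simp: f_def elim!: evenE oddE, presburger)
  have f: "f 0 = 1" "f (2 * Suc i) = 2 * i" "f (Suc (2 * i)) = Suc (2 * Suc i)" for i
    by (simp_all add: f_def)
  define \<sigma>' where "\<sigma>' = case_nat undefined \<sigma>"
  have env: "(interleave \<rho> \<sigma>')(1 := x) \<circ> f = interleave (case_nat x \<rho>) \<sigma>" (is "?l = ?r") for x \<rho>
  proof (rule ext_even_odd)
    show "?l (2 * i) = ?r (2 * i)" for i
    proof (cases i)
      case 0
      then show ?thesis using interleave_simps(1)[of "case_nat x \<rho>" \<sigma> 0] f(1) by simp
    next
      case (Suc j)
      have "2 * j \<noteq> 1" by presburger
      then show ?thesis
        unfolding Suc comp_apply f interleave_simps by (simp add: interleave_def)
    qed
    show "?l (Suc (2 * i)) = ?r (Suc (2 * i))" for i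
      unfolding comp_apply f interleave_simps by (simp add: interleave_def \<sigma>'_def)
  qed
  have Q: "Q x \<rho> \<longleftrightarrow> sat \<phi> (interleave (case_nat x \<rho>) \<sigma>)" for x \<rho>
    using \<phi>[of "case_nat x \<rho>"] by simp
  show ?thesis
    by (rule definableI[of _ "Ex 1 (rename f \<phi>)" \<sigma>'])
      (simp only: Q sat.simps rename.simps sat_rename[OF inj] env f)
qed

lemma definable_disj [definable]:
  assumes "definable Q" "definable R" shows "definable (\<lambda>\<rho>. Q \<rho> \<or> R \<rho>)"
proof -
  have "definable (\<lambda>\<rho>. \<not> (\<not> Q \<rho> \<and> \<not> R \<rho>))"
    by (intro definable assms)
  then show ?thesis by (simp only: de_Morgan_conj not_not)
qed

lemma definable_imp [definable]:
  assumes "definable Q" "definable R" shows "definable (\<lambda>\<rho>. Q \<rho> \<longrightarrow> R \<rho>)"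
  unfolding imp_conv_disj by (intro definable assms)

lemma definable_iff [definable]:
  assumes "definable Q" "definable R" shows "definable (\<lambda>\<rho>. Q \<rho> \<longleftrightarrow> R \<rho>)"
proof -
  have "definable (\<lambda>\<rho>. (Q \<rho> \<and> R \<rho>) \<or> (\<not> Q \<rho> \<and> \<not> R \<rho>))"
    by (intro definable assms)
  moreover have "(\<lambda>\<rho>. (Q \<rho> \<and> R \<rho>) \<or> (\<not> Q \<rho> \<and> \<not> R \<rho>)) = (\<lambda>\<rho>. Q \<rho> \<longleftrightarrow> R \<rho>)"
    by (rule ext) blast
  ultimately show ?thesis by (rule subst[rotated])
qed

lemma definable_All [definable]:
  assumes "definable (\<lambda>\<rho>. Q (\<rho> 0) (\<lambda>n. \<rho> (Suc n)))"
  shows "definable (\<lambda>\<rho>. \<forall>x. Q x \<rho>)"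
proof -
  have "definable (\<lambda>\<rho>. \<not> (\<exists>x. \<not> Q x \<rho>))"
    by (intro definable assms)
  then show ?thesis by (simp only: not_ex not_not)
qed

lemma definable_True [definable]: "definable (\<lambda>\<rho>. True)"
  using definable_eq[OF variable_const variable_const, of undefined undefined] by (simp only: simp_thms)

lemma definable_False [definable]: "definable (\<lambda>\<rho>. False)"
  using definable_not[OF definable_True] by (simp only: simp_thms)

section \<open>Definability of set-theoretic notions\<close>

lemma definable_in_elts [definable]:
  "variable s \<Longrightarrow> variable t \<Longrightarrow> definable (\<lambda>\<rho>. s \<rho> \<in> elts (t \<rho>))"
  using definable_mem by (simp add: elts_def)

lemma definable_in_Collect [definable]:
  "definable (\<lambda>\<rho>. Q (s \<rho>) \<rho>) \<Longrightarrow> definable (\<lambda>\<rho>. s \<rho> \<in> {y. Q y \<rho>})"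
  by simp

lemma definable_in_empty [definable]: "definable (\<lambda>\<rho>. s \<rho> \<in> {})"
  using definable_False by simp

lemma definable_in_insert [definable]:
  "definable (\<lambda>\<rho>. s \<rho> = t \<rho>) \<Longrightarrow> definable (\<lambda>\<rho>. s \<rho> \<in> A \<rho>) \<Longrightarrow> definable (\<lambda>\<rho>. s \<rho> \<in> insert (t \<rho>) (A \<rho>))"
  using definable_disj by simp

lemma definable_in_Int [definable]:
  "definable (\<lambda>\<rho>. s \<rho> \<in> A \<rho>) \<Longrightarrow> definable (\<lambda>\<rho>. s \<rho> \<in> B \<rho>) \<Longrightarrow> definable (\<lambda>\<rho>. s \<rho> \<in> A \<rho> \<inter> B \<rho>)"
  using definable_conj by simp

lemma definable_Ball [definable]:
  assumes "definable (\<lambda>\<rho>. \<rho> 0 \<in> A (\<lambda>n. \<rho> (Suc n)))" "definable (\<lambda>\<rho>. Q (\<rho> 0) (\<lambda>n. \<rho> (Suc n)))"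
  shows "definable (\<lambda>\<rho>. \<forall>x\<in>A \<rho>. Q x \<rho>)"
  unfolding Ball_def by (intro definable_All definable_imp assms)

lemma definable_Bex [definable]:
  assumes "definable (\<lambda>\<rho>. \<rho> 0 \<in> A (\<lambda>n. \<rho> (Suc n)))" "definable (\<lambda>\<rho>. Q (\<rho> 0) (\<lambda>n. \<rho> (Suc n)))"
  shows "definable (\<lambda>\<rho>. \<exists>x\<in>A \<rho>. Q x \<rho>)"
  unfolding Bex_def by (intro definable_Ex definable_conj assms)

lemma definable_subset [definable]:
  assumes "definable (\<lambda>\<rho>. \<rho> 0 \<in> A (\<lambda>n. \<rho> (Suc n)))" "definable (\<lambda>\<rho>. \<rho> 0 \<in> B (\<lambda>n. \<rho> (Suc n)))"
  shows "definable (\<lambda>\<rho>. (A \<rho> :: 'v set) \<subseteq> B \<rho>)"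
  unfolding subset_eq by (intro definable_Ball assms)

lemma definable_set_eq [definable]:
  assumes "definable (\<lambda>\<rho>. \<rho> 0 \<in> A (\<lambda>n. \<rho> (Suc n)))" "definable (\<lambda>\<rho>. \<rho> 0 \<in> B (\<lambda>n. \<rho> (Suc n)))"
  shows "definable (\<lambda>\<rho>. (A \<rho> :: 'v set) = B \<rho>)"
  unfolding set_eq_iff by (intro definable_All definable_iff assms)

lemma definable_is_pair [definable]:
  assumes "variable p" "variable x" "variable y"
  shows "definable (\<lambda>\<rho>. is_pair (p \<rho>) (x \<rho>) (y \<rho>))"
  unfolding is_pair_def by (intro definable assms[THEN variable_comp])

lemma definable_rel [definable]:
  assumes "variable r" "variable x" "variable y"
  shows "definable (\<lambda>\<rho>. rel (r \<rho>) (x \<rho>) (y \<rho>))"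
  unfolding rel_def by (intro definable assms[THEN variable_comp])

lemma mem_elts [simp]: "y \<in> elts x \<longleftrightarrow> y \<epsilon> x"
  by (simp add: elts_def)


lemma definable_is_scott_open_filter [definable]:
  assumes "variable A" "variable r" "variable \<kappa>"
  shows "definable (\<lambda>\<rho>. is_scott_open_filter (A \<rho>) (r \<rho>) (\<kappa> \<rho>))"
  unfolding is_scott_open_filter_def is_glb_def is_lub_def is_directed_def
  by (intro definable assms[THEN variable_comp])

lemma is_pair_inject:
  assumes "is_pair p x y" "is_pair p x' y'" shows "x = x' \<and> y = y'"
proof -
  obtain s d s' d' where *: "elts s = {x}" "elts d = {x, y}" "elts p = {s, d}"
    "elts s' = {x'}" "elts d' = {x', y'}" "elts p = {s', d'}"
    using assms by (auto simp: is_pair_def)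
  then have "s' = s \<or> s' = d" "d' = s \<or> d' = d" "s = s' \<or> s = d'" "d = s' \<or> d = d'"
    by auto
  with *(1,2,4,5) show ?thesis by (auto simp: doubleton_eq_iff singleton_insert_inj_eq)
qed

end

section \<open>Set constructions inside a model of ZF\<close>

context ZF_model
begin

lemma set_ext: "(\<And>z. z \<epsilon> x \<longleftrightarrow> z \<epsilon> y) \<Longrightarrow> x = y"
  by (rule extensionality) auto

lemma elts_subset_iff: "elts x \<subseteq> elts y \<longleftrightarrow> (\<forall>z. z \<epsilon> x \<longrightarrow> z \<epsilon> y)"
  by auto

lemma pair_set: obtains z where "elts z = {x, y}"
  using pairing by blast

text \<open>The predicate looks only at variable 0 and keeps its parameters in
  \<open>\<sigma>\<close>, so the remaining environment can be filled arbitrarily, here with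
  \<open>a\<close>.\<close>

lemma separate:
  assumes "definable (\<lambda>\<rho>. P (\<rho> 0))"
  obtains b where "elts b = {x \<in> elts a. P x}"
proof -
  obtain \<phi> \<sigma> where \<phi>: "\<And>\<rho>. P (\<rho> 0) \<longleftrightarrow> sat \<phi> (interleave \<rho> \<sigma>)"
    using assms by (auto simp: definable_def)
  have "sat \<phi> ((interleave (\<lambda>_. a) \<sigma>)(0 := x)) \<longleftrightarrow> P x" for x
  proof -
    have "(interleave (\<lambda>_. a) \<sigma>)(0 := x) = interleave ((\<lambda>_. a)(0 := x)) \<sigma>"
      by (auto simp: interleave_def fun_eq_iff)
    then show ?thesis using \<phi>[of "(\<lambda>_. a)(0 := x)"] by simp
  qed
  then show thesis
    using separation[of a \<phi> "interleave (\<lambda>_. a) \<sigma>"] that by auto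
qed

lemma empty_set: obtains z where "elts z = {}"
  using separate[of "\<lambda>_. False" undefined thesis] definable_False by auto

lemma Un_set: obtains z where "elts z = elts x \<union> elts y"
proof -
  obtain p where "elts p = {x, y}" by (rule pair_set)
  then show thesis using union[of p] that by auto
qed

lemma Pow_set: "\<exists>z. \<forall>y. y \<epsilon> z \<longleftrightarrow> elts y \<subseteq> elts x"
  using power_set[of x] by (auto simp: set_eq_iff)

lemma ex_pair: obtains p where "is_pair p x y"
proof -
  obtain s where "elts s = {x, x}" by (rule pair_set)
  moreover obtain d where "elts d = {x, y}" by (rule pair_set)
  moreover obtain p where "elts p = {s, d}" by (rule pair_set)
  ultimately show thesis using that[of p] by (auto simp: is_pair_def)
qed

lemma is_pair_unique: "is_pair p x y \<Longrightarrow> is_pair p' x y \<Longrightarrow> p = p'"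
  unfolding is_pair_def by (metis extensionality)

lemma rel_iff: "is_pair p x y \<Longrightarrow> rel r x y \<longleftrightarrow> p \<epsilon> r"
  unfolding rel_def by (metis is_pair_unique)

text \<open>The relation lives inside the double power set of the union of its domain and range.\<close>

lemma separate_rel:
  assumes P: "definable (\<lambda>\<rho>. P (\<rho> (Suc 0)) (\<rho> 0))"
  obtains z where "\<And>x y. rel z x y \<longleftrightarrow> x \<epsilon> a \<and> y \<epsilon> b \<and> P x y"
    "\<And>p. p \<epsilon> z \<Longrightarrow> \<exists>x y. x \<epsilon> a \<and> y \<epsilon> b \<and> is_pair p x y"
proof -
  obtain u where u: "elts u = elts a \<union> elts b" by (rule Un_set)
  obtain v where v: "\<And>y. y \<epsilon> v \<longleftrightarrow> elts y \<subseteq> elts u" using Pow_set[of u] by blast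
  obtain w where w: "\<And>y. y \<epsilon> w \<longleftrightarrow> elts y \<subseteq> elts v" using Pow_set[of v] by blast
  \<comment> \<open>Under the two nested quantifiers \<open>x\<close> becomes variable 1 and
    \<open>y\<close> variable 0, which is the numbering used in the assumption on
    \<open>P\<close>.\<close>
  have "definable (\<lambda>\<rho>. \<exists>x y. (x \<epsilon> a \<and> y \<epsilon> b \<and> is_pair (\<rho> 0) x y) \<and> P x y)"
    by (intro definable P)
  then obtain z where z: "elts z = {p \<in> elts w. \<exists>x y. (x \<epsilon> a \<and> y \<epsilon> b \<and> is_pair p x y) \<and> P x y}"
    by (rule separate)
  have pw: "p \<epsilon> w" if p: "is_pair p x y" and xy: "x \<epsilon> a" "y \<epsilon> b" for p x y
  proof -
    obtain s d where sd: "elts s = {x}" "elts d = {x, y}" "elts p = {s, d}"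
      using p unfolding is_pair_def by blast
    then have "s \<epsilon> v" "d \<epsilon> v"
      using u xy by (simp_all add: v)
    then show ?thesis using sd by (simp add: w)
  qed
  show thesis
  proof (rule that)
    fix x y
    obtain p where p: "is_pair p x y" by (rule ex_pair)
    have "p \<epsilon> z \<longleftrightarrow> p \<epsilon> w \<and> (\<exists>x y. (x \<epsilon> a \<and> y \<epsilon> b \<and> is_pair p x y) \<and> P x y)"
      using z by (auto simp: set_eq_iff)
    also have "\<dots> \<longleftrightarrow> x \<epsilon> a \<and> y \<epsilon> b \<and> P x y"
      using pw p is_pair_inject[OF p] by blast
    finally show "rel z x y \<longleftrightarrow> x \<epsilon> a \<and> y \<epsilon> b \<and> P x y"
      by (simp add: rel_iff[OF p])
  next
    fix p assume "p \<epsilon> z"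
    then have "p \<in> elts z" by simp
    then show "\<exists>x y. x \<epsilon> a \<and> y \<epsilon> b \<and> is_pair p x y"
      unfolding z by blast
  qed
qed

section \<open>Filters and ultrafilters on a set of the model\<close>

lemma set_filterI:
  assumes "\<And>U. U \<epsilon> F \<Longrightarrow> elts U \<subseteq> elts X" "X \<epsilon> F"
    "\<And>U V. U \<epsilon> F \<Longrightarrow> elts U \<subseteq> elts V \<Longrightarrow> elts V \<subseteq> elts X \<Longrightarrow> V \<epsilon> F"
    "\<And>U V W. U \<epsilon> F \<Longrightarrow> V \<epsilon> F \<Longrightarrow> elts W = elts U \<inter> elts V \<Longrightarrow> W \<epsilon> F"
  shows "set_filter X F"
  using assms unfolding set_filter_def by blast

lemma set_filterD:
  assumes "set_filter X F"
  shows "U \<epsilon> F \<Longrightarrow> elts U \<subseteq> elts X" "X \<epsilon> F"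
    "U \<epsilon> F \<Longrightarrow> elts U \<subseteq> elts V \<Longrightarrow> elts V \<subseteq> elts X \<Longrightarrow> V \<epsilon> F"
    "U \<epsilon> F \<Longrightarrow> V \<epsilon> F \<Longrightarrow> elts W = elts U \<inter> elts V \<Longrightarrow> W \<epsilon> F"
  using assms unfolding set_filter_def by blast+

lemma Int_set: obtains z where "elts z = elts x \<inter> elts y"
proof -
  have "definable (\<lambda>\<rho>. \<rho> 0 \<epsilon> y)" by (intro definable)
  then obtain z where "elts z = {u \<in> elts x. u \<epsilon> y}" by (rule separate)
  then show thesis using that[of z] by (simp add: set_eq_iff)
qed

lemma Diff_set: obtains z where "elts z = elts x - elts y"
proof -
  have "definable (\<lambda>\<rho>. \<not> \<rho> 0 \<epsilon> y)" by (intro definable)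
  then obtain z where "elts z = {u \<in> elts x. \<not> u \<epsilon> y}" by (rule separate)
  then show thesis using that[of z] by (simp add: set_eq_iff)
qed

text \<open>This is the filter generated by \<open>F\<close> and \<open>U\<close>, possibly
  improper. It serves to show that an ultrafilter decides every set, and later to exhibit a filter
  as the meet of its extensions by a set and by the complement.\<close>

lemma adjoin_filter:
  assumes F: "set_filter X F" and U: "elts U \<subseteq> elts X"
  obtains H where "set_filter X H"
    "\<And>V. V \<epsilon> H \<longleftrightarrow> elts V \<subseteq> elts X \<and> (\<exists>W. W \<epsilon> F \<and> elts U \<inter> elts W \<subseteq> elts V)"
proof -
  obtain p where p: "\<And>y. y \<epsilon> p \<longleftrightarrow> elts y \<subseteq> elts X" using Pow_set[of X] by blast
  have "definable (\<lambda>\<rho>. \<exists>W. W \<epsilon> F \<and> elts U \<inter> elts W \<subseteq> elts (\<rho> 0))"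
    by (intro definable)
  then obtain H where "elts H = {V \<in> elts p. \<exists>W. W \<epsilon> F \<and> elts U \<inter> elts W \<subseteq> elts V}"
    by (rule separate)
  then have H: "V \<epsilon> H \<longleftrightarrow> elts V \<subseteq> elts X \<and> (\<exists>W. W \<epsilon> F \<and> elts U \<inter> elts W \<subseteq> elts V)" for V
    by (auto simp: set_eq_iff p)
  have "set_filter X H"
  proof (rule set_filterI)
    show "X \<epsilon> H" using set_filterD(2)[OF F] U unfolding H by blast
  next
    fix V V' W assume V: "V \<epsilon> H" "V' \<epsilon> H" and W: "elts W = elts V \<inter> elts V'"
    then obtain B B' where B: "B \<epsilon> F" "B' \<epsilon> F" "elts U \<inter> elts B \<subseteq> elts V" "elts U \<inter> elts B' \<subseteq> elts V'"
      unfolding H by blast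
    obtain C where C: "elts C = elts B \<inter> elts B'" by (rule Int_set)
    then have "C \<epsilon> F" using set_filterD(4)[OF F] B(1,2) by blast
    moreover have "elts U \<inter> elts C \<subseteq> elts W" using B C W by blast
    moreover have "elts W \<subseteq> elts X" using V W unfolding H by blast
    ultimately show "W \<epsilon> H" unfolding H by blast
  next
    fix V W assume "V \<epsilon> H" "elts V \<subseteq> elts W" "elts W \<subseteq> elts X"
    then show "W \<epsilon> H" unfolding H by blast
  next
    fix V assume "V \<epsilon> H"
    then show "elts V \<subseteq> elts X" unfolding H by blast
  qed
  with H show thesis using that by blast
qed

lemma set_ultrafilterD:
  assumes "set_ultrafilter X G"
  shows "set_filter X G" "U \<epsilon> G \<Longrightarrow> elts U \<noteq> {}"
    "set_filter X H \<Longrightarrow> (\<And>U. U \<epsilon> H \<Longrightarrow> elts U \<noteq> {}) \<Longrightarrow> (\<And>U. U \<epsilon> G \<Longrightarrow> U \<epsilon> H) \<Longrightarrow> H = G"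
  using assms unfolding set_ultrafilter_def proper_set_filter_def by auto

text \<open>If the complement \<open>V\<close> is not in \<open>G\<close>, adjoining
  \<open>U\<close> gives a proper filter: an empty member would come from a set in \<open>G\<close>
  disjoint from \<open>U\<close>, which would put \<open>V\<close> into \<open>G\<close>. Maximality
  then gives \<open>U \<epsilon> G\<close>.\<close>

lemma ultrafilter_prime:
  assumes G: "set_ultrafilter X G" and U: "elts U \<subseteq> elts X" and V: "elts V = elts X - elts U"
  shows "U \<epsilon> G \<or> V \<epsilon> G"
proof (rule disjCI)
  assume nV: "\<not> V \<epsilon> G"
  note F = set_ultrafilterD(1)[OF G]
  obtain H where HF: "set_filter X H"
    and H: "\<And>V. V \<epsilon> H \<longleftrightarrow> elts V \<subseteq> elts X \<and> (\<exists>W. W \<epsilon> G \<and> elts U \<inter> elts W \<subseteq> elts V)"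
    using adjoin_filter[OF F U] by blast
  have "elts W \<noteq> {}" if WH: "W \<epsilon> H" for W
  proof
    assume "elts W = {}"
    then obtain B where B: "B \<epsilon> G" "elts U \<inter> elts B = {}" using WH unfolding H by blast
    moreover have "elts B \<subseteq> elts V" "elts V \<subseteq> elts X" using set_filterD(1)[OF F B(1)] B V by auto
    ultimately have "V \<epsilon> G" using set_filterD(3)[OF F] by blast
    with nV show False ..
  qed
  moreover have "W \<epsilon> H" if "W \<epsilon> G" for W
    using set_filterD(1)[OF F that] that unfolding H by blast
  ultimately have "H = G" using set_ultrafilterD(3)[OF G HF] by blast
  moreover have "U \<epsilon> H" using U set_filterD(2)[OF F] unfolding H by blast
  ultimately show "U \<epsilon> G" by simp
qed

section \<open>The Bourbaki-Witt fixpoint theorem\<close>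

text \<open>Instead of iterating \<open>g\<close> along ordinals, the proof takes the least subset
  \<open>M\<close> of \<open>N\<close> that contains \<open>b\<close> and is closed under
  \<open>g\<close> and under existing joins of nonempty sets. It turns out to be a chain, so it has
  a join; this join belongs to \<open>M\<close>, and so does its value under \<open>g\<close>, which
  therefore cannot exceed it.\<close>

lemma bourbaki_witt:
  assumes refl: "\<And>x. x \<epsilon> N \<Longrightarrow> rel r x x"
    and trans: "\<And>x y z. rel r x y \<Longrightarrow> rel r y z \<Longrightarrow> rel r x z"
    and antisym: "\<And>x y. rel r x y \<Longrightarrow> rel r y x \<Longrightarrow> x = y"
    and bot: "b \<epsilon> N" "\<And>x. x \<epsilon> N \<Longrightarrow> rel r b x"
    and g: "\<And>x. x \<epsilon> N \<Longrightarrow> \<exists>!y. rel g x y"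
    and gN: "\<And>x y. rel g x y \<Longrightarrow> y \<epsilon> N"
    and infl: "\<And>x y. rel g x y \<Longrightarrow> rel r x y"
    and chain: "\<And>D. elts D \<subseteq> elts N \<Longrightarrow> elts D \<noteq> {} \<Longrightarrow>
      (\<And>x y. x \<epsilon> D \<Longrightarrow> y \<epsilon> D \<Longrightarrow> rel r x y \<or> rel r y x) \<Longrightarrow> \<exists>s. is_lub N r (elts D) s"
  obtains p where "p \<epsilon> N" "rel g p p"
proof -
  define closed where "closed T \<longleftrightarrow> b \<epsilon> T \<and> (\<forall>x y. x \<epsilon> T \<and> rel g x y \<longrightarrow> y \<epsilon> T) \<and>
    (\<forall>D s. elts D \<subseteq> elts T \<and> elts D \<noteq> {} \<and> is_lub N r (elts D) s \<longrightarrow> s \<epsilon> T)" for T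
  have "definable (\<lambda>\<rho>. \<forall>T. elts T \<subseteq> elts N \<and> closed T \<longrightarrow> \<rho> 0 \<epsilon> T)"
    unfolding closed_def is_lub_def by (intro definable)
  then obtain M where M: "elts M = {x \<in> elts N. \<forall>T. elts T \<subseteq> elts N \<and> closed T \<longrightarrow> x \<epsilon> T}"
    by (rule separate)
  have M_iff: "x \<epsilon> M \<longleftrightarrow> x \<epsilon> N \<and> (\<forall>T. elts T \<subseteq> elts N \<and> closed T \<longrightarrow> x \<epsilon> T)" for x
    using M by (auto simp: set_eq_iff)
  have MN: "x \<epsilon> M \<Longrightarrow> x \<epsilon> N" for x by (simp add: M_iff)
  have lubN: "is_lub N r P s \<Longrightarrow> s \<epsilon> N" for P s by (simp add: is_lub_def)
  have closed_M: "closed M"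
    unfolding closed_def
  proof (intro conjI allI impI)
    show "b \<epsilon> M" by (simp add: M_iff bot closed_def)
    show "y \<epsilon> M" if "x \<epsilon> M \<and> rel g x y" for x y
      using that gN unfolding M_iff closed_def by blast
    show "s \<epsilon> M" if D: "elts D \<subseteq> elts M \<and> elts D \<noteq> {} \<and> is_lub N r (elts D) s" for D s
      unfolding M_iff
    proof (intro conjI allI impI)
      show "s \<epsilon> N" using D lubN by blast
      fix T assume T: "elts T \<subseteq> elts N \<and> closed T"
      then have "elts D \<subseteq> elts T" using D by (auto simp: M_iff)
      with T D show "s \<epsilon> T" unfolding closed_def by blast
    qed
  qed
  \<comment> \<open>Minimality of \<open>M\<close> as an induction principle. Definability of
    \<open>P\<close> is what makes \<open>{x \<in> M. P x}\<close> a set of the model that competes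
    with \<open>M\<close>.\<close>
  have induct: "P x" if P: "definable (\<lambda>\<rho>. P (\<rho> 0))" "P b"
    and step: "\<And>x y. x \<epsilon> M \<Longrightarrow> P x \<Longrightarrow> rel g x y \<Longrightarrow> P y"
    and lim: "\<And>D s. elts D \<subseteq> elts M \<Longrightarrow> elts D \<noteq> {} \<Longrightarrow> is_lub N r (elts D) s \<Longrightarrow> s \<epsilon> M \<Longrightarrow>
      (\<And>x. x \<epsilon> D \<Longrightarrow> P x) \<Longrightarrow> P s" and x: "x \<epsilon> M" for P x
  proof -
    obtain T where "elts T = {x \<in> elts M. P x}" by (rule separate[OF P(1)])
    then have T: "x \<epsilon> T \<longleftrightarrow> x \<epsilon> M \<and> P x" for x by (auto simp: set_eq_iff)
    have "closed T"
      unfolding closed_def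
    proof (intro conjI allI impI)
      show "b \<epsilon> T" using P(2) closed_M by (simp add: T closed_def)
      show "y \<epsilon> T" if "x \<epsilon> T \<and> rel g x y" for x y
        using that closed_M step unfolding T closed_def by blast
      show "s \<epsilon> T" if D: "elts D \<subseteq> elts T \<and> elts D \<noteq> {} \<and> is_lub N r (elts D) s" for D s
      proof -
        have "elts D \<subseteq> elts M" using D by (auto simp: T)
        moreover from this have "s \<epsilon> M" using D closed_M unfolding closed_def by blast
        moreover have "\<And>x. x \<epsilon> D \<Longrightarrow> P x" using D by (auto simp: T)
        ultimately show ?thesis using lim[of D s] D by (simp add: T)
      qed
    qed
    moreover have "elts T \<subseteq> elts N" by (auto simp: T MN)
    ultimately show "P x" using x T M_iff[of x] by blast
  qed
  \<comment> \<open>An element is extreme if no step of \<open>g\<close> that starts in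
    \<open>M\<close> strictly below it can jump over it or aside.\<close>
  define extreme where "extreme c \<longleftrightarrow> (\<forall>x y. x \<epsilon> M \<and> rel r x c \<and> x \<noteq> c \<and> rel g x y \<longrightarrow> rel r y c)" for c
  \<comment> \<open>An extreme \<open>c\<close> cuts \<open>M\<close> into the part below
    \<open>c\<close> and the part above its successor, so \<open>c\<close> is comparable with all of
    \<open>M\<close>. Showing that all elements are extreme then makes \<open>M\<close> a
    chain.\<close>
  have split: "rel r x c \<or> rel r c' x" if c: "c \<epsilon> M" "extreme c" "rel g c c'" and x: "x \<epsilon> M" for c c' x
  proof (rule induct[OF _ _ _ _ x])
    show "definable (\<lambda>\<rho>. rel r (\<rho> 0) c \<or> rel r c' (\<rho> 0))" by (intro definable)
    show "rel r b c \<or> rel r c' b" using bot c MN by blast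
    show "rel r y c \<or> rel r c' y" if "x \<epsilon> M" "rel r x c \<or> rel r c' x" "rel g x y" for x y
    proof (cases "x = c")
      case True
      then have "y = c'" using that c g MN by blast
      then show ?thesis using c refl gN by blast
    next
      case False
      then show ?thesis using that c infl trans unfolding extreme_def by blast
    qed
    show "rel r s c \<or> rel r c' s"
      if "is_lub N r (elts D) s" "\<And>x. x \<epsilon> D \<Longrightarrow> rel r x c \<or> rel r c' x" for D s
      using that c MN trans unfolding is_lub_def by (metis mem_elts)
  qed
  have extreme: "extreme c" if c: "c \<epsilon> M" for c
  proof (rule induct[OF _ _ _ _ c])
    show "definable (\<lambda>\<rho>. extreme (\<rho> 0))" unfolding extreme_def by (intro definable)
    show "extreme b" unfolding extreme_def using bot antisym MN by blast
    show "extreme d" if d: "c \<epsilon> M" "extreme c" "rel g c d" for c d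
      unfolding extreme_def
    proof (intro allI impI)
      fix x y assume x: "x \<epsilon> M \<and> rel r x d \<and> x \<noteq> d \<and> rel g x y"
      then have xc: "rel r x c" using split[OF d, of x] antisym by blast
      show "rel r y d"
      proof (cases "x = c")
        case True
        then have "y = d" using x d g MN by blast
        then show ?thesis using x gN refl by blast
      next
        case False
        then show ?thesis using x xc d infl trans unfolding extreme_def by blast
      qed
    qed
    show "extreme s" if D: "elts D \<subseteq> elts M" "is_lub N r (elts D) s" "s \<epsilon> M" "\<And>x. x \<epsilon> D \<Longrightarrow> extreme x" for D s
      unfolding extreme_def
    proof (intro allI impI)
      fix x y assume x: "x \<epsilon> M \<and> rel r x s \<and> x \<noteq> s \<and> rel g x y"
      have "\<exists>c. c \<epsilon> D \<and> rel r x c"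
      proof (rule ccontr)
        assume none: "\<nexists>c. c \<epsilon> D \<and> rel r x c"
        have "rel r c x" if "c \<epsilon> D" for c
        proof -
          have "c \<epsilon> M" using that D by auto
          then obtain c' where "rel g c c'" using g MN by blast
          then have "rel r c' x" using split[OF \<open>c \<epsilon> M\<close>] D(4)[OF that] x none that by blast
          then show ?thesis using \<open>rel g c c'\<close> infl trans by blast
        qed
        then have "rel r s x" using D(2) x MN by (simp add: is_lub_def)
        then show False using x antisym by blast
      qed
      then obtain c where c: "c \<epsilon> D" "rel r x c" by blast
      then have cM: "c \<epsilon> M" "extreme c" and cs: "rel r c s" using D by (auto simp: is_lub_def)
      show "rel r y s"
      proof (cases "x = c")
        case True
        \<comment> \<open>Here \<open>M\<close> is split at \<open>c\<close>, whose successor is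
          \<open>y\<close>, with \<open>s\<close> as the tested element: \<open>s\<close> is not
          below \<open>c\<close>, because \<open>x = c\<close> lies below \<open>s\<close> and
          differs from it.\<close>
        then have "rel r y s" if "\<not> rel r s x"
          using split[OF cM(1) cM(2), of y s] x D that by blast
        then show ?thesis using x antisym by blast
      next
        case False
        then show ?thesis using x c cM cs trans unfolding extreme_def by blast
      qed
    qed
  qed
  have "rel r x y \<or> rel r y x" if xy: "x \<epsilon> M" "y \<epsilon> M" for x y
  proof -
    obtain x' where "rel g x x'" using g xy MN by blast
    then show ?thesis using split[OF xy(1) extreme[OF xy(1)] _ xy(2)] infl trans by blast
  qed
  moreover have "elts M \<noteq> {}" using closed_M by (auto simp: closed_def)
  moreover have "elts M \<subseteq> elts N" by (auto simp: MN)
  ultimately obtain s where s: "is_lub N r (elts M) s" using chain[of M] by blast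
  then have sM: "s \<epsilon> M" using closed_M \<open>elts M \<noteq> {}\<close> unfolding closed_def by blast
  obtain t where t: "rel g s t" using g sM MN by blast
  then have "t \<epsilon> M" using closed_M sM unfolding closed_def by blast
  then have "rel r t s" using s by (simp add: is_lub_def)
  then have "t = s" using t infl antisym by blast
  then show thesis using that[of s] t sM MN by blast
qed

end

section \<open>The Ultrafilter Principle yields prime elements\<close>

locale ZF_frame = ZF_model +
  fixes A r
  assumes frame: "is_frame A r"
begin

abbreviation le (infix \<open>\<sqsubseteq>\<close> 50) where "x \<sqsubseteq> y \<equiv> rel r x y"

lemma complete: "is_complete_lattice A r"
  using frame by (simp add: is_frame_def)

lemma partial_order: "partial_order_on (elts A) {(x, y). x \<sqsubseteq> y}"
  using complete by (simp add: is_complete_lattice_def is_poset_def)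

lemma le_refl: "x \<epsilon> A \<Longrightarrow> x \<sqsubseteq> x"
  using partial_order by (auto simp: partial_order_on_def preorder_on_def refl_on_def)

lemma le_carrier: "x \<sqsubseteq> y \<Longrightarrow> x \<epsilon> A" "x \<sqsubseteq> y \<Longrightarrow> y \<epsilon> A"
  using partial_order by (auto simp: partial_order_on_def preorder_on_def)

lemma le_trans: "x \<sqsubseteq> y \<Longrightarrow> y \<sqsubseteq> z \<Longrightarrow> x \<sqsubseteq> z"
  using partial_order unfolding partial_order_on_def preorder_on_def trans_def by blast

lemma le_antisym: "x \<sqsubseteq> y \<Longrightarrow> y \<sqsubseteq> x \<Longrightarrow> x = y"
  using partial_order unfolding partial_order_on_def antisym_def by blast

lemma ex_lub: "elts S \<subseteq> elts A \<Longrightarrow> \<exists>j. is_lub A r (elts S) j"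
  and ex_glb: "elts S \<subseteq> elts A \<Longrightarrow> \<exists>m. is_glb A r (elts S) m"
  using complete by (simp_all add: is_complete_lattice_def)

lemma ex_join:
  assumes "x \<epsilon> A" "y \<epsilon> A" shows "\<exists>j. is_lub A r {x, y} j"
proof -
  obtain S where "elts S = {x, y}" by (rule pair_set)
  then show ?thesis using ex_lub[of S] assms by simp
qed

lemma ex_meet:
  assumes "x \<epsilon> A" "y \<epsilon> A" shows "\<exists>m. is_glb A r {x, y} m"
proof -
  obtain S where "elts S = {x, y}" by (rule pair_set)
  then show ?thesis using ex_glb[of S] assms by simp
qed

lemma ex_top: "\<exists>t. is_glb A r {} t"
proof -
  obtain S where "elts S = {}" by (rule empty_set)
  then show ?thesis using ex_glb[of S] by simp
qed

lemma distrib: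
  assumes "is_lub A r (elts S) s" "elts S \<subseteq> elts A" "is_glb A r {a, s} m" "a \<epsilon> A" "u \<epsilon> A"
    and u: "\<And>x t. x \<epsilon> S \<Longrightarrow> is_glb A r {a, x} t \<Longrightarrow> t \<sqsubseteq> u"
  shows "m \<sqsubseteq> u"
proof -
  have "is_lub A r {t. \<exists>x\<in>elts S. is_glb A r {a, x} t} m"
    using frame assms(1-4) unfolding is_frame_def by blast
  then show ?thesis using u \<open>u \<epsilon> A\<close> unfolding is_lub_def Ball_def Bex_def mem_elts mem_Collect_eq by blast
qed

text \<open>The binary case, with the bound tested on arbitrary common lower bounds; this spares
  naming the meets of \<open>a\<close> with \<open>x\<close> and with \<open>y\<close>.\<close>

lemma distrib_join:
  assumes s: "is_lub A r {x, y} s" and m: "is_glb A r {a, s} m" and "x \<epsilon> A" "y \<epsilon> A" "a \<epsilon> A" "u \<epsilon> A"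
    and u: "\<And>t. t \<sqsubseteq> a \<Longrightarrow> t \<sqsubseteq> x \<Longrightarrow> t \<sqsubseteq> u" "\<And>t. t \<sqsubseteq> a \<Longrightarrow> t \<sqsubseteq> y \<Longrightarrow> t \<sqsubseteq> u"
  shows "m \<sqsubseteq> u"
proof -
  obtain S where S: "elts S = {x, y}" by (rule pair_set)
  then have S': "z \<epsilon> S \<Longrightarrow> z = x \<or> z = y" for z by (auto simp: set_eq_iff)
  show ?thesis
  proof (rule distrib[of S s a])
    show "is_lub A r (elts S) s" "elts S \<subseteq> elts A" using S s assms by auto
    show "t \<sqsubseteq> u" if "z \<epsilon> S" "is_glb A r {a, z} t" for z t
      using S'[OF that(1)] that(2) u unfolding is_glb_def by auto
  qed (use assms in auto)
qed

text \<open>The meet-prime elements, which play the part of the points of the frame; the existential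
  clause excludes the top.\<close>

definition prime_elt where
  "prime_elt p \<longleftrightarrow> p \<epsilon> A \<and> (\<exists>x. x \<epsilon> A \<and> \<not> x \<sqsubseteq> p) \<and>
     (\<forall>y z m. is_glb A r {y, z} m \<and> y \<epsilon> A \<and> z \<epsilon> A \<and> m \<sqsubseteq> p \<longrightarrow> y \<sqsubseteq> p \<or> z \<sqsubseteq> p)"

text \<open>The space consists of the primes, and \<open>a\<close> is represented by the primes not
  above it. Primality turns meets into intersections, joins always become unions, and the separation
  assumption makes the representation reflect the order.\<close>

lemma spatialI:
  assumes sep: "\<And>a b. a \<epsilon> A \<Longrightarrow> b \<epsilon> A \<Longrightarrow> \<not> a \<sqsubseteq> b \<Longrightarrow> \<exists>p. prime_elt p \<and> b \<sqsubseteq> p \<and> \<not> a \<sqsubseteq> p"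
  shows "is_spatial A r"
proof -
  have "definable (\<lambda>\<rho>. prime_elt (\<rho> 0))"
    unfolding prime_elt_def is_glb_def by (intro definable)
  then obtain X where "elts X = {p \<in> elts A. prime_elt p}" by (rule separate)
  then have X: "p \<epsilon> X \<longleftrightarrow> prime_elt p" for p by (auto simp: set_eq_iff prime_elt_def)
  define opn where "opn a U \<longleftrightarrow> (\<forall>p. p \<epsilon> U \<longleftrightarrow> p \<epsilon> X \<and> \<not> a \<sqsubseteq> p)" for a U
  obtain Q where Q: "\<And>U. U \<epsilon> Q \<longleftrightarrow> elts U \<subseteq> elts X" using Pow_set[of X] by blast
  have "definable (\<lambda>\<rho>. \<exists>a. a \<epsilon> A \<and> opn a (\<rho> 0))"
    unfolding opn_def by (intro definable)
  then obtain T where "elts T = {U \<in> elts Q. \<exists>a. a \<epsilon> A \<and> opn a U}" by (rule separate)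
  then have T: "U \<epsilon> T \<longleftrightarrow> (\<exists>a. a \<epsilon> A \<and> opn a U)" for U
    by (auto simp: set_eq_iff Q opn_def)
  have "definable (\<lambda>\<rho>. opn (\<rho> (Suc 0)) (\<rho> 0))"
    unfolding opn_def by (intro definable)
  then obtain f where f: "\<And>a U. rel f a U \<longleftrightarrow> a \<epsilon> A \<and> U \<epsilon> T \<and> opn a U"
    and f_pairs: "\<And>p. p \<epsilon> f \<Longrightarrow> \<exists>x y. x \<epsilon> A \<and> y \<epsilon> T \<and> is_pair p x y"
    by (rule separate_rel[where a = A and b = T]) blast
  have f_iff: "rel f a U \<longleftrightarrow> a \<epsilon> A \<and> opn a U" for a U using f T by blast
  have order: "a \<sqsubseteq> b \<longleftrightarrow> elts U \<subseteq> elts V" if U: "rel f a U" and V: "rel f b V" for a b U V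
  proof
    assume "a \<sqsubseteq> b"
    then show "elts U \<subseteq> elts V" using that le_trans by (auto simp: f_iff opn_def)
  next
    assume UV: "elts U \<subseteq> elts V"
    show "a \<sqsubseteq> b"
    proof (rule ccontr)
      assume "\<not> a \<sqsubseteq> b"
      then obtain p where "prime_elt p" "b \<sqsubseteq> p" "\<not> a \<sqsubseteq> p" using sep U V unfolding f_iff by blast
      then have "p \<epsilon> U" "\<not> p \<epsilon> V" using that by (auto simp: f_iff opn_def X)
      then show False using UV by auto
    qed
  qed
  have f_fun: "is_fun f A T"
    unfolding is_fun_def
  proof (intro conjI allI impI)
    fix a assume a: "a \<epsilon> A"
    have "definable (\<lambda>\<rho>. \<not> a \<sqsubseteq> \<rho> 0)" by (intro definable)
    then obtain U where "elts U = {p \<in> elts X. \<not> a \<sqsubseteq> p}" by (rule separate)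
    then have "opn a U" by (simp add: opn_def set_eq_iff)
    moreover have "U = V" if "opn a U" "opn a V" for U V
      by (rule set_ext) (use that in \<open>simp add: opn_def\<close>)
    ultimately show "\<exists>!U. rel f a U" using a by (auto simp: f_iff)
  qed (rule f_pairs)
  have "is_topology X T"
    unfolding is_topology_def
  proof (intro conjI allI impI)
    show "elts U \<subseteq> elts X" if "U \<epsilon> T" for U using that by (auto simp: T opn_def)
    obtain t where t: "is_glb A r {} t" using ex_top by blast
    have "\<not> t \<sqsubseteq> p" if "p \<epsilon> X" for p
      using that t le_trans unfolding X prime_elt_def is_glb_def by blast
    then show "X \<epsilon> T" using t unfolding T opn_def is_glb_def by blast
  next
    fix U V W assume W: "U \<epsilon> T \<and> V \<epsilon> T \<and> elts W = elts U \<inter> elts V"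
    then obtain a b where ab: "a \<epsilon> A" "opn a U" "b \<epsilon> A" "opn b V" by (auto simp: T)
    obtain m where m: "is_glb A r {a, b} m" using ex_meet ab by blast
    then have mA: "m \<epsilon> A" "m \<sqsubseteq> a" "m \<sqsubseteq> b" by (auto simp: is_glb_def)
    have "m \<sqsubseteq> p \<longleftrightarrow> a \<sqsubseteq> p \<or> b \<sqsubseteq> p" if "p \<epsilon> X" for p
      using that m ab mA le_trans unfolding X prime_elt_def by blast
    moreover have "p \<epsilon> W \<longleftrightarrow> p \<epsilon> U \<and> p \<epsilon> V" for p using W by (auto simp: set_eq_iff)
    ultimately have "opn m W" using ab unfolding opn_def by blast
    then show "W \<epsilon> T" using mA T by blast
  next
    fix S W assume W: "elts S \<subseteq> elts T \<and> elts W = (\<Union>U\<in>elts S. elts U)"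
    \<comment> \<open>\<open>D\<close> gathers every element that represents a member of
      \<open>S\<close>, so no representative has to be selected.\<close>
    have "definable (\<lambda>\<rho>. \<exists>U. U \<epsilon> S \<and> opn (\<rho> 0) U)"
      unfolding opn_def by (intro definable)
    then obtain D where D: "elts D = {a \<in> elts A. \<exists>U. U \<epsilon> S \<and> opn a U}" by (rule separate)
    then have D_iff: "a \<epsilon> D \<longleftrightarrow> a \<epsilon> A \<and> (\<exists>U. U \<epsilon> S \<and> opn a U)" for a by (simp add: set_eq_iff)
    obtain s where s: "is_lub A r (elts D) s" using ex_lub[of D] D by blast
    have "opn s W"
      unfolding opn_def
    proof (intro allI iffI)
      fix p assume "p \<epsilon> W"
      then have "p \<in> (\<Union>U\<in>elts S. elts U)" using W by (auto simp: set_eq_iff)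
      then obtain U where U: "U \<epsilon> S" "p \<epsilon> U" by auto
      then have "U \<epsilon> T" using W by auto
      then obtain a where a: "a \<epsilon> A" "opn a U" using T by blast
      then have "a \<sqsubseteq> s" using s U by (auto simp: is_lub_def D_iff)
      then show "p \<epsilon> X \<and> \<not> s \<sqsubseteq> p" using a U le_trans by (auto simp: opn_def)
    next
      fix p assume p: "p \<epsilon> X \<and> \<not> s \<sqsubseteq> p"
      then have "p \<epsilon> A" by (simp add: X prime_elt_def)
      then obtain a where a: "a \<epsilon> D" "\<not> a \<sqsubseteq> p" using s p unfolding is_lub_def Ball_def mem_elts by blast
      then obtain U where "U \<epsilon> S" "opn a U" by (auto simp: D_iff)
      then have "p \<in> (\<Union>U\<in>elts S. elts U)" using a p by (auto simp: opn_def)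
      then show "p \<epsilon> W" using W by (auto simp: set_eq_iff)
    qed
    then show "W \<epsilon> T" using s T unfolding is_lub_def by blast
  qed
  moreover have "is_inj f"
    unfolding is_inj_def using order le_antisym by (metis subset_refl)
  moreover have "\<forall>U. U \<epsilon> T \<longrightarrow> (\<exists>x. rel f x U)" by (simp add: T f_iff)
  ultimately show ?thesis
    unfolding is_spatial_def using f_fun order by blast
qed



section \<open>Primes avoiding a Scott-open filter\<close>

lemma prime_above:
  assumes up: ultrafilter_principle
    and \<kappa>: "is_scott_open_filter A r \<kappa>" and b: "b \<epsilon> A" "\<not> b \<epsilon> \<kappa>"
  shows "\<exists>p. prime_elt p \<and> b \<sqsubseteq> p \<and> \<not> p \<epsilon> \<kappa>"
proof -
  have \<kappa>_up: "x \<epsilon> \<kappa> \<Longrightarrow> x \<sqsubseteq> y \<Longrightarrow> y \<epsilon> \<kappa>"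
    and \<kappa>_top: "is_glb A r {} x \<Longrightarrow> x \<epsilon> \<kappa>"
    and \<kappa>_meet: "x \<epsilon> \<kappa> \<Longrightarrow> y \<epsilon> \<kappa> \<Longrightarrow> is_glb A r {x, y} m \<Longrightarrow> m \<epsilon> \<kappa>" for x y m
    using \<kappa> unfolding is_scott_open_filter_def by blast+
  have \<kappa>_open: "\<exists>d. d \<epsilon> D \<and> d \<epsilon> \<kappa>"
    if "elts D \<subseteq> elts A" "is_directed r D" "is_lub A r (elts D) s" "s \<epsilon> \<kappa>" for D s
    using \<kappa> that unfolding is_scott_open_filter_def mem_elts Bex_def by blast

  have "definable (\<lambda>\<rho>. b \<sqsubseteq> \<rho> 0 \<and> \<not> \<rho> 0 \<epsilon> \<kappa>)" by (intro definable)
  then obtain N where "elts N = {x \<in> elts A. b \<sqsubseteq> x \<and> \<not> x \<epsilon> \<kappa>}" by (rule separate)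
  then have N: "x \<epsilon> N \<longleftrightarrow> b \<sqsubseteq> x \<and> \<not> x \<epsilon> \<kappa>" for x using le_carrier by (auto simp: set_eq_iff)
  have NA: "x \<epsilon> N \<Longrightarrow> x \<epsilon> A" for x using N le_carrier by blast

  have "definable (\<lambda>\<rho>. True)" by (intro definable)
  then obtain Z where Z: "\<And>x y. rel Z x y \<longleftrightarrow> x \<epsilon> A \<and> y \<epsilon> A"
    by (rule separate_rel[where a = A and b = A and P = "\<lambda>_ _. True"]) blast
  obtain PZ where PZ: "\<And>S. S \<epsilon> PZ \<longleftrightarrow> elts S \<subseteq> elts Z" using Pow_set[of Z] by blast
  \<comment> \<open>The relations in the set \<open>X\<close> defined below act like forcing
    conditions: \<open>S\<close> promises to put \<open>y\<close> into the ideal at \<open>x\<close>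
    whenever \<open>rel S x y\<close>, and \<open>bounded S x w\<close> says that \<open>w\<close>
    keeps the promises made at \<open>x\<close> consistent with avoiding
    \<open>\<kappa>\<close>.\<close>
  define bounded where "bounded S x w \<longleftrightarrow> w \<epsilon> N \<and> x \<sqsubseteq> w \<and> (\<forall>u. rel S x u \<longrightarrow> u \<sqsubseteq> w)" for S x w
  have "definable (\<lambda>\<rho>. \<forall>x. x \<epsilon> N \<longrightarrow> (\<exists>w. bounded (\<rho> 0) x w))"
    unfolding bounded_def by (intro definable)
  then obtain X where "elts X = {S \<in> elts PZ. \<forall>x. x \<epsilon> N \<longrightarrow> (\<exists>w. bounded S x w)}" by (rule separate)
  then have X: "S \<epsilon> X \<longleftrightarrow> elts S \<subseteq> elts Z \<and> (\<forall>x. x \<epsilon> N \<longrightarrow> (\<exists>w. bounded S x w))" for S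
    by (simp add: set_eq_iff PZ)
  obtain PX where PX: "\<And>S. S \<epsilon> PX \<longleftrightarrow> elts S \<subseteq> elts X" using Pow_set[of X] by blast
  have rel_mono: "rel S x y \<Longrightarrow> elts S \<subseteq> elts S' \<Longrightarrow> rel S' x y" for S S' x y
    unfolding rel_def elts_subset_iff by blast
  have bounded_antimono: "bounded S' x w \<Longrightarrow> elts S \<subseteq> elts S' \<Longrightarrow> bounded S x w" for S S' x w
    unfolding bounded_def using rel_mono by blast

  \<comment> \<open>The cones above the various \<open>S'\<close> have a dense open union, and
    \<open>U\<close> contains it. Such sets form a filter, whereas sets that are merely dense may
    have disjoint members.\<close>
  define dense where "dense U \<longleftrightarrow> (\<forall>S. S \<epsilon> X \<longrightarrow> (\<exists>S'. S' \<epsilon> X \<and> elts S \<subseteq> elts S' \<and>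
    (\<forall>S''. S'' \<epsilon> X \<and> elts S' \<subseteq> elts S'' \<longrightarrow> S'' \<epsilon> U)))" for U
  have denseD: "\<exists>S'. S' \<epsilon> X \<and> elts S \<subseteq> elts S' \<and>
    (\<forall>S''. S'' \<epsilon> X \<and> elts S' \<subseteq> elts S'' \<longrightarrow> S'' \<epsilon> U)" if "dense U" "S \<epsilon> X" for U S
    using that by (simp only: dense_def)
  have "definable (\<lambda>\<rho>. dense (\<rho> 0))" unfolding dense_def by (intro definable)
  then obtain F where "elts F = {U \<in> elts PX. dense U}" by (rule separate)
  then have F: "U \<epsilon> F \<longleftrightarrow> elts U \<subseteq> elts X \<and> dense U" for U by (simp add: set_eq_iff PX)
  have "set_filter X F"
  proof (rule set_filterI)
    show "X \<epsilon> F" unfolding F dense_def by blast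
  next
    fix U V assume "U \<epsilon> F" "elts U \<subseteq> elts V" "elts V \<subseteq> elts X"
    then show "V \<epsilon> F" unfolding F dense_def elts_subset_iff by meson
  next
    fix U V W assume UV: "U \<epsilon> F" "V \<epsilon> F" and W: "elts W = elts U \<inter> elts V"
    have dUV: "dense U" "dense V" using UV by (simp_all add: F)
    have "dense W"
      unfolding dense_def
    proof (intro allI impI)
      fix S assume S: "S \<epsilon> X"
      obtain S1 where S1: "S1 \<epsilon> X" "elts S \<subseteq> elts S1" "\<forall>S''. S'' \<epsilon> X \<and> elts S1 \<subseteq> elts S'' \<longrightarrow> S'' \<epsilon> U"
        using denseD[OF dUV(1) S] by blast
      obtain S2 where S2: "S2 \<epsilon> X" "elts S1 \<subseteq> elts S2" "\<forall>S''. S'' \<epsilon> X \<and> elts S2 \<subseteq> elts S'' \<longrightarrow> S'' \<epsilon> V"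
        using denseD[OF dUV(2) S1(1)] by blast
      have "S'' \<epsilon> W" if S'': "S'' \<epsilon> X" "elts S2 \<subseteq> elts S''" for S''
      proof -
        have "S'' \<epsilon> V" using S2(3) S'' by blast
        moreover have "elts S1 \<subseteq> elts S''" using S2(2) S''(2) by (rule subset_trans)
        then have "S'' \<epsilon> U" using S1(3) S''(1) by blast
        ultimately have "S'' \<in> elts W" by (simp add: W)
        then show ?thesis by simp
      qed
      moreover have "elts S \<subseteq> elts S2" using S1(2) S2(2) by (rule subset_trans)
      ultimately show "\<exists>S'. S' \<epsilon> X \<and> elts S \<subseteq> elts S' \<and> (\<forall>S''. S'' \<epsilon> X \<and> elts S' \<subseteq> elts S'' \<longrightarrow> S'' \<epsilon> W)"
        using S2(1) by blast
    qed
    moreover have "elts W \<subseteq> elts X" using UV(1) W by (auto simp: F)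
    ultimately show "W \<epsilon> F" by (simp add: F)
  qed (simp add: F)
  moreover have "elts U \<noteq> {}" if "U \<epsilon> F" for U
  proof -
    \<comment> \<open>The empty relation is a condition, since each \<open>x\<close> in
      \<open>N\<close> serves as its own bound. Hence there is a condition below which density can
      be applied.\<close>
    obtain E where E: "elts E = {}" by (rule empty_set)
    then have "bounded E x x" if "x \<epsilon> N" for x
      using that le_refl NA by (auto simp: bounded_def rel_def set_eq_iff)
    then have "E \<epsilon> X" using E by (auto simp: X)
    moreover have "dense U" using that by (simp add: F)
    ultimately obtain S where "S \<epsilon> U" using denseD[of U E] by blast
    then show ?thesis by auto
  qed
  ultimately obtain G where G: "set_ultrafilter X G" and FG: "\<And>U. U \<epsilon> F \<Longrightarrow> U \<epsilon> G"
    using up unfolding ultrafilter_principle_def proper_set_filter_def elts_subset_iff by meson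
  note G_filter = set_filterD[OF set_ultrafilterD(1)[OF G]]

  \<comment> \<open>\<open>large P\<close> means that \<open>P\<close> holds for almost every
    condition in the sense of \<open>G\<close>. The set of these conditions has to exist in the
    model, which explains the definability assumptions in the rules that follow.\<close>
  define large where "large P \<longleftrightarrow> (\<exists>U. U \<epsilon> G \<and> (\<forall>S. S \<epsilon> U \<longleftrightarrow> S \<epsilon> X \<and> P S))" for P
  have large_mono: "large Q" if P: "large P" and Q: "definable (\<lambda>\<rho>. Q (\<rho> 0))"
    and PQ: "\<And>S. S \<epsilon> X \<Longrightarrow> P S \<Longrightarrow> Q S" for P Q
  proof -
    obtain U where U: "U \<epsilon> G" "\<And>S. S \<epsilon> U \<longleftrightarrow> S \<epsilon> X \<and> P S" using P by (auto simp: large_def)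
    obtain V where "elts V = {S \<in> elts X. Q S}" using Q by (rule separate)
    then have V: "S \<epsilon> V \<longleftrightarrow> S \<epsilon> X \<and> Q S" for S by (simp add: set_eq_iff)
    then have "elts U \<subseteq> elts V" "elts V \<subseteq> elts X" by (simp_all add: elts_subset_iff U(2) PQ)
    then have "V \<epsilon> G" using G_filter(3) U(1) by blast
    then show ?thesis using V by (auto simp: large_def)
  qed
  have large_conj: "large (\<lambda>S. P S \<and> Q S)" if PQ: "large P" "large Q" for P Q
  proof -
    obtain U V where U: "U \<epsilon> G" "\<And>S. S \<epsilon> U \<longleftrightarrow> S \<epsilon> X \<and> P S"
      and V: "V \<epsilon> G" "\<And>S. S \<epsilon> V \<longleftrightarrow> S \<epsilon> X \<and> Q S"
      using PQ unfolding large_def by blast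
    obtain W where W: "elts W = elts U \<inter> elts V" by (rule Int_set)
    then have "W \<epsilon> G" using G_filter(4) U V by blast
    moreover have "S \<epsilon> W \<longleftrightarrow> S \<epsilon> X \<and> P S \<and> Q S" for S
      using W U V by (auto simp: set_eq_iff)
    ultimately show ?thesis unfolding large_def by blast
  qed
  have large_cases: "large P \<or> large (\<lambda>S. \<not> P S)" if P: "definable (\<lambda>\<rho>. P (\<rho> 0))" for P
  proof -
    obtain U where "elts U = {S \<in> elts X. P S}" using P by (rule separate)
    then have U: "S \<epsilon> U \<longleftrightarrow> S \<epsilon> X \<and> P S" for S by (simp add: set_eq_iff)
    obtain V where V: "elts V = elts X - elts U" by (rule Diff_set)
    then have V': "S \<epsilon> V \<longleftrightarrow> S \<epsilon> X \<and> \<not> P S" for S using U by (auto simp: set_eq_iff)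
    have "U \<epsilon> G \<or> V \<epsilon> G" by (rule ultrafilter_prime[OF G _ V]) (auto simp: U)
    then show ?thesis using U V' unfolding large_def by blast
  qed
  have large_ex: "\<exists>S. S \<epsilon> X \<and> P S" if P: "large P" for P
  proof -
    obtain U where U: "U \<epsilon> G" "\<And>S. S \<epsilon> U \<longleftrightarrow> S \<epsilon> X \<and> P S" using P unfolding large_def by blast
    obtain S where "S \<in> elts U" using set_ultrafilterD(2)[OF G U(1)] by blast
    then show ?thesis using U(2) by auto
  qed
  have large_dense: "large P" if P: "definable (\<lambda>\<rho>. P (\<rho> 0))"
    and d: "\<And>S. S \<epsilon> X \<Longrightarrow> \<exists>S'. S' \<epsilon> X \<and> elts S \<subseteq> elts S' \<and> (\<forall>S''. S'' \<epsilon> X \<and> elts S' \<subseteq> elts S'' \<longrightarrow> P S'')" for P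
  proof -
    obtain U where "elts U = {S \<in> elts X. P S}" using P by (rule separate)
    then have U: "S \<epsilon> U \<longleftrightarrow> S \<epsilon> X \<and> P S" for S by (simp add: set_eq_iff)
    have "dense U" using d unfolding dense_def U by blast
    then have "U \<epsilon> G" using FG[of U] U by (simp add: F elts_subset_iff)
    then show ?thesis using U unfolding large_def by blast
  qed

  \<comment> \<open>If \<open>y\<close> can still be added to the promises at \<open>x\<close>,
    adding the pair gives a larger condition in \<open>X\<close>, because the sections at other
    elements are unchanged. If it cannot, no extension can add it either, as bounds only disappear
    when \<open>S\<close> grows. So a decision is reached on a dense open set.\<close>
  have decided: "large (\<lambda>S. rel S x y \<or> \<not> (\<exists>w. bounded S x w \<and> y \<sqsubseteq> w))" if xy: "x \<epsilon> N" "y \<epsilon> A" for x y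
  proof (rule large_dense)
    show "definable (\<lambda>\<rho>. rel (\<rho> 0) x y \<or> \<not> (\<exists>w. bounded (\<rho> 0) x w \<and> y \<sqsubseteq> w))"
      unfolding bounded_def by (intro definable)
    fix S assume S: "S \<epsilon> X"
    show "\<exists>S'. S' \<epsilon> X \<and> elts S \<subseteq> elts S' \<and> (\<forall>S''. S'' \<epsilon> X \<and> elts S' \<subseteq> elts S'' \<longrightarrow>
      rel S'' x y \<or> \<not> (\<exists>w. bounded S'' x w \<and> y \<sqsubseteq> w))"
    proof (cases "\<exists>w. bounded S x w \<and> y \<sqsubseteq> w")
      case False
      then show ?thesis using S bounded_antimono by blast
    next
      case True
      then obtain w where w: "bounded S x w" "y \<sqsubseteq> w" by blast
      obtain p where p: "is_pair p x y" by (rule ex_pair)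
      obtain P where P: "elts P = {p, p}" by (rule pair_set)
      obtain S' where "elts S' = elts S \<union> elts P" by (rule Un_set)
      then have S': "elts S' = insert p (elts S)" using P by simp
      then have S'_iff: "q \<epsilon> S' \<longleftrightarrow> q = p \<or> q \<epsilon> S" for q by (auto simp: set_eq_iff)
      have rel_S': "rel S' u v \<longleftrightarrow> u = x \<and> v = y \<or> rel S u v" for u v
      proof -
        obtain q where q: "is_pair q u v" by (rule ex_pair)
        have "q = p \<longleftrightarrow> u = x \<and> v = y"
          using is_pair_inject is_pair_unique p q by blast
        then show ?thesis by (simp add: rel_iff[OF q] S'_iff)
      qed
      have "p \<epsilon> Z" using Z[of x y] xy NA rel_iff[OF p] by blast
      then have "elts S' \<subseteq> elts Z" using S S' by (simp add: X)
      moreover have "\<exists>v. bounded S' u v" if "u \<epsilon> N" for u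
      proof (cases "u = x")
        case True
        have "bounded S' x w" using w by (auto simp: bounded_def rel_S')
        then show ?thesis using True by blast
      next
        case False
        then show ?thesis using S that by (auto simp: X bounded_def rel_S')
      qed
      ultimately have "S' \<epsilon> X" by (simp add: X)
      moreover have "elts S \<subseteq> elts S'" using S' by blast
      moreover have "rel S' x y" by (simp add: rel_S')
      ultimately show ?thesis using rel_mono by blast
    qed
  qed

  define \<Phi> where "\<Phi> x y \<longleftrightarrow> large (\<lambda>S. rel S x y)" for x y
  \<comment> \<open>Whatever almost every condition could add consistently has already been added,
    by \<open>decided\<close>. The ideal properties of \<open>\<Phi> x\<close> are instances of
    this.\<close>
  have \<Phi>I: "\<Phi> x y" if x: "x \<epsilon> N" "y \<epsilon> A" and P: "large P"
    and w: "\<And>S. S \<epsilon> X \<Longrightarrow> P S \<Longrightarrow> \<exists>w. bounded S x w \<and> y \<sqsubseteq> w" for x y P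
    unfolding \<Phi>_def
  proof (rule large_mono[OF large_conj[OF P decided[OF x]]])
    show "definable (\<lambda>\<rho>. rel (\<rho> 0) x y)" by (intro definable)
  qed (use w in blast)
  have X_bounded: "\<exists>w. bounded S x w" if "S \<epsilon> X" "x \<epsilon> N" for S x
    using that by (simp add: X)
  have \<Phi>_mem: "y \<epsilon> A" if \<Phi>: "\<Phi> x y" for x y
  proof -
    obtain S where "S \<epsilon> X" "rel S x y" using large_ex[OF \<Phi>[unfolded \<Phi>_def]] by blast
    then have "rel Z x y" using rel_mono by (auto simp: X)
    then show ?thesis by (simp add: Z)
  qed
  have \<Phi>_down: "\<Phi> x y" if "x \<epsilon> N" "y \<sqsubseteq> z" "\<Phi> x z" for x y z
    using \<Phi>I[of x y "\<lambda>S. rel S x z"] that X_bounded le_carrier le_trans unfolding \<Phi>_def bounded_def by blast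
  have \<Phi>_refl: "\<Phi> x x" if "x \<epsilon> N" for x
    using \<Phi>I[OF that NA[OF that] decided[OF that NA[OF that]]] X_bounded that unfolding bounded_def by blast
  have \<Phi>_join: "\<Phi> x j" if "x \<epsilon> N" "\<Phi> x y" "\<Phi> x z" and j: "is_lub A r {y, z} j" for x y z j
  proof (rule \<Phi>I[OF that(1)])
    show "j \<epsilon> A" using j by (simp add: is_lub_def)
    show "large (\<lambda>S. rel S x y \<and> rel S x z)" using that large_conj unfolding \<Phi>_def by blast
    show "\<exists>w. bounded S x w \<and> j \<sqsubseteq> w" if S: "S \<epsilon> X" "rel S x y \<and> rel S x z" for S
    proof -
      obtain w where w: "bounded S x w" using X_bounded S \<open>x \<epsilon> N\<close> by blast
      then have "j \<sqsubseteq> w" using S j NA unfolding bounded_def is_lub_def by blast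
      then show ?thesis using w by blast
    qed
  qed
  have \<Phi>_\<kappa>: "\<not> y \<epsilon> \<kappa>" if x: "x \<epsilon> N" and \<Phi>: "\<Phi> x y" for x y
  proof
    assume "y \<epsilon> \<kappa>"
    obtain S where S: "S \<epsilon> X" "rel S x y" using large_ex[OF \<Phi>[unfolded \<Phi>_def]] by blast
    then obtain w where "bounded S x w" using X_bounded x by blast
    then show False using S \<open>y \<epsilon> \<kappa>\<close> \<kappa>_up by (auto simp: bounded_def N)
  qed
  \<comment> \<open>Otherwise a single condition \<open>S\<close> contains \<open>m\<close> at
    \<open>x\<close> and blocks both \<open>y\<close> and \<open>z\<close>. For a bound
    \<open>w\<close> of \<open>S\<close> at \<open>x\<close>, the joins of \<open>w\<close> with
    \<open>y\<close> and with \<open>z\<close> must lie in \<open>\<kappa>\<close>, or they would be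
    bounds themselves. Their meet then lies in \<open>\<kappa>\<close> too, but by distributivity it
    is below \<open>w\<close>.\<close>
  have \<Phi>_prime: "\<Phi> x y \<or> \<Phi> x z" if xyz: "x \<epsilon> N" "y \<epsilon> A" "z \<epsilon> A" and m: "is_glb A r {y, z} m" "\<Phi> x m" for x y z m
  proof (rule ccontr)
    assume no: "\<not> (\<Phi> x y \<or> \<Phi> x z)"
    have not_rel: "large (\<lambda>S. \<not> rel S x v)" if "\<not> \<Phi> x v" for v
    proof -
      have "definable (\<lambda>\<rho>. rel (\<rho> 0) x v)" by (intro definable)
      from large_cases[OF this] that show ?thesis unfolding \<Phi>_def by blast
    qed
    have "large (\<lambda>S. rel S x m \<and> (\<not> rel S x y \<and> \<not> rel S x z) \<and>
       (rel S x y \<or> \<not> (\<exists>w. bounded S x w \<and> y \<sqsubseteq> w)) \<and> (rel S x z \<or> \<not> (\<exists>w. bounded S x w \<and> z \<sqsubseteq> w)))"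
      using no by (intro large_conj m(2)[unfolded \<Phi>_def] not_rel decided xyz) blast+
    then obtain S where S: "S \<epsilon> X" "rel S x m"
      and blocked: "\<And>w. bounded S x w \<Longrightarrow> \<not> y \<sqsubseteq> w" "\<And>w. bounded S x w \<Longrightarrow> \<not> z \<sqsubseteq> w"
      using large_ex by blast
    obtain w where w: "bounded S x w" using X_bounded S xyz by blast
    then have wN: "w \<epsilon> N" and wA: "w \<epsilon> A" and mw: "m \<sqsubseteq> w" using S NA by (auto simp: bounded_def)
    have join_\<kappa>: "j \<epsilon> \<kappa>" if j: "is_lub A r {v, w} j" and v: "\<And>w. bounded S x w \<Longrightarrow> \<not> v \<sqsubseteq> w" for v j
    proof (rule ccontr)
      assume "\<not> j \<epsilon> \<kappa>"
      moreover have "v \<sqsubseteq> j" "w \<sqsubseteq> j" using j by (auto simp: is_lub_def)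
      ultimately have "bounded S x j"
        using w le_trans unfolding bounded_def N by blast
      then show False using v \<open>v \<sqsubseteq> j\<close> by blast
    qed
    obtain j where j: "is_lub A r {y, w} j" using ex_join xyz wA by blast
    obtain k where k: "is_lub A r {z, w} k" using ex_join xyz wA by blast
    have jk: "j \<epsilon> A" "k \<epsilon> A" using j k by (auto simp: is_lub_def)
    obtain n where n: "is_glb A r {j, k} n" using ex_meet jk by blast
    \<comment> \<open>Distributivity is applied first to the join of \<open>z\<close> and
      \<open>w\<close>, then to that of \<open>y\<close> and \<open>w\<close>; the remaining lower
      bound of \<open>y\<close> and \<open>z\<close> lies below \<open>m\<close>, hence below
      \<open>w\<close>.\<close>
    have "n \<sqsubseteq> w"
    proof (rule distrib_join[OF k n xyz(3) wA jk(1) wA])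
      fix t assume t: "t \<sqsubseteq> j" "t \<sqsubseteq> z"
      have tA: "t \<epsilon> A" using t le_carrier by blast
      have "is_glb A r {t, j} t" using t le_refl[OF tA] tA by (auto simp: is_glb_def)
      then show "t \<sqsubseteq> w"
      proof (rule distrib_join[OF j _ xyz(2) wA tA wA])
        fix u assume "u \<sqsubseteq> t" "u \<sqsubseteq> y"
        then have "u \<sqsubseteq> m" using m(1) t le_trans le_carrier unfolding is_glb_def by blast
        then show "u \<sqsubseteq> w" using mw le_trans by blast
      qed
    qed
    moreover have "n \<epsilon> \<kappa>" using \<kappa>_meet[OF join_\<kappa>[OF j blocked(1)] join_\<kappa>[OF k blocked(2)] n] by blast
    ultimately show False using \<kappa>_up wN N by blast
  qed

  \<comment> \<open>Here the use of one ultrafilter pays off: \<open>\<Phi>\<close> is described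
    uniformly in \<open>x\<close> from the single parameter \<open>G\<close>, so the whole family of
    ideals is a relation in the model.\<close>
  have "definable (\<lambda>\<rho>. \<Phi> (\<rho> (Suc 0)) (\<rho> 0))"
    unfolding \<Phi>_def large_def by (intro definable)
  then obtain R where R: "\<And>x y. rel R x y \<longleftrightarrow> x \<epsilon> N \<and> y \<epsilon> A \<and> \<Phi> x y"
    by (rule separate_rel[where a = N and b = A]) blast
  have "definable (\<lambda>\<rho>. is_lub A r {y. rel R (\<rho> (Suc 0)) y} (\<rho> 0))"
    unfolding is_lub_def by (intro definable)
  then obtain g where g: "\<And>x p. rel g x p \<longleftrightarrow> x \<epsilon> N \<and> p \<epsilon> N \<and> is_lub A r {y. rel R x y} p"
    by (rule separate_rel[where a = N and b = N]) blast
  \<comment> \<open>Scott-openness in contrapositive form. It is used twice, for the join of an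
    ideal \<open>\<Phi> x\<close> and for the join of a chain in \<open>N\<close>.\<close>
  have lub_N: "s \<epsilon> N" if D: "elts D \<subseteq> elts A" "\<And>d. d \<epsilon> D \<Longrightarrow> \<not> d \<epsilon> \<kappa>" "is_directed r D"
    "is_lub A r (elts D) s" "d \<epsilon> D" "b \<sqsubseteq> d" for D s d
  proof -
    have "\<not> s \<epsilon> \<kappa>" using \<kappa>_open D by blast
    moreover have "d \<sqsubseteq> s" using D by (simp add: is_lub_def)
    ultimately show ?thesis using D le_trans N by blast
  qed
  have g_total: "\<exists>!p. rel g x p" if x: "x \<epsilon> N" for x
  proof -
    have "definable (\<lambda>\<rho>. rel R x (\<rho> 0))" by (intro definable)
    then obtain D where "elts D = {y \<in> elts A. rel R x y}" by (rule separate)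
    then have D: "elts D = {y. rel R x y}" using R by auto
    then have D_iff: "y \<epsilon> D \<longleftrightarrow> \<Phi> x y" for y using R x \<Phi>_mem by (auto simp: set_eq_iff)
    have DA: "elts D \<subseteq> elts A" using \<Phi>_mem by (auto simp: D_iff)
    obtain p where p: "is_lub A r (elts D) p" using ex_lub[OF DA] by blast
    have "is_directed r D"
      unfolding is_directed_def
    proof (intro conjI ballI)
      show "elts D \<noteq> {}" using \<Phi>_refl[OF x] D_iff by auto
      fix y z assume yz: "y \<in> elts D" "z \<in> elts D"
      then have "y \<epsilon> A" "z \<epsilon> A" using DA by auto
      then obtain j where j: "is_lub A r {y, z} j" using ex_join by blast
      moreover have "\<Phi> x y" "\<Phi> x z" using yz D_iff by simp_all
      ultimately have "j \<epsilon> D" using \<Phi>_join[OF x] D_iff by blast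
      moreover have "y \<sqsubseteq> j" "z \<sqsubseteq> j" using j by (simp_all add: is_lub_def)
      ultimately show "\<exists>j\<in>elts D. y \<sqsubseteq> j \<and> z \<sqsubseteq> j" by (auto intro: bexI[of _ j])
    qed
    moreover have "\<not> d \<epsilon> \<kappa>" if "d \<epsilon> D" for d using that \<Phi>_\<kappa>[OF x] D_iff by blast
    moreover have "x \<epsilon> D" using \<Phi>_refl[OF x] D_iff by blast
    moreover have "b \<sqsubseteq> x" using x N by blast
    ultimately have "p \<epsilon> N" using lub_N[OF DA _ _ p] by blast
    then have "rel g x p" using x p by (simp add: D g)
    moreover have "q = p" if "rel g x q" for q
      using that p le_antisym unfolding g D is_lub_def by blast
    ultimately show ?thesis by blast
  qed
  have "\<exists>p. p \<epsilon> N \<and> rel g p p"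
  proof (rule bourbaki_witt[of N r b g])
    show "x \<sqsubseteq> p" if "rel g x p" for x p
      using that \<Phi>_refl[of x] R NA unfolding g is_lub_def by auto
    fix D assume D: "elts D \<subseteq> elts N" "elts D \<noteq> {}" and chain: "\<And>x y. x \<epsilon> D \<Longrightarrow> y \<epsilon> D \<Longrightarrow> x \<sqsubseteq> y \<or> y \<sqsubseteq> x"
    have DA: "elts D \<subseteq> elts A" using D NA by auto
    obtain s where s: "is_lub A r (elts D) s" using ex_lub[OF DA] by blast
    obtain d where d: "d \<epsilon> D" using D(2) by (metis ex_in_conv mem_elts)
    have "is_directed r D"
      unfolding is_directed_def
    proof (intro conjI ballI)
      fix x y assume xy: "x \<in> elts D" "y \<in> elts D"
      then have "x \<sqsubseteq> x" "y \<sqsubseteq> y" using le_refl DA by auto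
      then show "\<exists>z\<in>elts D. x \<sqsubseteq> z \<and> y \<sqsubseteq> z" using chain[of x y] xy by auto
    qed (rule D(2))
    moreover have "\<not> x \<epsilon> \<kappa>" if "x \<epsilon> D" for x using that D(1) N by auto
    moreover have "b \<sqsubseteq> d" using d D(1) N by auto
    ultimately have "s \<epsilon> N" using lub_N[OF DA _ _ s d] by blast
    then have "is_lub N r (elts D) s" using s NA unfolding is_lub_def by blast
    then show "\<exists>s. is_lub N r (elts D) s" by blast
  next
    show "x \<sqsubseteq> x" if "x \<epsilon> N" for x using le_refl NA that by blast
    show "x \<sqsubseteq> z" if "x \<sqsubseteq> y" "y \<sqsubseteq> z" for x y z using le_trans that by blast
    show "x = y" if "x \<sqsubseteq> y" "y \<sqsubseteq> x" for x y using le_antisym that by blast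
    show "b \<epsilon> N" using b le_refl N by blast
    show "b \<sqsubseteq> x" if "x \<epsilon> N" for x using N that by blast
    show "\<exists>!y. rel g x y" if "x \<epsilon> N" for x using g_total that .
    show "y \<epsilon> N" if "rel g x y" for x y using g that by blast
  qed blast
  then obtain p where p: "p \<epsilon> N" "rel g p p" by blast
  have p_iff: "y \<sqsubseteq> p \<longleftrightarrow> \<Phi> p y" for y
  proof
    show "\<Phi> p y" if "y \<sqsubseteq> p" using \<Phi>_down \<Phi>_refl p that by blast
    show "y \<sqsubseteq> p" if "\<Phi> p y" using p that R \<Phi>_mem by (auto simp: g is_lub_def)
  qed
  have "prime_elt p"
    unfolding prime_elt_def
  proof (intro conjI allI impI)
    show "p \<epsilon> A" using p NA by blast
    obtain t where t: "is_glb A r {} t" using ex_top by blast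
    then have "t \<epsilon> A" "\<not> t \<sqsubseteq> p" using \<kappa>_top \<kappa>_up p N by (auto simp: is_glb_def)
    then show "\<exists>x. x \<epsilon> A \<and> \<not> x \<sqsubseteq> p" by blast
  qed (use \<Phi>_prime[OF p(1)] p_iff in blast)
  then show ?thesis using p N by blast
qed

text \<open>If every Scott-open filter containing \<open>a\<close> contained \<open>b\<close>, it
  would contain the meet \<open>m\<close> of both. Density then puts the value at \<open>a\<close>
  below the value at \<open>m\<close>, and injectivity gives \<open>a = m\<close>, hence
  \<open>a\<close> below \<open>b\<close>.\<close>

lemma canonical_extension_separates:
  assumes e: "is_canonical_extension A r B q e" and inj: "is_inj e"
    and ab: "a \<epsilon> A" "b \<epsilon> A" "\<not> a \<sqsubseteq> b"
  shows "\<exists>\<kappa>. is_scott_open_filter A r \<kappa> \<and> a \<epsilon> \<kappa> \<and> \<not> b \<epsilon> \<kappa>"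
proof (rule ccontr)
  assume none: "\<not> ?thesis"
  obtain m where m: "is_glb A r {a, b} m" using ex_meet ab by blast
  then have mA: "m \<epsilon> A" "m \<sqsubseteq> a" "m \<sqsubseteq> b" by (auto simp: is_glb_def)
  have e_fun: "is_fun e A B" and e_complete: "is_complete_lattice B q"
    and mono: "\<forall>x x' y y'. x \<sqsubseteq> x' \<and> rel e x y \<and> rel e x' y' \<longrightarrow> rel q y y'"
    and dense: "\<forall>u v. u \<epsilon> B \<and> v \<epsilon> B \<and>
        (\<forall>\<kappa> k a b. is_scott_open_filter A r \<kappa> \<and> meet_of e B q \<kappa> k \<and> rel e a b \<longrightarrow>
           rel q k u \<and> rel q v b \<longrightarrow> rel q k b) \<longrightarrow> rel q u v"
    and compact: "\<forall>\<kappa> k a b. is_scott_open_filter A r \<kappa> \<and> meet_of e B q \<kappa> k \<and> rel e a b \<and> rel q k b \<longrightarrow> a \<epsilon> \<kappa>"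
    by (insert e[unfolded is_canonical_extension_def], elim conjE, assumption)+
  have funct: "\<And>x. x \<epsilon> A \<Longrightarrow> \<exists>!y. rel e x y"
    using e_fun by (simp add: is_fun_def)
  have poset: "partial_order_on (elts B) {(x, y). rel q x y}"
    using e_complete by (simp add: is_complete_lattice_def is_poset_def)
  obtain u v where u: "rel e a u" and v: "rel e m v" using funct ab mA by blast
  have vu: "rel q v u" using mono mA u v by blast
  then have B: "u \<epsilon> B" "v \<epsilon> B"
    using poset by (auto simp: partial_order_on_def preorder_on_def)
  have trans: "rel q x y \<Longrightarrow> rel q y z \<Longrightarrow> rel q x z" for x y z
    using poset unfolding partial_order_on_def preorder_on_def trans_def by blast
  have "rel q u v"
  proof (rule dense[THEN spec, THEN spec, THEN mp], intro conjI allI impI B)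
    fix \<kappa> k c d
    assume "is_scott_open_filter A r \<kappa> \<and> meet_of e B q \<kappa> k \<and> rel e c d" "rel q k u \<and> rel q v d"
    then have \<kappa>: "is_scott_open_filter A r \<kappa>" "meet_of e B q \<kappa> k" "rel q k u" "rel q v d" by blast+
    have "a \<epsilon> \<kappa>" using compact \<kappa>(1-3) u by blast
    then have "b \<epsilon> \<kappa>" using none \<kappa> by blast
    moreover have "\<forall>x y m. x \<epsilon> \<kappa> \<and> y \<epsilon> \<kappa> \<and> is_glb A r {x, y} m \<longrightarrow> m \<epsilon> \<kappa>"
      using \<kappa>(1) unfolding is_scott_open_filter_def by (elim conjE)
    ultimately have "m \<epsilon> \<kappa>" using \<open>a \<epsilon> \<kappa>\<close> m by blast
    then have "v \<in> {y. \<exists>x\<in>elts \<kappa>. rel e x y}" using v by auto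
    then have "rel q k v" using \<kappa>(2) unfolding meet_of_def is_glb_def by blast
    then show "rel q k d" using \<kappa>(4) trans by blast
  qed
  then have "u = v" using vu poset unfolding partial_order_on_def antisym_def by blast
  then have "a = m" using inj u v unfolding is_inj_def by blast
  then show False using mA ab by simp
qed

end

lemma (in ZF_model) ultrafilter_principle_imp_spatial:
  assumes ultrafilter_principle
  shows injective_frames_spatial
  unfolding injective_frames_spatial_def
proof (intro allI impI)
  fix A r B q e
  assume e: "is_frame A r \<and> is_canonical_extension A r B q e \<and> is_inj e"
  then interpret ZF_frame mem A r by unfold_locales blast
  show "is_spatial A r"
  proof (rule spatialI)
    fix a b assume ab: "a \<epsilon> A" "b \<epsilon> A" "\<not> rel r a b"
    then obtain \<kappa> where \<kappa>: "is_scott_open_filter A r \<kappa>" "a \<epsilon> \<kappa>" "\<not> b \<epsilon> \<kappa>"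
      using canonical_extension_separates e by blast
    then obtain p where "prime_elt p" "rel r b p" "\<not> p \<epsilon> \<kappa>"
      using prime_above assms ab by blast
    then show "\<exists>p. prime_elt p \<and> rel r b p \<and> \<not> rel r a p"
      using \<kappa> unfolding is_scott_open_filter_def by blast
  qed
qed

section \<open>Canonical extensions and frames of filters\<close>

text \<open>The lattice is ordered by reverse inclusion, and \<open>e\<close> sends \<open>a\<close>
  to the intersection of all Scott-open filters containing it. A Scott-open filter is then the meet
  of its own image, so compactness and density reduce to membership.\<close>

lemma (in ZF_frame) ex_injective_canonical_extension:
  assumes sep: "\<And>a b. a \<epsilon> A \<Longrightarrow> b \<epsilon> A \<Longrightarrow> \<not> a \<sqsubseteq> b \<Longrightarrow>
    \<exists>\<kappa>. is_scott_open_filter A r \<kappa> \<and> a \<epsilon> \<kappa> \<and> \<not> b \<epsilon> \<kappa>"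
  shows "\<exists>B q e. is_canonical_extension A r B q e \<and> is_inj e"
proof -
  let ?sof = "is_scott_open_filter A r"
  have sofA: "c \<epsilon> A" if "?sof \<kappa>" "c \<epsilon> \<kappa>" for c \<kappa>
  proof -
    have "elts \<kappa> \<subseteq> elts A" using that(1) unfolding is_scott_open_filter_def by (elim conjE)
    then show ?thesis using that(2) by auto
  qed
  have sof_up: "d \<epsilon> \<kappa>" if "?sof \<kappa>" "c \<epsilon> \<kappa>" "c \<sqsubseteq> d" for c d \<kappa>
  proof -
    have "\<forall>x y. x \<epsilon> \<kappa> \<and> x \<sqsubseteq> y \<longrightarrow> y \<epsilon> \<kappa>" using that(1) unfolding is_scott_open_filter_def by (elim conjE)
    then show ?thesis using that(2,3) by blast
  qed
  obtain PA where PA: "\<And>Z. Z \<epsilon> PA \<longleftrightarrow> elts Z \<subseteq> elts A" using Pow_set[of A] by blast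
  \<comment> \<open>A set is closed if it equals the intersection of the Scott-open filters that
    include it; this describes the intersections of such filters without mentioning
    families.\<close>
  define closed where "closed Z \<longleftrightarrow>
    (\<forall>a. a \<epsilon> A \<and> (\<forall>\<kappa>. ?sof \<kappa> \<and> elts Z \<subseteq> elts \<kappa> \<longrightarrow> a \<epsilon> \<kappa>) \<longrightarrow> a \<epsilon> Z)" for Z
  have "definable (\<lambda>\<rho>. closed (\<rho> 0))" unfolding closed_def by (intro definable)
  then obtain B where "elts B = {Z \<in> elts PA. closed Z}" by (rule separate)
  then have B: "Z \<epsilon> B \<longleftrightarrow> elts Z \<subseteq> elts A \<and> closed Z" for Z by (simp add: set_eq_iff PA)
  have BA: "c \<epsilon> A" if "Z \<epsilon> B" "c \<epsilon> Z" for c Z using that by (auto simp: B)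
  have closedD: "c \<epsilon> Z" if "Z \<epsilon> B" "c \<epsilon> A" "\<And>\<kappa>. ?sof \<kappa> \<Longrightarrow> elts Z \<subseteq> elts \<kappa> \<Longrightarrow> c \<epsilon> \<kappa>" for c Z
    using that unfolding B closed_def by blast
  have sofB: "\<kappa> \<epsilon> B" if "?sof \<kappa>" for \<kappa>
    using that sofA[OF that] unfolding B closed_def elts_subset_iff by blast
  have "definable (\<lambda>\<rho>. elts (\<rho> 0) \<subseteq> elts (\<rho> (Suc 0)))" by (intro definable)
  then obtain q where q: "\<And>u v. rel q u v \<longleftrightarrow> u \<epsilon> B \<and> v \<epsilon> B \<and> elts v \<subseteq> elts u"
    by (rule separate_rel[where a = B and b = B and P = "\<lambda>u v. elts v \<subseteq> elts u"]) blast
  define ext where "ext a u \<longleftrightarrow> (\<forall>c. c \<epsilon> u \<longleftrightarrow> c \<epsilon> A \<and> (\<forall>\<kappa>. ?sof \<kappa> \<and> a \<epsilon> \<kappa> \<longrightarrow> c \<epsilon> \<kappa>))" for a u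
  have "definable (\<lambda>\<rho>. ext (\<rho> (Suc 0)) (\<rho> 0))" unfolding ext_def by (intro definable)
  then obtain e where e: "\<And>a u. rel e a u \<longleftrightarrow> a \<epsilon> A \<and> u \<epsilon> B \<and> ext a u"
    and e_pairs: "\<And>p. p \<epsilon> e \<Longrightarrow> \<exists>x y. x \<epsilon> A \<and> y \<epsilon> B \<and> is_pair p x y"
    by (rule separate_rel[where a = A and b = B and P = ext]) blast
  have e_iff: "c \<epsilon> u \<longleftrightarrow> c \<epsilon> A \<and> (\<forall>\<kappa>. ?sof \<kappa> \<and> a \<epsilon> \<kappa> \<longrightarrow> c \<epsilon> \<kappa>)" if "rel e a u" for a u c
    using that unfolding e ext_def by blast
  have e_self: "a \<epsilon> u" if "rel e a u" for a u
    using that e_iff[OF that, of a] unfolding e by blast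
  have e_le: "elts d \<subseteq> elts v" if "rel e c d" "c \<epsilon> v" "v \<epsilon> B" for c d v
    unfolding elts_subset_iff
  proof (intro allI impI)
    fix x assume x: "x \<epsilon> d"
    show "x \<epsilon> v"
    proof (rule closedD[OF that(3)])
      show "x \<epsilon> A" using x e_iff[OF that(1)] by blast
      show "x \<epsilon> \<kappa>" if "?sof \<kappa>" "elts v \<subseteq> elts \<kappa>" for \<kappa>
        using that x e_iff[OF \<open>rel e c d\<close>] \<open>c \<epsilon> v\<close> by auto
    qed
  qed
  have e_total: "\<exists>u. rel e a u" if a: "a \<epsilon> A" for a
  proof -
    have "definable (\<lambda>\<rho>. \<forall>\<kappa>. ?sof \<kappa> \<and> a \<epsilon> \<kappa> \<longrightarrow> \<rho> 0 \<epsilon> \<kappa>)" by (intro definable)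
    then obtain u where "elts u = {c \<in> elts A. \<forall>\<kappa>. ?sof \<kappa> \<and> a \<epsilon> \<kappa> \<longrightarrow> c \<epsilon> \<kappa>}" by (rule separate)
    then have u: "c \<epsilon> u \<longleftrightarrow> c \<epsilon> A \<and> (\<forall>\<kappa>. ?sof \<kappa> \<and> a \<epsilon> \<kappa> \<longrightarrow> c \<epsilon> \<kappa>)" for c by (simp add: set_eq_iff)
    have "closed u"
      unfolding closed_def
    proof (intro allI impI)
      fix c assume c: "c \<epsilon> A \<and> (\<forall>\<kappa>. ?sof \<kappa> \<and> elts u \<subseteq> elts \<kappa> \<longrightarrow> c \<epsilon> \<kappa>)"
      have "elts u \<subseteq> elts \<kappa>" if "?sof \<kappa>" "a \<epsilon> \<kappa>" for \<kappa>
        using that u by (simp add: elts_subset_iff)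
      then show "c \<epsilon> u" using c unfolding u by blast
    qed
    then have "u \<epsilon> B" by (simp add: B u elts_subset_iff)
    then show ?thesis using a u unfolding e ext_def by blast
  qed
  have meet: "meet_of e B q \<kappa> \<kappa>" if \<kappa>: "?sof \<kappa>" for \<kappa>
    unfolding meet_of_def is_glb_def
  proof (intro conjI ballI allI impI)
    show \<kappa>B: "\<kappa> \<epsilon> B" using sofB \<kappa> .
    fix y assume "y \<in> {y. \<exists>x\<in>elts \<kappa>. rel e x y}"
    then obtain x where x: "x \<epsilon> \<kappa>" "rel e x y" by auto
    then show "rel q \<kappa> y" using e_le[OF x(2,1) \<kappa>B] \<kappa>B unfolding q e by blast
  next
    fix l assume l: "l \<epsilon> B \<and> (\<forall>x\<in>{y. \<exists>x\<in>elts \<kappa>. rel e x y}. rel q l x)"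
    have "x \<epsilon> l" if x: "x \<epsilon> \<kappa>" for x
    proof -
      obtain y where y: "rel e x y" using e_total sofA[OF \<kappa> x] by blast
      then have "y \<in> {y. \<exists>x\<in>elts \<kappa>. rel e x y}" using x by auto
      then have "rel q l y" using l by blast
      then have "elts y \<subseteq> elts l" unfolding q by blast
      then show ?thesis using e_self[OF y] by auto
    qed
    then show "rel q l \<kappa>" using l sofB[OF \<kappa>] unfolding q elts_subset_iff by blast
  qed
  have q_antisym: "u = v" if "rel q u v" "rel q v u" for u v
    using that by (intro extensionality subset_antisym) (auto simp: q)
  have "is_canonical_extension A r B q e"
    unfolding is_canonical_extension_def
  proof (intro conjI)
    show "is_complete_lattice B q"
      unfolding is_complete_lattice_def
    proof (intro conjI allI impI)
      show "is_poset B q"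
        unfolding is_poset_def partial_order_on_def preorder_on_def refl_on_def trans_def antisym_def
        using q q_antisym by auto
      fix S assume S: "elts S \<subseteq> elts B"
      have SB: "u \<epsilon> B" if "u \<epsilon> S" for u using S that by auto
      \<comment> \<open>Because the order is reversed, joins are intersections, while meets are
        closures of unions.\<close>
      have "definable (\<lambda>\<rho>. \<forall>u. u \<epsilon> S \<longrightarrow> \<rho> 0 \<epsilon> u)" by (intro definable)
      then obtain J where "elts J = {c \<in> elts A. \<forall>u. u \<epsilon> S \<longrightarrow> c \<epsilon> u}" by (rule separate)
      then have J: "c \<epsilon> J \<longleftrightarrow> c \<epsilon> A \<and> (\<forall>u. u \<epsilon> S \<longrightarrow> c \<epsilon> u)" for c by (simp add: set_eq_iff)
      have Ju: "elts J \<subseteq> elts u" if "u \<epsilon> S" for u using that by (simp add: elts_subset_iff J)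
      have "closed J"
        unfolding closed_def
      proof (intro allI impI)
        fix c assume c: "c \<epsilon> A \<and> (\<forall>\<kappa>. ?sof \<kappa> \<and> elts J \<subseteq> elts \<kappa> \<longrightarrow> c \<epsilon> \<kappa>)"
        have "c \<epsilon> u" if u: "u \<epsilon> S" for u
          by (rule closedD[OF SB[OF u]]) (use c subset_trans[OF Ju[OF u]] in blast)+
        then show "c \<epsilon> J" using c by (simp add: J)
      qed
      then have JB: "J \<epsilon> B" by (simp add: B J elts_subset_iff)
      have "is_lub B q (elts S) J"
        unfolding is_lub_def
      proof (intro conjI ballI allI impI JB)
        show "rel q u J" if "u \<in> elts S" for u using that Ju SB JB by (simp add: q)
        fix w assume w: "w \<epsilon> B \<and> (\<forall>u\<in>elts S. rel q u w)"
        then have "c \<epsilon> u" if "c \<epsilon> w" "u \<epsilon> S" for c u using that by (auto simp: q elts_subset_iff[of w])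
        then have "elts w \<subseteq> elts J" using w BA unfolding elts_subset_iff J by blast
        then show "rel q J w" using w JB by (simp add: q)
      qed
      then show "\<exists>j. is_lub B q (elts S) j" ..
      have "definable (\<lambda>\<rho>. \<forall>\<kappa>. ?sof \<kappa> \<and> (\<forall>u. u \<epsilon> S \<longrightarrow> elts u \<subseteq> elts \<kappa>) \<longrightarrow> \<rho> 0 \<epsilon> \<kappa>)"
        by (intro definable)
      then obtain M where
        "elts M = {c \<in> elts A. \<forall>\<kappa>. ?sof \<kappa> \<and> (\<forall>u. u \<epsilon> S \<longrightarrow> elts u \<subseteq> elts \<kappa>) \<longrightarrow> c \<epsilon> \<kappa>}"
        by (rule separate)
      then have M: "c \<epsilon> M \<longleftrightarrow> c \<epsilon> A \<and> (\<forall>\<kappa>. ?sof \<kappa> \<and> (\<forall>u. u \<epsilon> S \<longrightarrow> elts u \<subseteq> elts \<kappa>) \<longrightarrow> c \<epsilon> \<kappa>)" for c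
        by (simp add: set_eq_iff)
      have "closed M"
        unfolding closed_def
      proof (intro allI impI)
        fix c assume c: "c \<epsilon> A \<and> (\<forall>\<kappa>. ?sof \<kappa> \<and> elts M \<subseteq> elts \<kappa> \<longrightarrow> c \<epsilon> \<kappa>)"
        have "elts M \<subseteq> elts \<kappa>" if "?sof \<kappa>" "\<forall>u. u \<epsilon> S \<longrightarrow> elts u \<subseteq> elts \<kappa>" for \<kappa>
          using that M unfolding elts_subset_iff[of M] by blast
        then show "c \<epsilon> M" using c unfolding M by blast
      qed
      then have MB: "M \<epsilon> B" by (simp add: B M elts_subset_iff)
      have "is_glb B q (elts S) M"
        unfolding is_glb_def
      proof (intro conjI ballI allI impI MB)
        fix u assume "u \<in> elts S"
        then have u: "u \<epsilon> S" by simp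
        have "elts u \<subseteq> elts M" using u BA[OF SB[OF u]] unfolding elts_subset_iff M by blast
        then show "rel q M u" using SB[OF u] MB by (simp add: q)
      next
        fix l assume l: "l \<epsilon> B \<and> (\<forall>u\<in>elts S. rel q l u)"
        then have ul: "elts u \<subseteq> elts l" if "u \<epsilon> S" for u using that by (simp add: q)
        have "c \<epsilon> l" if c: "c \<epsilon> M" for c
        proof (rule closedD)
          fix \<kappa> assume \<kappa>: "?sof \<kappa>" "elts l \<subseteq> elts \<kappa>"
          then have "\<forall>u. u \<epsilon> S \<longrightarrow> elts u \<subseteq> elts \<kappa>" using ul by blast
          then show "c \<epsilon> \<kappa>" using c \<kappa>(1) unfolding M by blast
        qed (use l c M in blast)+
        then show "rel q l M" using l MB by (simp add: q elts_subset_iff)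
      qed
      then show "\<exists>m. is_glb B q (elts S) m" ..
    qed
    show "is_fun e A B"
      unfolding is_fun_def
    proof (intro conjI allI impI)
      fix a assume "a \<epsilon> A"
      moreover have "u = v" if "rel e a u" "rel e a v" for u v
        by (rule set_ext) (simp add: e_iff[OF that(1)] e_iff[OF that(2)])
      ultimately show "\<exists>!u. rel e a u" using e_total by blast
    qed (rule e_pairs)
    show "\<forall>x x' y y'. x \<sqsubseteq> x' \<and> rel e x y \<and> rel e x' y' \<longrightarrow> rel q y y'"
    proof (intro allI impI)
      fix x x' y y' assume *: "x \<sqsubseteq> x' \<and> rel e x y \<and> rel e x' y'"
      then have y: "rel e x y" "rel e x' y'" by blast+
      have "x' \<epsilon> y" unfolding e_iff[OF y(1)] using * sof_up le_carrier by blast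
      moreover have "y \<epsilon> B" "y' \<epsilon> B" using y by (simp_all add: e)
      ultimately show "rel q y y'" using e_le[OF y(2)] by (simp add: q)
    qed
    show "\<forall>u v. u \<epsilon> B \<and> v \<epsilon> B \<and>
        (\<forall>\<kappa> k a b. is_scott_open_filter A r \<kappa> \<and> meet_of e B q \<kappa> k \<and> rel e a b \<longrightarrow>
           rel q k u \<and> rel q v b \<longrightarrow> rel q k b) \<longrightarrow> rel q u v"
    proof (intro allI impI, elim conjE)
      fix u v assume uv: "u \<epsilon> B" "v \<epsilon> B" and
        H: "\<forall>\<kappa> k a b. is_scott_open_filter A r \<kappa> \<and> meet_of e B q \<kappa> k \<and> rel e a b \<longrightarrow>
           rel q k u \<and> rel q v b \<longrightarrow> rel q k b"
      \<comment> \<open>Density is tested with the Scott-open filters \<open>\<kappa>\<close> that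
        include \<open>u\<close> and with the image \<open>d\<close> of \<open>c\<close>. The
        conclusion that \<open>d\<close> is included in \<open>\<kappa>\<close> places
        \<open>c\<close> in \<open>\<kappa>\<close>, and \<open>u\<close> is the intersection of all
        these filters.\<close>
      have "c \<epsilon> u" if c: "c \<epsilon> v" for c
      proof (rule closedD[OF uv(1)])
        show cA: "c \<epsilon> A" using BA uv(2) c by blast
        fix \<kappa> assume \<kappa>: "?sof \<kappa>" "elts u \<subseteq> elts \<kappa>"
        obtain d where d: "rel e c d" using e_total[OF cA] by blast
        have "rel q \<kappa> u" using sofB[OF \<kappa>(1)] uv(1) \<kappa>(2) by (simp add: q)
        moreover have "d \<epsilon> B" using d by (simp add: e)
        then have "rel q v d" using e_le[OF d c uv(2)] uv(2) by (simp add: q)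
        ultimately have "rel q \<kappa> d" using H meet[OF \<kappa>(1)] \<kappa>(1) d by blast
        then show "c \<epsilon> \<kappa>" using e_self[OF d] by (auto simp: q)
      qed
      then show "rel q u v" using uv by (simp add: q elts_subset_iff)
    qed
    show "\<forall>\<kappa> k a b. is_scott_open_filter A r \<kappa> \<and> meet_of e B q \<kappa> k \<and> rel e a b \<and> rel q k b \<longrightarrow> a \<epsilon> \<kappa>"
    proof (intro allI impI, elim conjE)
      fix \<kappa> k a b
      assume \<kappa>: "?sof \<kappa>" and k: "meet_of e B q \<kappa> k" and b: "rel e a b" "rel q k b"
      have "k = \<kappa>"
        using q_antisym k meet[OF \<kappa>] unfolding meet_of_def is_glb_def by blast
      then show "a \<epsilon> \<kappa>" using b(2) e_self[OF b(1)] by (auto simp: q)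
    qed
  qed
  moreover have "is_inj e"
    unfolding is_inj_def
  proof (intro allI impI, elim conjE)
    have "a \<sqsubseteq> b" if ab: "rel e a u" "rel e b u" for a b u
    proof (rule ccontr)
      assume "\<not> a \<sqsubseteq> b"
      then obtain \<kappa> where "?sof \<kappa>" "a \<epsilon> \<kappa>" "\<not> b \<epsilon> \<kappa>" using sep ab unfolding e by blast
      then show False using e_self[OF ab(2)] e_iff[OF ab(1)] by blast
    qed
    then show "a = b" if "rel e a u" "rel e b u" for a b u using that le_antisym by blast
  qed
  ultimately show ?thesis by blast
qed

section \<open>The frame of filters above a given filter\<close>

context ZF_model
begin

text \<open>Meets are intersections, whereas joins are awkward to describe. Distributivity is
  therefore proved by residuation: the implication is itself a filter above \<open>F\<close>, it
  bounds all members of \<open>S\<close>, and hence it bounds their join.\<close>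

lemma filter_frame:
  assumes F: "set_filter X F"
  obtains A r where "\<And>H. H \<epsilon> A \<longleftrightarrow> set_filter X H \<and> elts F \<subseteq> elts H"
    and "\<And>H K. rel r H K \<longleftrightarrow> H \<epsilon> A \<and> K \<epsilon> A \<and> elts H \<subseteq> elts K"
    and "is_frame A r"
    and "\<And>H K. H \<epsilon> A \<Longrightarrow> K \<epsilon> A \<Longrightarrow> \<not> rel r H K \<Longrightarrow>
      \<exists>\<kappa>. is_scott_open_filter A r \<kappa> \<and> H \<epsilon> \<kappa> \<and> \<not> K \<epsilon> \<kappa>"
proof -
  obtain P where P: "\<And>U. U \<epsilon> P \<longleftrightarrow> elts U \<subseteq> elts X" using Pow_set[of X] by blast
  obtain PP where PP: "\<And>H. H \<epsilon> PP \<longleftrightarrow> elts H \<subseteq> elts P" using Pow_set[of P] by blast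
  have "definable (\<lambda>\<rho>. set_filter X (\<rho> 0) \<and> elts F \<subseteq> elts (\<rho> 0))"
    unfolding set_filter_def by (intro definable)
  then obtain A where "elts A = {H \<in> elts PP. set_filter X H \<and> elts F \<subseteq> elts H}" by (rule separate)
  moreover have "H \<epsilon> PP" if "set_filter X H" for H
    using set_filterD(1)[OF that] by (simp add: PP P elts_subset_iff[of H])
  ultimately have A: "H \<epsilon> A \<longleftrightarrow> set_filter X H \<and> elts F \<subseteq> elts H" for H
    by (auto simp: set_eq_iff)
  have filt: "set_filter X H" and F_le: "U \<epsilon> F \<Longrightarrow> U \<epsilon> H" if "H \<epsilon> A" for H U
    using that by (auto simp: A)
  note A_D = set_filterD[OF filt]
  have "definable (\<lambda>\<rho>. elts (\<rho> (Suc 0)) \<subseteq> elts (\<rho> 0))" by (intro definable)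
  then obtain r where r: "\<And>H K. rel r H K \<longleftrightarrow> H \<epsilon> A \<and> K \<epsilon> A \<and> elts H \<subseteq> elts K"
    by (rule separate_rel[where a = A and b = A and P = "\<lambda>H K. elts H \<subseteq> elts K"]) blast
  have r_mem: "rel r H K \<longleftrightarrow> H \<epsilon> A \<and> K \<epsilon> A \<and> (\<forall>U. U \<epsilon> H \<longrightarrow> U \<epsilon> K)" for H K
    by (simp add: r elts_subset_iff)
  \<comment> \<open>The improper filter is a member; it will serve as the top of the frame.\<close>
  have PA: "P \<epsilon> A"
    unfolding A
  proof (intro conjI set_filterI)
    show "elts F \<subseteq> elts P" using set_filterD(1)[OF F] by (simp add: elts_subset_iff[of F] P)
  qed (auto simp: P)
  have ex_meet: "\<exists>M. M \<epsilon> A \<and> (\<forall>U. U \<epsilon> M \<longleftrightarrow> elts U \<subseteq> elts X \<and> (\<forall>H. H \<epsilon> S \<longrightarrow> U \<epsilon> H))"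
    if S: "elts S \<subseteq> elts A" for S
  proof -
    have "definable (\<lambda>\<rho>. \<forall>H. H \<epsilon> S \<longrightarrow> \<rho> 0 \<epsilon> H)" by (intro definable)
    then obtain M where "elts M = {U \<in> elts P. \<forall>H. H \<epsilon> S \<longrightarrow> U \<epsilon> H}" by (rule separate)
    then have M: "U \<epsilon> M \<longleftrightarrow> elts U \<subseteq> elts X \<and> (\<forall>H. H \<epsilon> S \<longrightarrow> U \<epsilon> H)" for U
      by (simp add: set_eq_iff P)
    have SA: "H \<epsilon> A" if "H \<epsilon> S" for H using that S by auto
    have "set_filter X M"
    proof (rule set_filterI)
      show "X \<epsilon> M" using SA A_D(2) by (simp add: M)
      show "V \<epsilon> M" if "U \<epsilon> M" "elts U \<subseteq> elts V" "elts V \<subseteq> elts X" for U V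
        using that SA A_D(3)[of _ U V] unfolding M by blast
      show "W \<epsilon> M" if UV: "U \<epsilon> M" "V \<epsilon> M" and W: "elts W = elts U \<inter> elts V" for U V W
        unfolding M
      proof (intro conjI allI impI)
        show "elts W \<subseteq> elts X" using UV W unfolding M by blast
        show "W \<epsilon> H" if "H \<epsilon> S" for H
          using A_D(4)[OF SA[OF that] _ _ W] UV that unfolding M by blast
      qed
    qed (simp add: M)
    moreover have "elts F \<subseteq> elts M"
      using set_filterD(1)[OF F] F_le SA unfolding elts_subset_iff[of F] M by blast
    ultimately have "M \<epsilon> A" by (simp add: A)
    then show ?thesis using M by blast
  qed
  have r_refl: "H \<epsilon> A \<Longrightarrow> rel r H H" for H by (simp add: r)
  have r_trans: "rel r H K \<Longrightarrow> rel r K L \<Longrightarrow> rel r H L" for H K L unfolding r_mem by blast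
  have r_antisym: "H = K" if "rel r H K" "rel r K H" for H K
    using that by (intro extensionality subset_antisym) (simp_all add: r)
  have is_glb_meet: "is_glb A r (elts S) M"
    if S: "elts S \<subseteq> elts A" and M: "M \<epsilon> A" "\<forall>U. U \<epsilon> M \<longleftrightarrow> elts U \<subseteq> elts X \<and> (\<forall>H. H \<epsilon> S \<longrightarrow> U \<epsilon> H)" for S M
    unfolding is_glb_def
  proof (intro conjI ballI allI impI M(1))
    show "rel r M H" if "H \<in> elts S" for H
    proof -
      have "H \<epsilon> S" "H \<epsilon> A" using that S by auto
      then show ?thesis using M unfolding r_mem by blast
    qed
    fix L assume L: "L \<epsilon> A \<and> (\<forall>H\<in>elts S. rel r L H)"
    show "rel r L M"
      unfolding r_mem
    proof (intro conjI allI impI M(1))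
      show "L \<epsilon> A" using L ..
      show "U \<epsilon> M" if "U \<epsilon> L" for U
      proof -
        have LA: "L \<epsilon> A" using L ..
        have "U \<epsilon> H" if "H \<epsilon> S" for H using L that \<open>U \<epsilon> L\<close> by (simp add: r_mem)
        then show ?thesis using A_D(1)[OF LA that] M(2) by blast
      qed
    qed
  qed
  have glb: "\<exists>m. is_glb A r (elts S) m" if S: "elts S \<subseteq> elts A" for S
    using ex_meet[OF S] is_glb_meet[OF S] by blast
  have glb2: "U \<epsilon> m \<longleftrightarrow> U \<epsilon> H \<and> U \<epsilon> K" if HK: "H \<epsilon> A" "K \<epsilon> A" and m: "is_glb A r {H, K} m" for H K m U
  proof -
    obtain S where S: "elts S = {H, K}" by (rule pair_set)
    then have SA: "elts S \<subseteq> elts A" using HK by simp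
    have S_iff: "L \<epsilon> S \<longleftrightarrow> L = H \<or> L = K" for L using S by (auto simp: set_eq_iff)
    obtain M where M: "M \<epsilon> A" "\<forall>U. U \<epsilon> M \<longleftrightarrow> elts U \<subseteq> elts X \<and> (\<forall>H. H \<epsilon> S \<longrightarrow> U \<epsilon> H)"
      using ex_meet[OF SA] by blast
    have "is_glb A r {H, K} M" using is_glb_meet[OF SA M] S by simp
    then have "m = M" using m r_antisym unfolding is_glb_def by blast
    moreover have "U \<epsilon> M \<longleftrightarrow> elts U \<subseteq> elts X \<and> U \<epsilon> H \<and> U \<epsilon> K" using M(2) by (auto simp only: S_iff)
    ultimately show ?thesis using A_D(1)[OF HK(1), of U] by blast
  qed
  have lub: "\<exists>j. is_lub A r (elts S) j" if S: "elts S \<subseteq> elts A" for S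
  proof -
    have "definable (\<lambda>\<rho>. \<forall>H. H \<epsilon> S \<longrightarrow> rel r H (\<rho> 0))" by (intro definable)
    then obtain Ub where "elts Ub = {K \<in> elts A. \<forall>H. H \<epsilon> S \<longrightarrow> rel r H K}" by (rule separate)
    then have Ub: "K \<epsilon> Ub \<longleftrightarrow> K \<epsilon> A \<and> (\<forall>H. H \<epsilon> S \<longrightarrow> rel r H K)" for K by (simp add: set_eq_iff)
    then obtain j where "is_glb A r (elts Ub) j" using glb[of Ub] unfolding elts_subset_iff[of Ub] by blast
    then have j: "j \<epsilon> A" "\<And>K. K \<epsilon> Ub \<Longrightarrow> rel r j K"
      "\<And>l. l \<epsilon> A \<Longrightarrow> (\<And>K. K \<epsilon> Ub \<Longrightarrow> rel r l K) \<Longrightarrow> rel r l j"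
      by (simp_all add: is_glb_def)
    have "is_lub A r (elts S) j"
      unfolding is_lub_def Ball_def mem_elts
    proof (intro conjI allI impI j(1))
      fix H assume H: "H \<epsilon> S"
      then have "H \<epsilon> A" using S by auto
      then show "rel r H j" by (rule j(3)) (use H in \<open>simp add: Ub\<close>)
    next
      fix K assume "K \<epsilon> A \<and> (\<forall>H. H \<epsilon> S \<longrightarrow> rel r H K)"
      then show "rel r j K" by (intro j(2)) (simp add: Ub)
    qed
    then show ?thesis ..
  qed
  have complete: "is_complete_lattice A r"
    unfolding is_complete_lattice_def is_poset_def partial_order_on_def preorder_on_def
      refl_on_def trans_def antisym_def
  proof (intro conjI)
    show "{(x, y). rel r x y} \<subseteq> elts A \<times> elts A" by (auto simp: r)
    show "\<forall>x\<in>elts A. (x, x) \<in> {(x, y). rel r x y}" using r_refl by simp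
    show "\<forall>x y z. (x, y) \<in> {(x, y). rel r x y} \<longrightarrow> (y, z) \<in> {(x, y). rel r x y} \<longrightarrow> (x, z) \<in> {(x, y). rel r x y}"
      using r_trans by blast
    show "\<forall>x y. (x, y) \<in> {(x, y). rel r x y} \<longrightarrow> (y, x) \<in> {(x, y). rel r x y} \<longrightarrow> x = y"
      using r_antisym by blast
    show "\<forall>S. elts S \<subseteq> elts A \<longrightarrow> (\<exists>j. is_lub A r (elts S) j) \<and> (\<exists>m. is_glb A r (elts S) m)"
      using lub glb by blast
  qed
  have frame: "is_frame A r"
    unfolding is_frame_def
  proof (intro conjI complete allI impI, elim conjE)
    fix H S s m
    assume H: "H \<epsilon> A" and S: "elts S \<subseteq> elts A" and s: "is_lub A r (elts S) s"
      and m: "is_glb A r {H, s} m"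
    have SA: "K \<epsilon> A" if "K \<epsilon> S" for K using S that by auto
    have Ks: "rel r K s" if "K \<epsilon> S" for K using s that by (simp add: is_lub_def)
    have sA: "s \<epsilon> A" and mA: "m \<epsilon> A" using s m by (simp_all add: is_lub_def is_glb_def)
    show "is_lub A r {t. \<exists>x\<in>elts S. is_glb A r {H, x} t} m"
      unfolding is_lub_def
    proof (intro conjI ballI allI impI mA)
      fix t assume "t \<in> {t. \<exists>x\<in>elts S. is_glb A r {H, x} t}"
      then obtain K where K: "K \<epsilon> S" "is_glb A r {H, K} t" by auto
      then have "t \<epsilon> A" by (simp add: is_glb_def)
      then show "rel r t m"
        using glb2[OF H SA[OF K(1)] K(2)] glb2[OF H sA m] Ks[OF K(1)] mA unfolding r_mem by blast
    next
      fix u assume u: "u \<epsilon> A \<and> (\<forall>x\<in>{t. \<exists>x\<in>elts S. is_glb A r {H, x} t}. rel r x u)"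
      then have uA: "u \<epsilon> A" by blast
      have tu: "rel r t u" if "K \<epsilon> S" "is_glb A r {H, K} t" for K t
      proof -
        have "t \<in> {t. \<exists>x\<in>elts S. is_glb A r {H, x} t}" using that by auto
        then show ?thesis using u by blast
      qed
      \<comment> \<open>the Heyting implication of \<open>H\<close> and \<open>u\<close>\<close>
      have "definable (\<lambda>\<rho>. \<forall>V W. V \<epsilon> H \<and> elts W \<subseteq> elts X \<and> elts (\<rho> 0) \<subseteq> elts W \<and> elts V \<subseteq> elts W \<longrightarrow> W \<epsilon> u)"
        by (intro definable)
      then obtain I where "elts I = {U \<in> elts P. \<forall>V W. V \<epsilon> H \<and> elts W \<subseteq> elts X \<and> elts U \<subseteq> elts W \<and> elts V \<subseteq> elts W \<longrightarrow> W \<epsilon> u}"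
        by (rule separate)
      then have I: "U \<epsilon> I \<longleftrightarrow> elts U \<subseteq> elts X \<and>
          (\<forall>V W. V \<epsilon> H \<and> elts W \<subseteq> elts X \<and> elts U \<subseteq> elts W \<and> elts V \<subseteq> elts W \<longrightarrow> W \<epsilon> u)" for U
        by (simp add: set_eq_iff P)
      then have I_D: "U \<epsilon> I \<Longrightarrow> V \<epsilon> H \<Longrightarrow> elts W \<subseteq> elts X \<Longrightarrow> elts U \<subseteq> elts W \<Longrightarrow> elts V \<subseteq> elts W \<Longrightarrow> W \<epsilon> u" for U V W
        by blast
      have "set_filter X I"
      proof (rule set_filterI)
        have "W \<epsilon> u" if "elts W \<subseteq> elts X" "elts X \<subseteq> elts W" for W
          using A_D(2)[OF uA] extensionality[OF subset_antisym[OF that]] by simp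
        then show "X \<epsilon> I" unfolding I by blast
        show "V \<epsilon> I" if "U \<epsilon> I" "elts U \<subseteq> elts V" "elts V \<subseteq> elts X" for U V
          using that(1,3) subset_trans[OF that(2)] unfolding I by blast
        show "Y \<epsilon> I" if UV: "U \<epsilon> I" "U' \<epsilon> I" and Y: "elts Y = elts U \<inter> elts U'" for U U' Y
          unfolding I
        proof (intro conjI allI impI, goal_cases)
          case 1
          then show ?case using UV Y unfolding I by blast
        next
          case (2 V W)
          \<comment> \<open>A set \<open>W\<close> including the intersection of \<open>U\<close>
            and \<open>U'\<close> is the intersection of its unions with \<open>U\<close> and with
            \<open>U'\<close>, and each of these is in \<open>u\<close> by the condition on
            \<open>U\<close> or on \<open>U'\<close>.\<close>
          obtain W1 where W1: "elts W1 = elts U \<union> elts W" by (rule Un_set)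
          obtain W2 where W2: "elts W2 = elts U' \<union> elts W" by (rule Un_set)
          have UX: "elts U \<subseteq> elts X" "elts U' \<subseteq> elts X" using UV unfolding I by blast+
          have V: "V \<epsilon> H" and W: "elts W \<subseteq> elts X" "elts Y \<subseteq> elts W" "elts V \<subseteq> elts W" using 2 by blast+
          have "W1 \<epsilon> u"
            by (rule I_D[OF UV(1) V]) (use UX W W1 in blast)+
          moreover have "W2 \<epsilon> u"
            by (rule I_D[OF UV(2) V]) (use UX W W2 in blast)+
          moreover have "elts W = elts W1 \<inter> elts W2" using W(2) W1 W2 Y by blast
          ultimately show ?case using A_D(4)[OF uA] by blast
        qed
      qed (simp add: I)
      moreover have "elts F \<subseteq> elts I"
        unfolding elts_subset_iff[of F] I
      proof (intro allI impI conjI, goal_cases)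
        case (1 U)
        then show ?case using set_filterD(1)[OF F] by blast
      next
        case (2 U V W)
        then show ?case using F_le[OF uA] A_D(3)[OF uA] by blast
      qed
      ultimately have IA: "I \<epsilon> A" by (simp add: A)
      have "rel r K I" if K: "K \<epsilon> S" for K
        unfolding r_mem I
      proof (intro conjI allI impI IA SA K, goal_cases)
        case (1 U)
        then show ?case using A_D(1)[OF SA[OF K]] by blast
      next
        case (2 U V W)
        obtain T where T: "elts T = {H, K}" by (rule pair_set)
        then obtain t where t: "is_glb A r {H, K} t" using glb[of T] H SA[OF K] by auto
        have "W \<epsilon> H" using A_D(3)[OF H] 2 by blast
        moreover have "W \<epsilon> K" using A_D(3)[OF SA[OF K]] 2 by blast
        ultimately have "W \<epsilon> t" using glb2[OF H SA[OF K] t] by blast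
        then show ?case using tu[OF K t] by (simp add: r_mem)
      qed
      then have "rel r s I" using s IA by (simp add: is_lub_def)
      have "U \<epsilon> u" if "U \<epsilon> m" for U
      proof -
        have "U \<epsilon> H" "U \<epsilon> I" using glb2[OF H sA m] that \<open>rel r s I\<close> unfolding r_mem by blast+
        then show ?thesis unfolding I by blast
      qed
      then show "rel r m u" using mA uA by (simp add: r_mem)
    qed
  qed
  have "\<exists>\<kappa>. is_scott_open_filter A r \<kappa> \<and> H \<epsilon> \<kappa> \<and> \<not> K \<epsilon> \<kappa>"
    if HK: "H \<epsilon> A" "K \<epsilon> A" "\<not> rel r H K" for H K
  proof -
    obtain U where U: "U \<epsilon> H" "\<not> U \<epsilon> K" using HK unfolding r_mem by blast
    have UX: "elts U \<subseteq> elts X" using A_D(1)[OF HK(1) U(1)] .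
    have "definable (\<lambda>\<rho>. U \<epsilon> \<rho> 0)" by (intro definable)
    then obtain \<kappa> where "elts \<kappa> = {H \<in> elts A. U \<epsilon> H}" by (rule separate)
    then have \<kappa>: "H \<epsilon> \<kappa> \<longleftrightarrow> H \<epsilon> A \<and> U \<epsilon> H" for H by (simp add: set_eq_iff)
    have "is_scott_open_filter A r \<kappa>"
      unfolding is_scott_open_filter_def
    proof (intro conjI allI impI)
      show "elts \<kappa> \<subseteq> elts A" by (simp add: elts_subset_iff \<kappa>)
      show "y \<epsilon> \<kappa>" if "x \<epsilon> \<kappa> \<and> rel r x y" for x y using that unfolding \<kappa> r_mem by blast
      show "t \<epsilon> \<kappa>" if "is_glb A r {} t" for t
      proof -
        have "rel r P t" "t \<epsilon> A" using that PA by (simp_all add: is_glb_def)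
        moreover have "U \<epsilon> P" using UX by (simp add: P)
        ultimately show ?thesis unfolding \<kappa> r_mem by blast
      qed
      show "m \<epsilon> \<kappa>" if "x \<epsilon> \<kappa> \<and> y \<epsilon> \<kappa> \<and> is_glb A r {x, y} m" for x y m
      proof -
        have "m \<epsilon> A" using that by (simp add: is_glb_def)
        then show ?thesis using that glb2[of x y m U] unfolding \<kappa> by blast
      qed
      fix D s assume D: "elts D \<subseteq> elts A \<and> is_directed r D \<and> is_lub A r (elts D) s \<and> s \<epsilon> \<kappa>"
      have DA: "d \<epsilon> A" if "d \<epsilon> D" for d using that D by auto
      have dir: "\<exists>z. z \<epsilon> D \<and> rel r x z \<and> rel r y z" if "x \<epsilon> D" "y \<epsilon> D" for x y
      proof -
        have "\<forall>x\<in>elts D. \<forall>y\<in>elts D. \<exists>z\<in>elts D. rel r x z \<and> rel r y z"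
          using D unfolding is_directed_def by (elim conjE)
        then have "\<exists>z\<in>elts D. rel r x z \<and> rel r y z" using that by simp
        then show ?thesis by auto
      qed
      obtain d where d: "d \<epsilon> D" using D unfolding is_directed_def by (metis ex_in_conv mem_elts)
      \<comment> \<open>A directed union of filters is a filter, so the union \<open>J\<close> of
        \<open>D\<close> bounds the join \<open>s\<close>. As \<open>U\<close> is in
        \<open>s\<close>, it is in \<open>J\<close>, that is, in some member of
        \<open>D\<close>.\<close>
      have "definable (\<lambda>\<rho>. \<exists>H. H \<epsilon> D \<and> \<rho> 0 \<epsilon> H)" by (intro definable)
      then obtain J where "elts J = {V \<in> elts P. \<exists>H. H \<epsilon> D \<and> V \<epsilon> H}" by (rule separate)
      then have J: "V \<epsilon> J \<longleftrightarrow> elts V \<subseteq> elts X \<and> (\<exists>H. H \<epsilon> D \<and> V \<epsilon> H)" for V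
        by (simp add: set_eq_iff P)
      have "set_filter X J"
      proof (rule set_filterI)
        show "X \<epsilon> J" using d A_D(2)[OF DA[OF d]] unfolding J by blast
        show "W \<epsilon> J" if "V \<epsilon> J" "elts V \<subseteq> elts W" "elts W \<subseteq> elts X" for V W
          using that DA A_D(3)[of _ V W] unfolding J by blast
        show "W \<epsilon> J" if V: "V \<epsilon> J" "V' \<epsilon> J" and W: "elts W = elts V \<inter> elts V'" for V V' W
        proof -
          obtain h h' where h: "h \<epsilon> D" "V \<epsilon> h" "h' \<epsilon> D" "V' \<epsilon> h'" using V unfolding J by blast
          obtain z where z: "z \<epsilon> D" "rel r h z" "rel r h' z" using dir[OF h(1,3)] by blast
          have "V \<epsilon> z" "V' \<epsilon> z" using z h unfolding r_mem by blast+
          then have "W \<epsilon> z" using A_D(4)[OF DA[OF z(1)] _ _ W] by blast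
          moreover have "elts W \<subseteq> elts X" using V W unfolding J by blast
          ultimately show ?thesis using z(1) unfolding J by blast
        qed
      qed (simp add: J)
      moreover have "elts F \<subseteq> elts J"
        using d F_le[OF DA[OF d]] set_filterD(1)[OF F] unfolding elts_subset_iff[of F] J by blast
      ultimately have JA: "J \<epsilon> A" by (simp add: A)
      have "rel r h J" if "h \<epsilon> D" for h
        using that DA[OF that] JA A_D(1)[OF DA[OF that]] unfolding r_mem J by blast
      then have "rel r s J" using D JA by (simp add: is_lub_def)
      moreover have "U \<epsilon> s" using D by (simp add: \<kappa>)
      ultimately have "U \<epsilon> J" unfolding r_mem by blast
      then show "\<exists>d\<in>elts D. d \<epsilon> \<kappa>" using DA unfolding J \<kappa> by auto
    qed
    then show ?thesis using U HK by (auto simp: \<kappa>)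
  qed
  with A r frame show thesis using that by blast
qed

section \<open>Ultrafilters from points of the frame of filters\<close>

lemma spatial_imp_ultrafilter_principle:
  assumes sp: injective_frames_spatial
  shows ultrafilter_principle
  unfolding ultrafilter_principle_def
proof (intro allI impI)
  fix X F assume "proper_set_filter X F"
  then have F: "set_filter X F" and proper: "\<And>U. U \<epsilon> F \<Longrightarrow> elts U \<noteq> {}"
    by (simp_all add: proper_set_filter_def)
  obtain A r where A: "\<And>H. H \<epsilon> A \<longleftrightarrow> set_filter X H \<and> elts F \<subseteq> elts H"
    and r: "\<And>H K. rel r H K \<longleftrightarrow> H \<epsilon> A \<and> K \<epsilon> A \<and> elts H \<subseteq> elts K"
    and frame: "is_frame A r"
    and sep: "\<And>H K. H \<epsilon> A \<Longrightarrow> K \<epsilon> A \<Longrightarrow> \<not> rel r H K \<Longrightarrow>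
      \<exists>\<kappa>. is_scott_open_filter A r \<kappa> \<and> H \<epsilon> \<kappa> \<and> \<not> K \<epsilon> \<kappa>"
    using filter_frame[OF F] by blast
  interpret ZF_frame mem A r by unfold_locales (rule frame)
  obtain B q e where e: "is_canonical_extension A r B q e" "is_inj e"
    using ex_injective_canonical_extension sep by blast
  then have "is_spatial A r" using sp frame unfolding injective_frames_spatial_def by blast
  then obtain Y T f where top: "is_topology Y T" and f: "is_fun f A T" "is_inj f"
    and onto: "\<And>U. U \<epsilon> T \<Longrightarrow> \<exists>x. rel f x U"
    and order: "\<And>x y U V. rel f x U \<Longrightarrow> rel f y V \<Longrightarrow> rel r x y \<longleftrightarrow> elts U \<subseteq> elts V"
    unfolding is_spatial_def by blast
  have T_Int: "\<And>U V W. U \<epsilon> T \<Longrightarrow> V \<epsilon> T \<Longrightarrow> elts W = elts U \<inter> elts V \<Longrightarrow> W \<epsilon> T"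
    and T_Un: "\<And>S W. elts S \<subseteq> elts T \<Longrightarrow> elts W = (\<Union>U\<in>elts S. elts U) \<Longrightarrow> W \<epsilon> T"
    using top unfolding is_topology_def by blast+
  have total: "\<exists>U. rel f H U" if "H \<epsilon> A" for H
    using f(1) that unfolding is_fun_def by blast
  have ranf: "U \<epsilon> T" and domf: "H \<epsilon> A" if fU: "rel f H U" for H U
  proof -
    obtain p where p: "is_pair p H U" "p \<epsilon> f" using fU unfolding rel_def by blast
    then obtain x y where "x \<epsilon> A" "y \<epsilon> T" "is_pair p x y" using f(1) unfolding is_fun_def by blast
    then show "U \<epsilon> T" "H \<epsilon> A" using is_pair_inject[OF p(1)] by blast+
  qed

  have FA: "F \<epsilon> A" using F by (simp add: A)
  have F_least: "rel r F H" if "H \<epsilon> A" for H using that FA by (simp add: r A)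
  \<comment> \<open>The empty set is open, so the open set of the least element \<open>F\<close> is
    empty. The improper filter \<open>P\<close> differs from the proper filter \<open>F\<close>, so
    by injectivity its open set is inhabited, and this yields a point \<open>x\<close>.\<close>
  obtain E where E: "elts E = {}" by (rule empty_set)
  have "E \<epsilon> T" using T_Un[of E E] E by simp
  then obtain w where "rel f w E" using onto by blast
  moreover obtain UF where UF: "rel f F UF" using total[OF FA] by blast
  ultimately have UF_empty: "elts UF = {}"
    using order[OF UF, of w E] F_least[of w] domf E by blast
  obtain P where P: "\<And>U. U \<epsilon> P \<longleftrightarrow> elts U \<subseteq> elts X" using Pow_set[of X] by blast
  have PA: "P \<epsilon> A"
    unfolding A
  proof (intro conjI set_filterI)
    show "elts F \<subseteq> elts P" using set_filterD(1)[OF F] by (simp add: elts_subset_iff[of F] P)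
  qed (auto simp: P)
  obtain UP where UP: "rel f P UP" using total[OF PA] by blast
  have "E \<epsilon> P" "\<not> E \<epsilon> F" using proper E by (auto simp: P)
  then have "P \<noteq> F" by blast
  moreover have "P = F" if "elts UP = {}"
    using extensionality[of UP UF] that UF_empty f(2) UP UF unfolding is_inj_def by blast
  ultimately obtain x where x: "x \<epsilon> UP" by (metis ex_in_conv mem_elts)

  \<comment> \<open>the largest filter whose open set omits the point \<open>x\<close>\<close>
  have "definable (\<lambda>\<rho>. \<exists>U. rel f (\<rho> 0) U \<and> \<not> x \<epsilon> U)" by (intro definable)
  then obtain S where "elts S = {H \<in> elts A. \<exists>U. rel f H U \<and> \<not> x \<epsilon> U}" by (rule separate)
  then have S: "H \<epsilon> S \<longleftrightarrow> (\<exists>U. rel f H U \<and> \<not> x \<epsilon> U)" for H using domf by (auto simp: set_eq_iff)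
  have SA: "elts S \<subseteq> elts A" using domf by (auto simp: S)
  obtain j where j: "is_lub A r (elts S) j" using ex_lub[OF SA] by blast
  then have jA: "j \<epsilon> A" and S_le: "\<And>H. H \<epsilon> S \<Longrightarrow> rel r H j" by (simp_all add: is_lub_def)
  have "j \<epsilon> S"
  proof -
    \<comment> \<open>The union \<open>W\<close> of the open sets that omit \<open>x\<close> omits
      \<open>x\<close> as well, and it is the open set of some \<open>w\<close>. Since
      \<open>w\<close> bounds \<open>S\<close>, the join \<open>j\<close> lies below
      \<open>w\<close>, so the open set of \<open>j\<close> omits \<open>x\<close>.\<close>
    have "definable (\<lambda>\<rho>. \<exists>H. H \<epsilon> S \<and> rel f H (\<rho> 0) \<and> \<not> x \<epsilon> \<rho> 0)" by (intro definable)
    then obtain R where "elts R = {V \<in> elts T. \<exists>H. H \<epsilon> S \<and> rel f H V \<and> \<not> x \<epsilon> V}" by (rule separate)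
    then have R: "V \<epsilon> R \<longleftrightarrow> V \<epsilon> T \<and> (\<exists>H. H \<epsilon> S \<and> rel f H V \<and> \<not> x \<epsilon> V)" for V
      by (simp add: set_eq_iff)
    obtain W where W: "elts W = (\<Union>U\<in>elts R. elts U)" using union by blast
    have "W \<epsilon> T" using T_Un[OF _ W] by (simp add: elts_subset_iff R)
    then obtain w where w: "rel f w W" using onto by blast
    have "rel r H w" if "H \<epsilon> S" for H
    proof -
      obtain V where V: "rel f H V" "\<not> x \<epsilon> V" using \<open>H \<epsilon> S\<close> unfolding S by blast
      then have "V \<epsilon> R" using \<open>H \<epsilon> S\<close> ranf unfolding R by blast
      then have "elts V \<subseteq> elts W" unfolding W by auto
      then show ?thesis using order[OF V(1) w] by blast
    qed
    then have "rel r j w" using j domf[OF w] by (simp add: is_lub_def)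
    moreover obtain V where V: "rel f j V" using total[OF jA] by blast
    ultimately have "elts V \<subseteq> elts W" using order[OF V w] by blast
    moreover have "x \<notin> elts W" unfolding W by (auto simp: R)
    ultimately have "\<not> x \<epsilon> V" by auto
    then show ?thesis using V unfolding S by blast
  qed
  then obtain Uj where Uj: "rel f j Uj" "\<not> x \<epsilon> Uj" unfolding S by blast
  have jF: "set_filter X j" and Fj: "elts F \<subseteq> elts j" using jA by (simp_all add: A)
  have j_proper: "elts U \<noteq> {}" if U: "U \<epsilon> j" for U
  proof
    assume "elts U = {}"
    then have "elts P \<subseteq> elts j" using set_filterD(3)[OF jF U] unfolding elts_subset_iff[of P] P by blast
    then have "elts UP \<subseteq> elts Uj" using order[OF UP Uj(1)] PA jA by (simp add: r)
    then show False using x Uj by auto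
  qed
  have "set_ultrafilter X j"
    unfolding set_ultrafilter_def proper_set_filter_def
  proof (intro conjI allI impI jF j_proper)
    fix G assume "(set_filter X G \<and> (\<forall>U. U \<epsilon> G \<longrightarrow> elts U \<noteq> {})) \<and> elts j \<subseteq> elts G"
    then have G: "set_filter X G" "\<And>U. U \<epsilon> G \<Longrightarrow> elts U \<noteq> {}" and jG: "elts j \<subseteq> elts G" by blast+
    have "U \<epsilon> j" if U: "U \<epsilon> G" for U
    proof -
      have UX: "elts U \<subseteq> elts X" using set_filterD(1)[OF G(1) U] .
      obtain V where V: "elts V = elts X - elts U" by (rule Diff_set)
      have VX: "elts V \<subseteq> elts X" using V by blast
      \<comment> \<open>The extensions of \<open>F\<close> by \<open>U\<close> and by its complement
        \<open>V\<close> have only \<open>F\<close> below both, and the open set of \<open>F\<close>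
        is empty. So the open set of one of them omits \<open>x\<close>, and that extension lies
        below \<open>j\<close>. It cannot be the one by \<open>V\<close>, because then
        \<open>V\<close> would join \<open>U\<close> in the proper filter \<open>G\<close>.\<close>
      obtain H1 where H1: "set_filter X H1"
        "\<And>V. V \<epsilon> H1 \<longleftrightarrow> elts V \<subseteq> elts X \<and> (\<exists>W. W \<epsilon> F \<and> elts U \<inter> elts W \<subseteq> elts V)"
        using adjoin_filter[OF F UX] by blast
      obtain H2 where H2: "set_filter X H2"
        "\<And>Z. Z \<epsilon> H2 \<longleftrightarrow> elts Z \<subseteq> elts X \<and> (\<exists>W. W \<epsilon> F \<and> elts V \<inter> elts W \<subseteq> elts Z)"
        using adjoin_filter[OF F VX] by blast
      have HA: "H1 \<epsilon> A" "H2 \<epsilon> A"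
        using H1 H2 set_filterD(1)[OF F] unfolding A elts_subset_iff[of F] by blast+
      have UH: "U \<epsilon> H1" "V \<epsilon> H2" using UX VX set_filterD(2)[OF F] unfolding H1(2) H2(2) by blast+
      obtain U1 U2 where U12: "rel f H1 U1" "rel f H2 U2" using total HA by blast
      obtain W where W: "elts W = elts U1 \<inter> elts U2" by (rule Int_set)
      then have "W \<epsilon> T" using T_Int ranf U12 by blast
      then obtain w where w: "rel f w W" using onto by blast
      have w12: "rel r w H1" "rel r w H2" using order[OF w U12(1)] order[OF w U12(2)] W by blast+
      have "Z \<epsilon> F" if "Z \<epsilon> w" for Z
      proof -
        have "Z \<epsilon> H1" "Z \<epsilon> H2" using w12 that by (auto simp: r)
        then obtain C D where ZX: "elts Z \<subseteq> elts X" and C: "C \<epsilon> F" "elts U \<inter> elts C \<subseteq> elts Z"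
          and D: "D \<epsilon> F" "elts V \<inter> elts D \<subseteq> elts Z"
          unfolding H1(2) H2(2) by blast
        obtain K where K: "elts K = elts C \<inter> elts D" by (rule Int_set)
        then have "K \<epsilon> F" using set_filterD(4)[OF F C(1) D(1)] by blast
        moreover have "elts K \<subseteq> elts Z"
          using C(2) D(2) V K set_filterD(1)[OF F C(1)] by blast
        ultimately show ?thesis using set_filterD(3)[OF F] ZX by blast
      qed
      then have "rel r w F" using domf[OF w] FA by (simp add: r elts_subset_iff)
      then have "elts W = {}" using order[OF w UF] UF_empty by blast
      then have "\<not> x \<epsilon> U1 \<or> \<not> x \<epsilon> U2" using W by auto
      then have "H1 \<epsilon> S \<or> H2 \<epsilon> S" using U12 unfolding S by blast
      moreover have "Z \<epsilon> j" if "H \<epsilon> S" "Z \<epsilon> H" for H Z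
        using S_le[OF that(1)] that(2) unfolding r elts_subset_iff by blast
      ultimately have "U \<epsilon> j \<or> V \<epsilon> j" using UH by blast
      moreover have False if "V \<epsilon> j"
      proof -
        have "V \<epsilon> G" using that jG by auto
        then have "E \<epsilon> G" using set_filterD(4)[OF G(1) U, of V E] E V by auto
        then show False using G(2) E by blast
      qed
      ultimately show ?thesis by blast
    qed
    then show "G = j" using jG by (intro set_ext) auto
  qed
  then show "\<exists>G. set_ultrafilter X G \<and> elts F \<subseteq> elts G" using Fj by blast
qed

end


theorem proposition5p1:
  fixes e :: "'a::frame \<Rightarrow> 'b::complete_lattice"
    and mem :: "'v \<Rightarrow> 'v \<Rightarrow> bool"
  shows "(canonical_extension e \<longrightarrow>
      (inj e \<longleftrightarrow>
        (\<forall>U\<in>range (open_sublocale :: 'a \<Rightarrow> 'a set). \<forall>V\<in>range open_sublocale.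
          U \<subseteq> V \<longleftrightarrow>
          (\<forall>K. compact_sublocale K \<and> fitted_sublocale K \<longrightarrow> K \<subseteq> U \<longrightarrow> K \<subseteq> V)))) \<and>
    (ZF_model mem \<longrightarrow>
      (set_structure.ultrafilter_principle mem \<longleftrightarrow> set_structure.injective_frames_spatial mem))"
proof (intro conjI impI)
  assume e: "canonical_extension e"
  show "inj e \<longleftrightarrow>
        (\<forall>U\<in>range (open_sublocale :: 'a \<Rightarrow> 'a set). \<forall>V\<in>range open_sublocale.
          U \<subseteq> V \<longleftrightarrow>
          (\<forall>K. compact_sublocale K \<and> fitted_sublocale K \<longrightarrow> K \<subseteq> U \<longrightarrow> K \<subseteq> V))"
    unfolding inj_canonical_extension_iff[OF e] ball_simps compact_fitted_separation_iff
      open_sublocale_subset_iff by simp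
next
  assume "ZF_model mem"
  then interpret ZF_model mem .
  show "ultrafilter_principle \<longleftrightarrow> injective_frames_spatial"
    using ultrafilter_principle_imp_spatial spatial_imp_ultrafilter_principle by blast
qed

end
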